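(* Let $G = \langle R \cup D\rangle$ be a periodic primary multi-GGS group acting on the rooted tree $\underline{R}^\ast$ (that is, a periodic constant spinal group whose rooted group $R$ is cyclic of prime power order). Assume that there exist a directed element $d \in D$ and a vertex $x \in \underline{R}$ corresponding to a generator of $R$ such that $d|_x$ also generates $R$. Then every maximal subgroup of $G$ has finite index, i.e. $G \in \mathcal{MF}$.
   Context: $\mathcal{MF}$ is the class of groups all of whose maximal subgroups have finite index. A group is periodic if all its elements have finite order. For a finite non-empty set $X$, $X^\ast$ denotes the rooted tree of finite words over $X$ (root the empty word $\varnothing$; $u$ is joined to $ux$ for $x\in X$). $\mathrm{Aut}(X^\ast)$ is its automorphism group, acting on the left. For $g\in\mathrm{Aut}(X^\ast)$ and $v\in X^\ast$, the section $g|_v\in \mathrm{Aut}(X^\ast)$ is defined by $g(vu)=g(v)\,g|_v(u)$ for all $u\in X^\ast$. Constant spinal groups: let $R$ be a finite group with identity $e$, let $X=\underline{R}$ be its underlying set, and write $\underline{r}\in X$ for the letter corresponding to $r\in R$. The group $R$ acts on $X$ by $r\underline{s}=\underline{rs}$, and $r\in R$ is identified with the rooted automorphism $\underline{s}w\mapsto \underline{rs}\,w$ of $X^\ast$. An automorphism $d$ is directed if it fixes every word of length $1$, $d|_{\underline{e}}=d$, and $d|_x\in R$ (a rooted automorphism) for all $x\in X\smallsetminus\{\underline{e}\}$. Let $D$ be a group of directed automorphisms with $\langle d|_x \mid d\in D,\ x\in X\smallsetminus\{\underline{e}\}\rangle = R$. Then $G=\langle R\cup D\rangle\le \mathrm{Aut}(X^\ast)$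 is called a constant spinal group with rooted group $R$ and directed group $D$. It is a multi-GGS group if $R$ is cyclic, and it is called primary if $|X|=|R|$ is a prime power. *)

theory Defs
  imports "HOL-Algebra.Bij" "HOL-Algebra.Elementary_Groups" "HOL-Number_Theory.Prime_Powers"
begin

section \<open>Groups all of whose maximal subgroups have finite index\<close>

definition maximal_subgroup :: "'a set \<Rightarrow> ('a, 'b) monoid_scheme \<Rightarrow> bool" where
  "maximal_subgroup H G \<longleftrightarrow>
     subgroup H G \<and> H \<noteq> carrier G \<and>
     (\<forall>K. subgroup K G \<and> H \<subseteq> K \<longrightarrow> K = H \<or> K = carrier G)"

definition in_MF :: "('a, 'b) monoid_scheme \<Rightarrow> bool" where
  "in_MF G \<longleftrightarrow> group G \<and> (\<forall>H. maximal_subgroup H G \<longrightarrow> finite (rcosets\<^bsub>G\<^esub> H))"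

definition periodic_group :: "('a, 'b) monoid_scheme \<Rightarrow> bool" where
  "periodic_group G \<longleftrightarrow>
     group G \<and> (\<forall>g\<in>carrier G. \<exists>n::nat. n > 0 \<and> g [^]\<^bsub>G\<^esub> n = \<one>\<^bsub>G\<^esub>)"


section \<open>Automorphisms of the rooted tree of finite words\<close>

definition tree_adj :: "'a set \<Rightarrow> 'a list \<Rightarrow> 'a list \<Rightarrow> bool" where
  "tree_adj X u v \<longleftrightarrow> (\<exists>x\<in>X. v = u @ [x] \<or> u = v @ [x])"

text \<open>As in \<^const>\<open>Bij\<close>, automorphisms are extensional: they are undefined off the vertex set.\<close>

definition tree_auts :: "'a set \<Rightarrow> ('a list \<Rightarrow> 'a list) set" where
  "tree_auts X = {f \<in> Bij (lists X). f [] = [] \<and>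
     (\<forall>u\<in>lists X. \<forall>v\<in>lists X. tree_adj X (f u) (f v) \<longleftrightarrow> tree_adj X u v)}"

definition tree_aut_group :: "'a set \<Rightarrow> ('a list \<Rightarrow> 'a list) monoid" where
  "tree_aut_group X = (BijGroup (lists X))\<lparr>carrier := tree_auts X\<rparr>"

definition tree_section :: "'a set \<Rightarrow> ('a list \<Rightarrow> 'a list) \<Rightarrow> 'a list \<Rightarrow> 'a list \<Rightarrow> 'a list" where
  "tree_section X g v =
     (THE h. h \<in> tree_auts X \<and> (\<forall>u\<in>lists X. g (v @ u) = g v @ h u))"


section \<open>Constant spinal groups\<close>

text \<open>The letters are the elements of the carrier of \<open>R\<close>, so that the tree is
  \<^term>\<open>lists (carrier R)\<close>.\<close>

definition rooted :: "('a, 'b) monoid_scheme \<Rightarrow> 'a \<Rightarrow> 'a list \<Rightarrow> 'a list" where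
  "rooted R r = (\<lambda>w \<in> lists (carrier R). case w of [] \<Rightarrow> [] | s # u \<Rightarrow> (r \<otimes>\<^bsub>R\<^esub> s) # u)"

definition rooted_auts :: "('a, 'b) monoid_scheme \<Rightarrow> ('a list \<Rightarrow> 'a list) set" where
  "rooted_auts R = rooted R ` carrier R"

definition directed_aut :: "('a, 'b) monoid_scheme \<Rightarrow> ('a list \<Rightarrow> 'a list) \<Rightarrow> bool" where
  "directed_aut R d \<longleftrightarrow>
     d \<in> tree_auts (carrier R) \<and>
     (\<forall>x\<in>carrier R. d [x] = [x]) \<and>
     tree_section (carrier R) d [\<one>\<^bsub>R\<^esub>] = d \<and>
     (\<forall>x\<in>carrier R - {\<one>\<^bsub>R\<^esub>}. tree_section (carrier R) d [x] \<in> rooted_auts R)"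

definition constant_spinal ::
    "('a, 'b) monoid_scheme \<Rightarrow> ('a list \<Rightarrow> 'a list) set \<Rightarrow> bool" where
  "constant_spinal R D \<longleftrightarrow>
     group R \<and> finite (carrier R) \<and>
     subgroup D (tree_aut_group (carrier R)) \<and>
     (\<forall>d\<in>D. directed_aut R d) \<and>
     generate (tree_aut_group (carrier R))
       {tree_section (carrier R) d [x] | d x. d \<in> D \<and> x \<in> carrier R - {\<one>\<^bsub>R\<^esub>}}
     = rooted_auts R"

definition spinal_group ::
    "('a, 'b) monoid_scheme \<Rightarrow> ('a list \<Rightarrow> 'a list) set \<Rightarrow> ('a list \<Rightarrow> 'a list) monoid" where
  "spinal_group R D = subgroup_generated (tree_aut_group (carrier R)) (rooted_auts R \<union> D)"

definition multi_GGS ::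
    "('a, 'b) monoid_scheme \<Rightarrow> ('a list \<Rightarrow> 'a list) set \<Rightarrow> bool" where
  "multi_GGS R D \<longleftrightarrow> constant_spinal R D \<and> cyclic_group R"

definition primary :: "('a, 'b) monoid_scheme \<Rightarrow> bool" where
  "primary R \<longleftrightarrow> primepow (order R)"


section \<open>Well-definedness of the notions above\<close>

lemma subgroup_tree_auts: "subgroup (tree_auts X) (BijGroup (lists X))"
proof -
  interpret B: group "BijGroup (lists X)" by (rule group_BijGroup)
  show ?thesis
  proof (rule B.subgroupI)
    show "tree_auts X \<subseteq> carrier (BijGroup (lists X))"
      by (auto simp: tree_auts_def BijGroup_def)
    have "(\<lambda>x\<in>lists X. x) \<in> tree_auts X"
      by (auto simp: tree_auts_def id_Bij)
    then show "tree_auts X \<noteq> {}" by blast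
  next
    fix a assume a: "a \<in> tree_auts X"
    then have aB: "a \<in> Bij (lists X)" by (simp add: tree_auts_def)
    then have bij: "bij_betw a (lists X) (lists X)" by (simp add: Bij_def)
    have inv: "inv\<^bsub>BijGroup (lists X)\<^esub> a = (\<lambda>x\<in>lists X. inv_into (lists X) a x)"
      using aB by (rule inv_BijGroup)
    have mem: "inv_into (lists X) a u \<in> lists X" if "u \<in> lists X" for u
      using aB that by (rule Bij_inv_into_mem)
    have app: "a (inv_into (lists X) a u) = u" if "u \<in> lists X" for u
      using bij that by (simp add: bij_betw_inv_into_right)
    have "inv_into (lists X) a [] = []"
      using bij_betw_inv_into_left[OF bij, of "[]"] a by (simp add: tree_auts_def)
    moreover have "tree_adj X (inv_into (lists X) a u) (inv_into (lists X) a v) \<longleftrightarrow> tree_adj X u v"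
      if "u \<in> lists X" "v \<in> lists X" for u v
    proof -
      have "tree_adj X (a (inv_into (lists X) a u)) (a (inv_into (lists X) a v))
          \<longleftrightarrow> tree_adj X (inv_into (lists X) a u) (inv_into (lists X) a v)"
        using a mem[OF that(1)] mem[OF that(2)] unfolding tree_auts_def by blast
      then show ?thesis using app that by simp
    qed
    ultimately show "inv\<^bsub>BijGroup (lists X)\<^esub> a \<in> tree_auts X"
      unfolding inv tree_auts_def using restrict_inv_into_Bij[OF aB] by simp
  next
    fix a b assume a: "a \<in> tree_auts X" and b: "b \<in> tree_auts X"
    have B: "a \<in> Bij (lists X)" "b \<in> Bij (lists X)" using a b by (auto simp: tree_auts_def)
    have mem: "b u \<in> lists X" if "u \<in> lists X" for u
      using Bij_imp_funcset[OF B(2)] that by (rule funcset_mem)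
    have "compose (lists X) a b \<in> tree_auts X"
      unfolding tree_auts_def
    proof (intro CollectI conjI ballI)
      show "compose (lists X) a b \<in> Bij (lists X)" using B by (rule compose_Bij)
      show "compose (lists X) a b [] = []" using a b by (simp add: compose_def tree_auts_def)
      fix u v assume uv: "u \<in> lists X" "v \<in> lists X"
      have "tree_adj X (a (b u)) (a (b v)) \<longleftrightarrow> tree_adj X (b u) (b v)"
        using a mem[OF uv(1)] mem[OF uv(2)] unfolding tree_auts_def by blast
      also have "\<dots> \<longleftrightarrow> tree_adj X u v" using b uv unfolding tree_auts_def by blast
      finally show "tree_adj X (compose (lists X) a b u) (compose (lists X) a b v)
          \<longleftrightarrow> tree_adj X u v" using uv by (simp add: compose_eq)
    qed
    then show "a \<otimes>\<^bsub>BijGroup (lists X)\<^esub> b \<in> tree_auts X"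
      using B by (simp add: BijGroup_def)
  qed
qed

lemma group_tree_aut_group: "group (tree_aut_group X)"
  unfolding tree_aut_group_def
  using group.subgroup_imp_group[OF group_BijGroup subgroup_tree_auts] .

lemma tree_auts_closed: "f \<in> tree_auts X \<Longrightarrow> u \<in> lists X \<Longrightarrow> f u \<in> lists X"
  unfolding tree_auts_def using Bij_imp_funcset by (blast dest: funcset_mem)

lemma tree_auts_inj:
  "f \<in> tree_auts X \<Longrightarrow> u \<in> lists X \<Longrightarrow> v \<in> lists X \<Longrightarrow> f u = f v \<longleftrightarrow> u = v"
  unfolding tree_auts_def Bij_def bij_betw_def by (auto dest: inj_onD)

lemma tree_auts_child:
  assumes f: "f \<in> tree_auts X"
  shows "u \<in> lists X \<Longrightarrow> x \<in> X \<Longrightarrow> \<exists>y\<in>X. f (u @ [x]) = f u @ [y]"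
proof (induction u arbitrary: x rule: rev_induct)
  case Nil
  have "[] \<in> lists X" "[x] \<in> lists X" "tree_adj X [] [x]"
    using Nil by (auto simp: tree_adj_def)
  then have "tree_adj X (f []) (f [x])"
    using f unfolding tree_auts_def by blast
  then show ?case using f by (auto simp: tree_adj_def tree_auts_def)
next
  case (snoc z u)
  have u: "u \<in> lists X" "z \<in> X" "u @ [z] \<in> lists X" "u @ [z, x] \<in> lists X"
    using snoc.prems by auto
  have "tree_adj X (u @ [z]) (u @ [z, x])" using snoc.prems by (auto simp: tree_adj_def)
  then have "tree_adj X (f (u @ [z])) (f (u @ [z, x]))"
    using f u unfolding tree_auts_def by blast
  then obtain y where y: "y \<in> X"
      "f (u @ [z, x]) = f (u @ [z]) @ [y] \<or> f (u @ [z]) = f (u @ [z, x]) @ [y]"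
    by (auto simp: tree_adj_def)
  obtain z' where "f (u @ [z]) = f u @ [z']" using snoc.IH[OF u(1,2)] by blast
  moreover have "f (u @ [z, x]) \<noteq> f u" using tree_auts_inj[OF f u(4,1)] by simp
  ultimately show ?case using y by auto
qed

lemma tree_auts_length:
  assumes f: "f \<in> tree_auts X" shows "u \<in> lists X \<Longrightarrow> length (f u) = length u"
proof (induction u rule: rev_induct)
  case Nil then show ?case using f by (simp add: tree_auts_def)
next
  case (snoc x u)
  then show ?case using tree_auts_child[OF f, of u x] by auto
qed

lemma tree_auts_append:
  assumes f: "f \<in> tree_auts X" and v: "v \<in> lists X"
  shows "u \<in> lists X \<Longrightarrow> f (v @ u) = f v @ drop (length v) (f (v @ u))"
proof (induction u rule: rev_induct)
  case Nil
  then show ?case using tree_auts_length[OF f v] by simp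
next
  case (snoc x u)
  then obtain y where "f (v @ u @ [x]) = f (v @ u) @ [y]"
    using tree_auts_child[OF f, of "v @ u" x] v by auto
  with snoc tree_auts_length[OF f v] show ?case
    by (metis append.assoc append_eq_conv_conj append_in_lists_conv)
qed

lemma tree_section_ex1:
  assumes g: "g \<in> tree_auts X" and v: "v \<in> lists X"
  shows "\<exists>!h. h \<in> tree_auts X \<and> (\<forall>u\<in>lists X. g (v @ u) = g v @ h u)"
proof (rule ex_ex1I)
  define h where "h = (\<lambda>u\<in>lists X. drop (length v) (g (v @ u)))"
  have eq: "g (v @ u) = g v @ h u" if "u \<in> lists X" for u
    using tree_auts_append[OF g v that] that by (simp add: h_def)
  have closed: "h u \<in> lists X" if "u \<in> lists X" for u
    using tree_auts_closed[OF g, of "v @ u"] eq[OF that] v that by simp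
  have inj: "inj_on h (lists X)"
  proof (rule inj_onI)
    fix a b assume "a \<in> lists X" "b \<in> lists X" "h a = h b"
    then show "a = b" using eq[of a] eq[of b] tree_auts_inj[OF g, of "v @ a" "v @ b"] v by simp
  qed
  have surj: "\<exists>u\<in>lists X. h u = w" if w: "w \<in> lists X" for w
  proof -
    have "g v @ w \<in> lists X" using tree_auts_closed[OF g v] w by simp
    moreover have "g ` lists X = lists X"
      using g by (simp add: tree_auts_def Bij_def bij_betw_def)
    ultimately obtain t where t: "t \<in> lists X" "g t = g v @ w" by (metis imageE)
    define t1 where "t1 = take (length v) t"
    define t2 where "t2 = drop (length v) t"
    have t12: "t = t1 @ t2" by (simp add: t1_def t2_def)
    then have tl: "t1 \<in> lists X" "t2 \<in> lists X" using t(1) by auto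
    have "length t = length v + length w"
      using t tree_auts_length[OF g t(1)] tree_auts_length[OF g v] by simp
    then have len: "length t1 = length v" by (simp add: t1_def)
    have "g t = g t1 @ drop (length t1) (g t)"
      using tree_auts_append[OF g tl] t12 by simp
    then have "g t1 = g v"
      using t(2) tree_auts_length[OF g tl(1)] tree_auts_length[OF g v] len
      by (metis append_eq_append_conv)
    then have "t1 = v" using tree_auts_inj[OF g tl(1) v] by simp
    then have "h t2 = w" using t(2) t12 eq[OF tl(2)] by simp
    then show ?thesis using tl by blast
  qed
  have "h ` lists X = lists X" using closed surj by blast
  moreover have "h \<in> extensional (lists X)" by (simp add: h_def)
  ultimately have "h \<in> Bij (lists X)" using inj by (simp add: Bij_def bij_betw_def)
  moreover have "h [] = []" using eq[of "[]"] by simp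
  moreover have "tree_adj X (h a) (h b) \<longleftrightarrow> tree_adj X a b"
    if "a \<in> lists X" "b \<in> lists X" for a b
  proof -
    have pre: "tree_adj X (c @ a') (c @ b') \<longleftrightarrow> tree_adj X a' b'" for c a' b'
      by (auto simp: tree_adj_def)
    have "v @ a \<in> lists X" "v @ b \<in> lists X" using v that by auto
    then have "tree_adj X (g (v @ a)) (g (v @ b)) \<longleftrightarrow> tree_adj X (v @ a) (v @ b)"
      using g unfolding tree_auts_def by blast
    then show ?thesis using eq that pre by simp
  qed
  ultimately have "h \<in> tree_auts X" by (simp add: tree_auts_def)
  then show "\<exists>h. h \<in> tree_auts X \<and> (\<forall>u\<in>lists X. g (v @ u) = g v @ h u)"
    using eq by blast
next
  fix h k
  assume h: "h \<in> tree_auts X \<and> (\<forall>u\<in>lists X. g (v @ u) = g v @ h u)"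
    and k: "k \<in> tree_auts X \<and> (\<forall>u\<in>lists X. g (v @ u) = g v @ k u)"
  have "h \<in> extensional (lists X)" "k \<in> extensional (lists X)"
    using h k by (auto simp: tree_auts_def Bij_def)
  then show "h = k"
    by (rule extensionalityI) (use h k in force)
qed

lemma tree_section_in_tree_auts:
  "g \<in> tree_auts X \<Longrightarrow> v \<in> lists X \<Longrightarrow> tree_section X g v \<in> tree_auts X"
  using theI'[OF tree_section_ex1[of g X v]] unfolding tree_section_def by blast

lemma tree_section_eq:
  "g \<in> tree_auts X \<Longrightarrow> v \<in> lists X \<Longrightarrow> u \<in> lists X \<Longrightarrow>
     g (v @ u) = g v @ tree_section X g v u"
  using theI'[OF tree_section_ex1[of g X v]] unfolding tree_section_def by blast

lemma rooted_in_tree_auts: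
  fixes R (structure)
  assumes "group R" and r: "r \<in> carrier R"
  shows "rooted R r \<in> tree_auts (carrier R)"
proof -
  interpret group R by fact
  let ?L = "lists (carrier R)"
  have closed: "rooted R s w \<in> ?L" if "s \<in> carrier R" "w \<in> ?L" for s w
    using that by (auto simp: rooted_def split: list.split)
  have inv: "rooted R (inv s) (rooted R s w) = w" if "s \<in> carrier R" "w \<in> ?L" for s w
    using that closed[OF that] by (auto simp: rooted_def m_assoc[symmetric] split: list.split)
  have inv': "rooted R r (rooted R (inv r) w) = w" if "w \<in> ?L" for w
    using inv[of "inv r" w] r that by simp
  have "bij_betw (rooted R r) ?L ?L"
    by (rule bij_betw_byWitness[where f' = "rooted R (inv r)"])
       (use inv[OF r] inv' closed[OF r] closed[OF inv_closed[OF r]] in blast)+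
  then have "rooted R r \<in> Bij ?L" by (simp add: Bij_def rooted_def)
  moreover have imp: "tree_adj (carrier R) (rooted R s u) (rooted R s v)"
    if "s \<in> carrier R" "u \<in> ?L" "v \<in> ?L" "tree_adj (carrier R) u v" for s u v
    using that by (auto simp: tree_adj_def rooted_def split: list.split)
  moreover have "tree_adj (carrier R) u v"
    if "u \<in> ?L" "v \<in> ?L" "tree_adj (carrier R) (rooted R r u) (rooted R r v)" for u v
    using imp[of "inv r" "rooted R r u" "rooted R r v"] that closed r inv[OF r] by simp
  moreover have "rooted R r [] = []" by (simp add: rooted_def)
  ultimately show ?thesis
    using r unfolding tree_auts_def by blast
qed

end

theory Submission
  imports Defs "HOL-Algebra.Multiplicative_Group"
begin

text \<open>Let \<open>G\<close> be the group, \<open>q = p ^ k\<close> the order of its rooted group, and \<open>M\<close> a maximal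
  subgroup of infinite index. Then \<open>M\<close> is dense: \<open>M N = G\<close> for every normal subgroup \<open>N\<close> of finite
  index, and density passes to the sections of \<open>M\<close> at vertices.

  The hypothesis on \<open>d\<close> and periodicity imply that the elements of \<open>G\<close> supported on one first-level
  subtree form a subgroup of finite index in the corresponding copy of \<open>G\<close>. As \<open>G\<close> is a finitely
  generated torsion group, derived subgroups of subgroups of finite index have finite index again,
  so \<open>G\<close> is just infinite. It follows that a dense subgroup one of whose sections is \<open>G\<close> equals \<open>G\<close>.

  On the other hand some section of a dense subgroup is \<open>G\<close> up to conjugation. Writing elements as
  words in conjugates of directed elements, powers and sections never increase the length, and by
  periodicity they reduce an element to a single directed letter; a second length reduction aligns a
  generator of the rooted group with such a letter, after which the remaining directed elements
  can be collected one after the other.\<close>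

section \<open>Groups as a type class\<close>

text \<open>Periodicity acts through orbit sums. If \<open>u\<close> has order n modulo
  \<open>q\<close>, the n-th power of \<open>rt u * d\<close> has at letter 0 the section
  \<open>rt u' * d\<close>, where u' sums the exponents of \<open>d\<close> over the subgroup
  generated by \<open>u\<close>. Were u' to generate that same subgroup again and again, the element
  would have infinite order. Hence the sum over the multiples of p^j is divisible by p^(j+1). For j
  = 0 the exponents of \<open>d\<close> sum to a multiple of \<open>p\<close>: this keeps the
  determinants of the branching argument from all vanishing and forces a second unit exponent beside
  a given one. For larger j it makes the rooted part shrink in the length reduction. No branching
  subgroup is computed from the exponents. Instead \<open>K\<close>, the set of sections of elements
  supported on one subtree, is reached through \<open>Z\<close>, the preimage of the centre of
  \<open>G\<close> modulo \<open>K\<close>: it suffices that \<open>G\<close> be abelian modulo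
  \<open>Z\<close>, since two passages to a derived subgroup keep the index finite.\<close>

class mult_group = monoid_mult + inverse +
  assumes left_inverse_mg: "inverse x * x = 1"
begin

sublocale mg: Groups.group times 1 inverse
  by unfold_locales (simp_all add: mult.assoc left_inverse_mg)

lemma mg_simps [simp]:
  "inverse x * x = 1" "x * inverse x = 1" "inverse x * (x * y) = y" "x * (inverse x * y) = y"
  "inverse (inverse x) = x" "inverse 1 = 1" "inverse (x * y) = inverse y * inverse x"
  by (simp_all add: mult.assoc[symmetric] mg.inverse_distrib_swap)

lemma mg_cancel [simp]:
  "x * y = x * z \<longleftrightarrow> y = z" "y * x = z * x \<longleftrightarrow> y = z"
  by (simp_all add: mg.left_cancel mg.right_cancel)

lemma mg_eq_1_iff: "x * y = 1 \<longleftrightarrow> y = inverse x"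
  by (metis mg_simps(2) mg_simps(3) mult_1_right)

lemma mg_inv_mult_eq_1_iff: "inverse x * y = 1 \<longleftrightarrow> x = y"
  by (metis mg_simps(4) mg_simps(1) mult_1_right)

definition comm :: "'a \<Rightarrow> 'a \<Rightarrow> 'a" where
  "comm x y = x * y * inverse x * inverse y"

definition subgrp :: "'a set \<Rightarrow> bool" where
  "subgrp H \<longleftrightarrow> 1 \<in> H \<and> (\<forall>x\<in>H. \<forall>y\<in>H. x * y \<in> H) \<and> (\<forall>x\<in>H. inverse x \<in> H)"

definition nrm :: "'a set \<Rightarrow> 'a set \<Rightarrow> bool" where
  "nrm N G \<longleftrightarrow> subgrp N \<and> N \<subseteq> G \<and> (\<forall>g\<in>G. \<forall>n\<in>N. g * n * inverse g \<in> N)"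

inductive_set gen :: "'a set \<Rightarrow> 'a set" for S where
  gen_one [intro, simp]: "1 \<in> gen S"
| gen_mult: "x \<in> gen S \<Longrightarrow> s \<in> S \<Longrightarrow> x * s \<in> gen S"
| gen_inv: "x \<in> gen S \<Longrightarrow> s \<in> S \<Longrightarrow> x * inverse s \<in> gen S"

definition der :: "'a set \<Rightarrow> 'a set" where
  "der A = gen {comm x y | x y. x \<in> A \<and> y \<in> A}"

text \<open>Finite index is expressed by a colouring with finitely many colours that refines the
  partition into cosets.\<close>

definition fin_index :: "'a set \<Rightarrow> 'a set \<Rightarrow> bool" where
  "fin_index A B \<longleftrightarrow> (\<exists>f :: 'a \<Rightarrow> nat. finite (f ` B) \<and>
     (\<forall>b\<in>B. \<forall>c\<in>B. f b = f c \<longrightarrow> inverse b * c \<in> A))"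

lemma comm_conj: "g * comm x y * inverse g = comm (g * x * inverse g) (g * y * inverse g)"
  by (simp add: comm_def mult.assoc)

lemma comm_eq_1_iff: "comm x y = 1 \<longleftrightarrow> x * y = y * x"
  unfolding comm_def
  by (metis mg_inv_mult_eq_1_iff mg_simps(5,7) mult.assoc mg_eq_1_iff)

lemma comm_one [simp]: "comm 1 x = 1" "comm x 1 = 1"
  by (simp_all add: comm_def)

lemma subgrp_one: "subgrp H \<Longrightarrow> 1 \<in> H"
  and subgrp_mult: "subgrp H \<Longrightarrow> x \<in> H \<Longrightarrow> y \<in> H \<Longrightarrow> x * y \<in> H"
  and subgrp_inv: "subgrp H \<Longrightarrow> x \<in> H \<Longrightarrow> inverse x \<in> H"
  by (auto simp: subgrp_def)

lemma subgrp_comm: "subgrp H \<Longrightarrow> x \<in> H \<Longrightarrow> y \<in> H \<Longrightarrow> comm x y \<in> H"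
  by (simp add: comm_def subgrp_def)

lemma subgrp_power: "subgrp H \<Longrightarrow> x \<in> H \<Longrightarrow> x ^ n \<in> H"
  by (induction n) (auto simp: subgrp_def)

lemma subgrp_mult_iff: "subgrp H \<Longrightarrow> x \<in> H \<Longrightarrow> x * y \<in> H \<longleftrightarrow> y \<in> H"
  "subgrp H \<Longrightarrow> y \<in> H \<Longrightarrow> x * y \<in> H \<longleftrightarrow> x \<in> H"
   by (metis mg_simps(3) subgrp_def) (metis mg_simps(2) mult.assoc mult_1_right subgrp_def)

lemma subgrp_inv_iff: "subgrp H \<Longrightarrow> inverse x \<in> H \<longleftrightarrow> x \<in> H"
  by (metis mg_simps(5) subgrp_inv)

lemma subgrp_Int: "subgrp H \<Longrightarrow> subgrp K \<Longrightarrow> subgrp (H \<inter> K)"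
  by (auto simp: subgrp_def)

lemma nrm_subgrp: "nrm N G \<Longrightarrow> subgrp N"
  and nrm_sub: "nrm N G \<Longrightarrow> N \<subseteq> G"
  and nrm_conj: "nrm N G \<Longrightarrow> g \<in> G \<Longrightarrow> n \<in> N \<Longrightarrow> g * n * inverse g \<in> N"
  by (auto simp: nrm_def)

lemma nrm_conj': "nrm N G \<Longrightarrow> subgrp G \<Longrightarrow> g \<in> G \<Longrightarrow> n \<in> N \<Longrightarrow> inverse g * n * g \<in> N"
  by (metis mg_simps(5) nrm_conj subgrp_inv)

lemma nrm_refl: "subgrp G \<Longrightarrow> nrm G G"
  by (auto simp: nrm_def subgrp_def)

lemma nrm_Int: "nrm N G \<Longrightarrow> nrm K G \<Longrightarrow> nrm (N \<inter> K) G"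
  by (auto simp: nrm_def subgrp_Int)

lemma nrm_comm_left: "nrm N G \<Longrightarrow> subgrp G \<Longrightarrow> n \<in> N \<Longrightarrow> g \<in> G \<Longrightarrow> comm n g \<in> N"
  unfolding comm_def using nrm_conj[of N G g "inverse n"] subgrp_mult[OF nrm_subgrp[of N G]]
    subgrp_inv[OF nrm_subgrp[of N G]] by (simp add: mult.assoc)

lemma comm_mult_left: "comm (x * y) g = x * comm y g * inverse x * comm x g"
  by (simp add: comm_def mult.assoc)

lemma comm_inv_left: "comm (inverse x) g = inverse x * inverse (comm x g) * x"
  by (simp add: comm_def mult.assoc)

lemma comm_swap: "comm x y = inverse (comm y x)"
  by (simp add: comm_def mult.assoc)

text \<open>Because \<open>N\<close> is normal in \<open>G\<close>, the identities for commutators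
  of products and inverses close this set. Commutation with \<open>g\<close> modulo \<open>N\<close>
  can thus be checked on generators of \<open>G\<close>.\<close>

lemma subgrp_comm_left:
  assumes N: "nrm N G" and G: "subgrp G"
  shows "subgrp {x \<in> G. comm x g \<in> N}"
proof -
  note Ns = nrm_subgrp[OF N]
  show ?thesis unfolding subgrp_def
  proof (intro conjI ballI)
    show "1 \<in> {x \<in> G. comm x g \<in> N}" using G Ns by (simp add: subgrp_one)
  next
    fix x y assume "x \<in> {x \<in> G. comm x g \<in> N}" "y \<in> {x \<in> G. comm x g \<in> N}"
    then show "x * y \<in> {x \<in> G. comm x g \<in> N}"
      using nrm_conj[OF N, of x "comm y g"] subgrp_mult[OF Ns] subgrp_mult[OF G]
      by (simp add: comm_mult_left)
  next
    fix x assume "x \<in> {x \<in> G. comm x g \<in> N}"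
    then show "inverse x \<in> {x \<in> G. comm x g \<in> N}"
      using nrm_conj'[OF N G, of x "inverse (comm x g)"] subgrp_inv[OF Ns, of "comm x g"]
        subgrp_inv[OF G]
      by (simp add: comm_inv_left del: mg_simps(7))
  qed
qed

lemma subgrp_comm_right:
  assumes N: "nrm N G" and G: "subgrp G"
  shows "subgrp {x \<in> G. comm g x \<in> N}"
proof -
  have "comm g x \<in> N \<longleftrightarrow> comm x g \<in> N" for x
    using comm_swap subgrp_inv_iff[OF nrm_subgrp[OF N]] by metis
  then show ?thesis using subgrp_comm_left[OF N G] by simp
qed

lemma gen_incl: "s \<in> S \<Longrightarrow> s \<in> gen S"
  using gen_mult[of 1 S s] by simp

lemma gen_mult_closed: assumes "y \<in> gen S" "x \<in> gen S" shows "x * y \<in> gen S"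
  using assms by (induction) (auto simp: mult.assoc[symmetric] intro: gen.intros)

lemma gen_inv_closed: assumes "x \<in> gen S" shows "inverse x \<in> gen S"
  using assms
proof (induction)
  case (gen_mult x s)
  then show ?case using gen_mult_closed[of "inverse x" S "inverse s"] gen.gen_inv[of 1 S s] by simp
next
  case (gen_inv x s)
  then show ?case using gen_mult_closed[of "inverse x" S s] gen_incl[of s S] by simp
qed simp

lemma subgrp_gen: "subgrp (gen S)"
  by (simp add: subgrp_def gen_mult_closed gen_inv_closed)

lemma gen_least: assumes "subgrp H" "S \<subseteq> H" shows "gen S \<subseteq> H"
proof
  fix x assume "x \<in> gen S"
  then show "x \<in> H" by induction (use assms in \<open>auto simp: subgrp_def\<close>)
qed

lemma subgrp_der: "subgrp (der A)"
  by (simp add: der_def subgrp_gen)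

lemma comm_in_der: "x \<in> A \<Longrightarrow> y \<in> A \<Longrightarrow> comm x y \<in> der A"
  unfolding der_def by (rule gen_incl) blast

lemma der_least: "subgrp H \<Longrightarrow> (\<And>x y. x \<in> A \<Longrightarrow> y \<in> A \<Longrightarrow> comm x y \<in> H) \<Longrightarrow> der A \<subseteq> H"
  unfolding der_def by (rule gen_least) auto

lemma nrm_gen:
  assumes "subgrp G" "S \<subseteq> G" "\<And>g s. g \<in> G \<Longrightarrow> s \<in> S \<Longrightarrow> g * s * inverse g \<in> S"
  shows "nrm (gen S) G"
  unfolding nrm_def
proof (intro conjI ballI)
  show "gen S \<subseteq> G" using assms gen_least by blast
  fix g n assume "g \<in> G" "n \<in> gen S"
  from this(2) show "g * n * inverse g \<in> gen S"
  proof induction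
    case (gen_mult x s)
    have "g * (x * s) * inverse g = (g * x * inverse g) * (g * s * inverse g)"
      by (simp add: mult.assoc)
    then show ?case using gen_mult assms(3)[OF \<open>g \<in> G\<close>] gen.gen_mult by presburger
  next
    case (gen_inv x s)
    have "g * (x * inverse s) * inverse g = (g * x * inverse g) * inverse (g * s * inverse g)"
      by (simp add: mult.assoc)
    then show ?case using gen_inv assms(3)[OF \<open>g \<in> G\<close>] gen.gen_inv by presburger
  qed simp
qed (rule subgrp_gen)

lemma nrm_der: assumes "nrm A G" "subgrp G" shows "nrm (der A) G"
  unfolding der_def
proof (rule nrm_gen)
  have "A \<subseteq> G" by (rule nrm_sub[OF assms(1)])
  then show "{comm x y |x y. x \<in> A \<and> y \<in> A} \<subseteq> G" using subgrp_comm[OF assms(2)] by blast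
  fix g s assume "g \<in> G" "s \<in> {comm x y |x y. x \<in> A \<and> y \<in> A}"
  then show "g * s * inverse g \<in> {comm x y |x y. x \<in> A \<and> y \<in> A}"
    using nrm_conj[OF assms(1)] comm_conj by blast
qed fact

section \<open>Calculus of finite index by colourings\<close>

lemma fin_indexI:
  assumes fin: "finite (f ` B)" and eq: "\<And>b c. b \<in> B \<Longrightarrow> c \<in> B \<Longrightarrow> f b = f c \<Longrightarrow> inverse b * c \<in> A"
  shows "fin_index A B"
proof -
  obtain h :: "'b \<Rightarrow> nat" where h: "inj_on h (f ` B)"
    using finite_imp_inj_to_nat_seg[OF fin] by blast
  show ?thesis unfolding fin_index_def
  proof (intro exI[of _ "h \<circ> f"] conjI ballI impI)
    show "finite ((h \<circ> f) ` B)" using finite_imageI[OF fin, of h] by (simp add: image_comp)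
    fix b c assume "b \<in> B" "c \<in> B" "(h \<circ> f) b = (h \<circ> f) c"
    then show "inverse b * c \<in> A" using eq h by (auto dest!: inj_onD)
  qed
qed

lemma fin_index_refl: "subgrp G \<Longrightarrow> fin_index G G"
  by (rule fin_indexI[where f = "\<lambda>_. ()"]) (auto simp: subgrp_def)

lemma fin_index_mono: "fin_index A B \<Longrightarrow> A \<subseteq> A' \<Longrightarrow> fin_index A' B"
  unfolding fin_index_def by blast

lemma fin_index_Int: assumes "fin_index A G" "fin_index B G" shows "fin_index (A \<inter> B) G"
proof -
  obtain f g :: "'a \<Rightarrow> nat" where fg: "finite (f ` G)" "finite (g ` G)"
    "\<And>b c. b \<in> G \<Longrightarrow> c \<in> G \<Longrightarrow> f b = f c \<Longrightarrow> inverse b * c \<in> A"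
    "\<And>b c. b \<in> G \<Longrightarrow> c \<in> G \<Longrightarrow> g b = g c \<Longrightarrow> inverse b * c \<in> B"
    using assms unfolding fin_index_def by blast
  show ?thesis
  proof (rule fin_indexI[where f = "\<lambda>x. (f x, g x)"])
    show "finite ((\<lambda>x. (f x, g x)) ` G)"
      by (rule finite_subset[of _ "f ` G \<times> g ` G"]) (use fg in auto)
  qed (use fg in auto)
qed

lemma fin_index_preimage:
  assumes "fin_index A B" "subgrp C"
    and \<phi>: "\<And>c. c \<in> C \<Longrightarrow> \<phi> c \<in> B"
    and hom: "\<And>b c. b \<in> C \<Longrightarrow> c \<in> C \<Longrightarrow> \<phi> (inverse b * c) = inverse (\<phi> b) * \<phi> c"
  shows "fin_index {c \<in> C. \<phi> c \<in> A} C"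
proof -
  obtain f :: "'a \<Rightarrow> nat" where f: "finite (f ` B)"
    "\<And>b c. b \<in> B \<Longrightarrow> c \<in> B \<Longrightarrow> f b = f c \<Longrightarrow> inverse b * c \<in> A"
    using assms(1) unfolding fin_index_def by blast
  show ?thesis
  proof (rule fin_indexI[where f = "f \<circ> \<phi>"])
    show "finite ((f \<circ> \<phi>) ` C)"
      by (rule finite_subset[OF _ f(1)]) (use \<phi> in auto)
  qed (use f \<phi> hom assms(2) in \<open>auto simp: subgrp_def\<close>)
qed

lemma fin_index_trans:
  assumes "fin_index A B" "fin_index B C" "subgrp C" "B \<subseteq> C"
  shows "fin_index A C"
proof -
  obtain f g :: "'a \<Rightarrow> nat" where fg: "finite (f ` B)" "finite (g ` C)"
    "\<And>b c. b \<in> B \<Longrightarrow> c \<in> B \<Longrightarrow> f b = f c \<Longrightarrow> inverse b * c \<in> A"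
    "\<And>b c. b \<in> C \<Longrightarrow> c \<in> C \<Longrightarrow> g b = g c \<Longrightarrow> inverse b * c \<in> B"
    using assms unfolding fin_index_def by blast
  \<comment> \<open>\<open>r\<close> picks a representative of each colour class of
    \<open>C\<close>; dividing by it lands in \<open>B\<close>, where the colouring \<open>f\<close>
    takes over.\<close>
  define r where "r = (\<lambda>n. SOME c. c \<in> C \<and> g c = n)"
  have r: "r (g c) \<in> C \<and> g (r (g c)) = g c" if "c \<in> C" for c
    unfolding r_def by (rule someI[of _ c]) (use that in simp)
  define \<phi> where "\<phi> = (\<lambda>c. inverse (r (g c)) * c)"
  have \<phi>: "\<phi> c \<in> B" if "c \<in> C" for c
    unfolding \<phi>_def using r[OF that] fg(4) that by blast
  show ?thesis
  proof (rule fin_indexI[where f = "\<lambda>c. (g c, f (\<phi> c))"])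
    show "finite ((\<lambda>c. (g c, f (\<phi> c))) ` C)"
      by (rule finite_subset[of _ "g ` C \<times> f ` B"]) (use fg \<phi> in auto)
    fix b c assume bc: "b \<in> C" "c \<in> C" "(g b, f (\<phi> b)) = (g c, f (\<phi> c))"
    then have "inverse (\<phi> b) * \<phi> c \<in> A" using fg(3) \<phi> by blast
    then show "inverse b * c \<in> A" using bc by (simp add: \<phi>_def mult.assoc)
  qed
qed

lemma fin_index_transversal:
  assumes "fin_index A G" "subgrp G" "subgrp A" "A \<subseteq> G"
  obtains T where "finite T" "T \<subseteq> G" "\<And>g. g \<in> G \<Longrightarrow> \<exists>t\<in>T. g * inverse t \<in> A"
proof -
  obtain f :: "'a \<Rightarrow> nat" where f: "finite (f ` G)"
    "\<And>b c. b \<in> G \<Longrightarrow> c \<in> G \<Longrightarrow> f b = f c \<Longrightarrow> inverse b * c \<in> A"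
    using assms(1) unfolding fin_index_def by blast
  define r where "r = (\<lambda>n. SOME c. c \<in> G \<and> f c = n)"
  have r: "r (f c) \<in> G \<and> f (r (f c)) = f c" if "c \<in> G" for c
    unfolding r_def by (rule someI[of _ c]) (use that in simp)
  show ?thesis
  proof
    \<comment> \<open>Colours compare \<open>inverse b * c\<close>; inverting the representatives
      turns left cosets into right cosets.\<close>
    show "finite ((\<lambda>n. inverse (r n)) ` f ` G)" using f(1) by simp
    show "(\<lambda>n. inverse (r n)) ` f ` G \<subseteq> G" using r assms(2) by (auto simp: subgrp_def)
    fix g assume g: "g \<in> G"
    have ig: "inverse g \<in> G" using g assms(2) subgrp_inv by blast
    have "inverse (inverse g) * r (f (inverse g)) \<in> A"
      using f(2)[OF ig, of "r (f (inverse g))"] r[OF ig] by metis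
    then show "\<exists>t\<in>(\<lambda>n. inverse (r n)) ` f ` G. g * inverse t \<in> A"
      using ig by auto
  qed
qed

lemma fin_index_from_transversal:
  assumes "finite T" "subgrp A" "subgrp G" "\<And>g. g \<in> G \<Longrightarrow> \<exists>t\<in>T. g * inverse t \<in> A"
  shows "fin_index A G"
proof -
  obtain \<tau> where \<tau>: "\<And>g. g \<in> G \<Longrightarrow> \<tau> g \<in> T \<and> g * inverse (\<tau> g) \<in> A"
    using assms(4) by metis
  show ?thesis
  proof (rule fin_indexI[where f = "\<lambda>g. \<tau> (inverse g)"])
    show "finite ((\<lambda>g. \<tau> (inverse g)) ` G)"
      by (rule finite_subset[OF _ assms(1)]) (use \<tau> assms(3) in \<open>auto simp: subgrp_def\<close>)
    fix b c assume bc: "b \<in> G" "c \<in> G" "\<tau> (inverse b) = \<tau> (inverse c)"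
    have i: "inverse b \<in> G" "inverse c \<in> G" using bc assms(3) subgrp_inv by auto
    have "(inverse b * inverse (\<tau> (inverse b))) * inverse (inverse c * inverse (\<tau> (inverse c))) \<in> A"
      using \<tau>[OF i(1)] \<tau>[OF i(2)] assms(2) subgrp_mult subgrp_inv by blast
    then show "inverse b * c \<in> A" by (simp add: bc(3) mult.assoc)
  qed
qed

section \<open>Derived subgroups in finitely generated torsion groups\<close>

lemma torsion_mod_bound:
  fixes x :: 'a and n :: nat
  assumes "x ^ n = 1" "n > 0" shows "\<exists>i<n. x ^ m = x ^ i" and "\<exists>i<n. inverse x ^ m = x ^ i"
proof -
  have "x ^ m = x ^ (m mod n)" for m
  proof -
    have "x ^ m = x ^ (n * (m div n) + m mod n)" by simp
    also have "\<dots> = (x ^ n) ^ (m div n) * x ^ (m mod n)" by (simp only: power_add power_mult)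
    finally show ?thesis using assms by simp
  qed
  then show 1: "\<exists>i<n. x ^ m = x ^ i" for m using assms(2) by (metis mod_less_divisor)
  have "x * x ^ (n - 1) = 1" using assms by (metis power_eq_if less_numeral_extra(3))
  then have "inverse x = x ^ (n - 1)" by (metis mg_eq_1_iff)
  then have "inverse x ^ m = x ^ ((n - 1) * m)" by (simp add: power_mult)
  then show "\<exists>i<n. inverse x ^ m = x ^ i" using 1 by metis
qed

text \<open>Modulo \<open>der A\<close> the generators commute and have finite order, so finitely
  many products of bounded powers represent everything. The induction adds one generator
  \<open>f\<close> and collects its powers on the right, each exchange costing an element of
  \<open>der A\<close>.\<close>

lemma gen_abelian_mod_finite:
  assumes A: "subgrp A" and F: "finite F" "F \<subseteq> A"
    and tor: "\<And>x. x \<in> F \<Longrightarrow> \<exists>n::nat. n > 0 \<and> x ^ n = 1"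
  shows "\<exists>E. finite E \<and> (\<forall>x\<in>gen F. \<exists>b\<in>der A. \<exists>e\<in>E. x = b * e)"
  using F tor
proof (induction F rule: finite_induct)
  case empty
  have "x = 1" if "x \<in> gen {}" for x using that by induction auto
  then show ?case using subgrp_one[OF subgrp_der] by (intro exI[of _ "{1}"]) force
next
  case (insert f F)
  note D = subgrp_der[of A]
  have nD: "nrm (der A) A" using nrm_der[OF nrm_refl[OF A] A] .
  obtain E where E: "finite E" "\<And>x. x \<in> gen F \<Longrightarrow> \<exists>b\<in>der A. \<exists>e\<in>E. x = b * e"
    using insert by auto
  obtain n :: nat where n: "n > 0" "f ^ n = 1" using insert.prems by blast
  have fA: "f \<in> A" and FA: "F \<subseteq> A" using insert.prems by auto
  have gF: "gen F \<subseteq> A" by (rule gen_least[OF A FA])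
  have invpow: "inverse f = f ^ (n - 1)"
    using n by (metis mg_eq_1_iff power_eq_if less_numeral_extra(3))
  have swap: "\<exists>c\<in>der A. b * y * f ^ i * g = c * (y * g) * f ^ i"
    if "b \<in> der A" "y \<in> A" "g \<in> A" for b y g i
  proof -
    have fi: "f ^ i \<in> A" using fA A subgrp_power by blast
    have "b * y * f ^ i * g = (b * (y * comm (f ^ i) g * inverse y)) * (y * g) * f ^ i"
      by (simp add: comm_def mult.assoc)
    moreover have "b * (y * comm (f ^ i) g * inverse y) \<in> der A"
      using subgrp_mult[OF D that(1)] nrm_conj[OF nD that(2)] comm_in_der[OF fi that(3)] by blast
    ultimately show ?thesis by blast
  qed
  have form: "\<exists>b\<in>der A. \<exists>y\<in>gen F. \<exists>i::nat. x = b * y * f ^ i" if "x \<in> gen (insert f F)" for x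
    using that
  proof induction
    case gen_one
    have "(1::'a) = 1 * 1 * f ^ 0" by simp
    then show ?case using subgrp_one[OF D] gen.gen_one[of F] by blast
  next
    case (gen_mult x s)
    then obtain b y i where x: "b \<in> der A" "y \<in> gen F" "x = b * y * f ^ i" by blast
    show ?case
    proof (cases "s = f")
      case True
      then have "x * s = b * y * f ^ Suc i" using x by (simp add: mult.assoc power_commutes)
      then show ?thesis using x by blast
    next
      case False
      then have s: "s \<in> F" "s \<in> A" using gen_mult FA by auto
      then obtain c where "c \<in> der A" "x * s = c * (y * s) * f ^ i"
        using swap[OF x(1) _ s(2)] x gF by blast
      then show ?thesis using gen.gen_mult[OF x(2) s(1)] by blast
    qed
  next
    case (gen_inv x s)
    then obtain b y i where x: "b \<in> der A" "y \<in> gen F" "x = b * y * f ^ i" by blast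
    show ?case
    proof (cases "s = f")
      case True
      then have "x * inverse s = b * y * f ^ (i + (n - 1))"
        using x by (simp add: mult.assoc power_add invpow)
      then show ?thesis using x by blast
    next
      case False
      then have s: "s \<in> F" "inverse s \<in> A" using gen_inv FA A subgrp_inv by auto
      then obtain c where "c \<in> der A" "x * inverse s = c * (y * inverse s) * f ^ i"
        using swap[OF x(1) _ s(2)] x gF by blast
      then show ?thesis using gen.gen_inv[OF x(2) s(1)] by blast
    qed
  qed
  let ?E = "(\<lambda>(e, i). e * f ^ i) ` (E \<times> {..<n})"
  have "\<exists>b\<in>der A. \<exists>e\<in>?E. x = b * e" if "x \<in> gen (insert f F)" for x
  proof -
    from form[OF that] obtain b y i where x: "b \<in> der A" "y \<in> gen F" "x = b * y * f ^ i" by blast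
    obtain b' e where y: "b' \<in> der A" "e \<in> E" "y = b' * e" using E(2)[OF x(2)] by blast
    obtain j where j: "j < n" "f ^ i = f ^ j" using torsion_mod_bound(1)[OF n(2,1)] by blast
    have "x = (b * b') * (e * f ^ j)" using x y j by (simp add: mult.assoc)
    moreover have "b * b' \<in> der A" using x y D subgrp_mult by blast
    moreover have "e * f ^ j \<in> ?E" using y j by force
    ultimately show ?thesis by blast
  qed
  moreover have "finite ?E" using E by simp
  ultimately show ?case by blast
qed

text \<open>Schreier's argument: with a finite transversal \<open>T\<close> of \<open>A\<close>, every element of the group
  is a product of the finitely many Schreier generators followed by an element of \<open>T\<close>; torsion
  leaves finitely many values of such a product modulo \<open>der A\<close>.\<close>

lemma fin_index_der:
  assumes G: "G = gen S" and S: "finite S"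
    and tor: "\<And>g. g \<in> G \<Longrightarrow> \<exists>n::nat. n > 0 \<and> g ^ n = 1"
    and A: "subgrp A" "A \<subseteq> G" "fin_index A G"
  shows "fin_index (der A) G"
proof -
  have sG: "subgrp G" using G subgrp_gen by simp
  obtain T where T: "finite T" "T \<subseteq> G" "\<And>g. g \<in> G \<Longrightarrow> \<exists>t\<in>T. g * inverse t \<in> A"
    using fin_index_transversal[OF A(3) sG A(1,2)] by blast
  obtain \<tau> where \<tau>: "\<And>g. g \<in> G \<Longrightarrow> \<tau> g \<in> T \<and> g * inverse (\<tau> g) \<in> A" using T(3) by metis
  define S' where "S' = S \<union> inverse ` S"
  have S': "finite S'" "S' \<subseteq> G" using S G sG gen_incl subgrp_inv by (auto simp: S'_def)
  \<comment> \<open>Besides the Schreier generators, \<open>F\<close> contains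
    \<open>inverse (\<tau> 1)\<close>: the transversal need not contain 1, yet the identity must
    also be a product followed by an element of \<open>T\<close>.\<close>
  define F where "F = insert (inverse (\<tau> 1)) ((\<lambda>(t, s). t * s * inverse (\<tau> (t * s))) ` (T \<times> S'))"
  have FA: "F \<subseteq> A"
    using \<tau>[OF subgrp_one[OF sG]] \<tau>[OF subgrp_mult[OF sG]] T(2) S'(2)
    by (auto simp: F_def subset_iff)
  have finF: "finite F" using T S' by (simp add: F_def)
  have form: "\<exists>y\<in>gen F. \<exists>t\<in>T. g = y * t" if "g \<in> G" for g
  proof -
    have step: "\<exists>y\<in>gen F. \<exists>t\<in>T. x * s = y * t" if "y \<in> gen F" "t \<in> T" "x = y * t" "s \<in> S'" for x y t s
    proof -
      have "t * s \<in> G" using that T S' sG subgrp_mult by blast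
      have f: "t * s * inverse (\<tau> (t * s)) \<in> F" using that by (force simp: F_def)
      have "x * s = y * (t * s * inverse (\<tau> (t * s))) * \<tau> (t * s)"
        using that by (simp add: mult.assoc)
      then show ?thesis using gen.gen_mult[OF that(1) f] \<tau>[OF \<open>t * s \<in> G\<close>] by blast
    qed
    from that have "g \<in> gen S" using G by simp
    then show ?thesis
    proof induction
      case gen_one
      have "inverse (\<tau> 1) \<in> gen F" by (rule gen_incl) (simp add: F_def)
      moreover have "1 = inverse (\<tau> 1) * \<tau> 1" by simp
      ultimately show ?case using \<tau>[OF subgrp_one[OF sG]] by blast
    next
      case (gen_mult x s)
      then show ?case using step[of _ _ x s] by (force simp: S'_def)
    next
      case (gen_inv x s)
      then show ?case using step[of _ _ x "inverse s"] by (force simp: S'_def)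
    qed
  qed
  have "\<exists>n::nat. n > 0 \<and> x ^ n = 1" if "x \<in> F" for x using that FA A(2) tor by blast
  then obtain E where E: "finite E" "\<And>x. x \<in> gen F \<Longrightarrow> \<exists>b\<in>der A. \<exists>e\<in>E. x = b * e"
    using gen_abelian_mod_finite[OF A(1) finF FA] by blast
  show ?thesis
  proof (rule fin_index_from_transversal[of "(\<lambda>(e, t). e * t) ` (E \<times> T)"])
    show "finite ((\<lambda>(e, t). e * t) ` (E \<times> T))" using E T by simp
    fix g assume "g \<in> G"
    then obtain y t where yt: "y \<in> gen F" "t \<in> T" "g = y * t" using form by blast
    then obtain b e where be: "b \<in> der A" "e \<in> E" "y = b * e" using E by blast
    have "g * inverse (e * t) = b" using yt be by (simp add: mult.assoc)
    then show "\<exists>t\<in>(\<lambda>(e, t). e * t) ` (E \<times> T). g * inverse t \<in> der A"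
      using be yt by (intro bexI[of _ "e * t"]) auto
  qed (use sG subgrp_der in auto)
qed

lemma fin_index_one_imp_finite: "fin_index {1} G \<Longrightarrow> finite G"
proof -
  assume "fin_index {1} G"
  then obtain f :: "'a \<Rightarrow> nat" where f: "finite (f ` G)"
    "\<And>b c. b \<in> G \<Longrightarrow> c \<in> G \<Longrightarrow> f b = f c \<Longrightarrow> inverse b * c \<in> {1}"
    unfolding fin_index_def by blast
  have "inj_on f G" by (rule inj_onI) (use f(2) mg_inv_mult_eq_1_iff in blast)
  then show ?thesis using f(1) finite_imageD by blast
qed

end

section \<open>Self-similar groups acting on the first level by translations\<close>

lemma dvd_diff_trans: "q dvd a - b \<Longrightarrow> q dvd b - c \<Longrightarrow> q dvd a - c" for q :: int
  by Groebner_Basis.algebra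

lemma dvd_diff_sym: "q dvd a - b \<Longrightarrow> q dvd b - a" for q :: int
  by Groebner_Basis.algebra

text \<open>Letters are integers modulo \<open>q\<close>; an element \<open>g\<close> maps the letter \<open>i\<close> to \<open>i + \<rho> g\<close>, and
  \<open>sec g i\<close> is its section at \<open>i\<close>. Since translations act freely, the stabiliser \<open>S1\<close> of the first
  level is also the stabiliser of each letter.\<close>

locale self_similar =
  fixes G :: "'g :: mult_group set" and q :: int
    and \<rho> :: "'g \<Rightarrow> int" and sec :: "'g \<Rightarrow> int \<Rightarrow> 'g"
  assumes G: "subgrp G" and q_gt_1: "q > 1"
    and rho_mult: "g \<in> G \<Longrightarrow> h \<in> G \<Longrightarrow> q dvd \<rho> (g * h) - (\<rho> g + \<rho> h)"
    and sec_mult: "g \<in> G \<Longrightarrow> h \<in> G \<Longrightarrow> sec (g * h) i = sec g (i + \<rho> h) * sec h i"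
    and sec_closed: "g \<in> G \<Longrightarrow> sec g i \<in> G"
    and sec_cong: "g \<in> G \<Longrightarrow> q dvd i - j \<Longrightarrow> sec g i = sec g j"
begin

definition S1 :: "'g set" where "S1 = {g \<in> G. q dvd \<rho> g}"

definition lift :: "'g set \<Rightarrow> 'g set" where "lift N = {g \<in> S1. \<forall>i. sec g i \<in> N}"

text \<open>The stabiliser of level \<open>n\<close> of the tree.\<close>

definition lev :: "nat \<Rightarrow> 'g set" where "lev n = (lift ^^ n) G"

text \<open>The rigid stabiliser of the subtree at letter \<open>i\<close>.\<close>

definition rist :: "int \<Rightarrow> 'g set" where
  "rist i = {g \<in> S1. \<forall>j. \<not> q dvd j - i \<longrightarrow> sec g j = 1}"

definition sect :: "'g set \<Rightarrow> int \<Rightarrow> 'g set" where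
  "sect H i = {sec h i | h. h \<in> H \<and> h \<in> S1}"

lemmas G_mult = subgrp_mult[OF G] and G_inv = subgrp_inv[OF G] and G_one = subgrp_one[OF G]
  and G_power = subgrp_power[OF G] and G_comm = subgrp_comm[OF G]

lemma rho_one: "q dvd \<rho> 1"
  using rho_mult[OF G_one G_one] by simp

lemma rho_inv: assumes "g \<in> G" shows "q dvd \<rho> (inverse g) + \<rho> g"
proof -
  have "q dvd \<rho> 1 - (\<rho> (inverse g) + \<rho> g)" using rho_mult[OF G_inv[OF assms] assms] by simp
  with rho_one show ?thesis by Groebner_Basis.algebra
qed

lemma sec_one [simp]: "sec 1 i = 1"
proof -
  have "sec (1 * 1) i = sec 1 (i + \<rho> 1) * sec 1 i" by (rule sec_mult[OF G_one G_one])
  moreover have "sec 1 (i + \<rho> 1) = sec 1 i" using rho_one by (intro sec_cong[OF G_one]) simp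
  ultimately show ?thesis by (metis mg_inv_mult_eq_1_iff mg_simps(3) mult_1_left)
qed

lemma sec_inv: assumes "g \<in> G" shows "sec (inverse g) i = inverse (sec g (i - \<rho> g))"
proof -
  have "sec (g * inverse g) i = sec g (i + \<rho> (inverse g)) * sec (inverse g) i"
    by (rule sec_mult[OF assms G_inv[OF assms]])
  moreover have "sec g (i + \<rho> (inverse g)) = sec g (i - \<rho> g)"
    using rho_inv[OF assms] by (intro sec_cong[OF assms]) (simp add: algebra_simps)
  ultimately show ?thesis by (metis mg_eq_1_iff mg_simps(2) sec_one)
qed

lemma S1_G: "g \<in> S1 \<Longrightarrow> g \<in> G" and S1_rho: "g \<in> S1 \<Longrightarrow> q dvd \<rho> g"
  by (auto simp: S1_def)

lemma sec_mult_S1: "g \<in> G \<Longrightarrow> h \<in> S1 \<Longrightarrow> sec (g * h) i = sec g i * sec h i"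
  using sec_mult[of g h i] sec_cong[of g "i + \<rho> h" i] by (simp add: S1_def)

lemma sec_inv_S1: "g \<in> S1 \<Longrightarrow> sec (inverse g) i = inverse (sec g i)"
  using sec_inv[of g i] sec_cong[of g "i - \<rho> g" i] by (simp add: S1_def)

lemma subgrp_S1: "subgrp S1"
  unfolding subgrp_def
proof (intro conjI ballI)
  show "1 \<in> S1" using G_one rho_one by (simp add: S1_def)
next
  fix x y assume xy: "x \<in> S1" "y \<in> S1"
  then have "q dvd \<rho> (x * y) - (\<rho> x + \<rho> y)" "q dvd \<rho> x" "q dvd \<rho> y"
    using rho_mult by (auto simp: S1_def)
  then have "q dvd \<rho> (x * y)" by Groebner_Basis.algebra
  then show "x * y \<in> S1" using xy G_mult by (simp add: S1_def)
next
  fix x assume "x \<in> S1"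
  then show "inverse x \<in> S1" using rho_inv[of x] G_inv by (simp add: S1_def dvd_add_left_iff)
qed

lemmas S1_mult = subgrp_mult[OF subgrp_S1] and S1_inv = subgrp_inv[OF subgrp_S1]
  and S1_one = subgrp_one[OF subgrp_S1] and S1_comm = subgrp_comm[OF subgrp_S1]
  and S1_power = subgrp_power[OF subgrp_S1]

lemma rho_conj: assumes "g \<in> G" "h \<in> G" shows "q dvd \<rho> (g * h * inverse g) - \<rho> h"
proof -
  have "q dvd \<rho> (g * h * inverse g) - (\<rho> (g * h) + \<rho> (inverse g))"
    using assms by (intro rho_mult G_mult G_inv)
  moreover have "q dvd \<rho> (g * h) - (\<rho> g + \<rho> h)" using assms by (intro rho_mult)
  moreover have "q dvd \<rho> (inverse g) + \<rho> g" using assms by (intro rho_inv)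
  ultimately show ?thesis by Groebner_Basis.algebra
qed

lemma nrm_S1: "nrm S1 G"
  unfolding nrm_def
proof (intro conjI ballI)
  show "S1 \<subseteq> G" by (auto simp: S1_def)
  fix g n assume "g \<in> G" "n \<in> S1"
  then show "g * n * inverse g \<in> S1"
    using rho_conj[of g n] G_mult G_inv by (auto simp: S1_def dvd_diff_left_iff)
qed (rule subgrp_S1)

lemma S1_conj: "g \<in> G \<Longrightarrow> n \<in> S1 \<Longrightarrow> g * n * inverse g \<in> S1"
  by (rule nrm_conj[OF nrm_S1])

lemma sec_conj:
  assumes g: "g \<in> G" and h: "h \<in> S1"
  shows "sec (g * h * inverse g) (i + \<rho> g) = sec g i * sec h i * inverse (sec g i)"
proof -
  have hG: "h \<in> G" using h S1_G by blast
  have "sec (g * h * inverse g) (i + \<rho> g)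
      = sec (g * h) (i + \<rho> g + \<rho> (inverse g)) * sec (inverse g) (i + \<rho> g)"
    using g hG by (intro sec_mult G_mult G_inv)
  also have "sec (g * h) (i + \<rho> g + \<rho> (inverse g)) = sec (g * h) i"
    using rho_inv[OF g] by (intro sec_cong G_mult g hG) (simp add: algebra_simps)
  also have "\<dots> = sec g i * sec h i" by (rule sec_mult_S1[OF g h])
  also have "sec (inverse g) (i + \<rho> g) = inverse (sec g i)" using sec_inv[OF g, of "i + \<rho> g"] by simp
  finally show ?thesis .
qed

lemma sec_conj_S1:
  assumes "g \<in> S1" and "h \<in> S1"
  shows "sec (g * h * inverse g) i = sec g i * sec h i * inverse (sec g i)"
  using assms by (simp add: sec_mult_S1 sec_inv_S1 S1_mult S1_inv S1_G)

lemma sec_comm: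
  assumes "g \<in> S1" "h \<in> S1"
  shows "sec (comm g h) i = comm (sec g i) (sec h i)"
  unfolding comm_def using assms
  by (simp add: sec_mult_S1 sec_inv_S1 S1_mult S1_inv S1_G)

lemma sec_power: "g \<in> S1 \<Longrightarrow> sec (g ^ n) i = sec g i ^ n"
  by (induction n) (simp_all add: sec_mult_S1 S1_power S1_G power_commutes[symmetric])

lemma subgrp_sect: assumes "subgrp H" shows "subgrp (sect H i)"
  unfolding subgrp_def sect_def
proof (intro conjI ballI)
  show "1 \<in> {sec h i | h. h \<in> H \<and> h \<in> S1}"
    using subgrp_one[OF assms] S1_one by (metis (mono_tags, lifting) mem_Collect_eq sec_one)
next
  fix x y assume "x \<in> {sec h i | h. h \<in> H \<and> h \<in> S1}" "y \<in> {sec h i | h. h \<in> H \<and> h \<in> S1}"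
  then obtain g h where "g \<in> H" "g \<in> S1" "x = sec g i" "h \<in> H" "h \<in> S1" "y = sec h i" by blast
  then show "x * y \<in> {sec h i | h. h \<in> H \<and> h \<in> S1}"
    by (intro CollectI exI[of _ "g * h"])
       (simp add: sec_mult_S1 S1_mult subgrp_mult[OF assms] S1_G)
next
  fix x assume "x \<in> {sec h i | h. h \<in> H \<and> h \<in> S1}"
  then obtain g where "g \<in> H" "g \<in> S1" "x = sec g i" by blast
  then show "inverse x \<in> {sec h i | h. h \<in> H \<and> h \<in> S1}"
    by (intro CollectI exI[of _ "inverse g"]) (simp add: sec_inv_S1 S1_inv subgrp_inv[OF assms])
qed

lemma sect_sub_G: "sect H i \<subseteq> G"
  unfolding sect_def using sec_closed S1_G by blast

lemma sect_I: "h \<in> H \<Longrightarrow> h \<in> S1 \<Longrightarrow> sec h i \<in> sect H i"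
  unfolding sect_def by blast

lemma sect_cong: "q dvd i - j \<Longrightarrow> sect H i = sect H j"
  unfolding sect_def using sec_cong S1_G by (metis (no_types, lifting))

lemma lift_sub_S1: "lift N \<subseteq> S1" by (auto simp: lift_def)

lemma nrm_lift: assumes N: "nrm N G" shows "nrm (lift N) G"
  unfolding nrm_def
proof (intro conjI ballI)
  note Ns = nrm_subgrp[OF N]
  show "subgrp (lift N)" unfolding subgrp_def lift_def
    using subgrp_one[OF Ns] subgrp_mult[OF Ns] subgrp_inv[OF Ns] S1_one S1_mult S1_inv
    by (auto simp: sec_mult_S1 sec_inv_S1 S1_G)
  show "lift N \<subseteq> G" using S1_G by (auto simp: lift_def)
  fix g n assume gn: "g \<in> G" "n \<in> lift N"
  then have n: "n \<in> S1" "\<And>i. sec n i \<in> N" by (auto simp: lift_def)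
  have "sec (g * n * inverse g) i \<in> N" for i
    using sec_conj[OF gn(1) n(1), of "i - \<rho> g"] nrm_conj[OF N sec_closed[OF gn(1)] n(2)] by simp
  then show "g * n * inverse g \<in> lift N" using S1_conj[OF gn(1) n(1)] by (simp add: lift_def)
qed

lemma sec_inv_mult:
  assumes g: "g \<in> G" and h: "h \<in> G" and eq: "q dvd \<rho> g - \<rho> h"
  shows "inverse g * h \<in> S1" "sec (inverse g * h) i = inverse (sec g i) * sec h i"
proof -
  have "q dvd \<rho> (inverse g * h) - (\<rho> (inverse g) + \<rho> h)" using g h by (intro rho_mult G_inv)
  with rho_inv[OF g] eq have "q dvd \<rho> (inverse g * h)" by Groebner_Basis.algebra
  then show "inverse g * h \<in> S1" using g h G_mult G_inv by (simp add: S1_def)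
  have "sec (inverse g * h) i = sec (inverse g) (i + \<rho> h) * sec h i"
    using g h by (intro sec_mult G_inv)
  also have "sec (inverse g) (i + \<rho> h) = inverse (sec g (i + \<rho> h - \<rho> g))" using g by (rule sec_inv)
  also have "sec g (i + \<rho> h - \<rho> g) = sec g i"
    using eq by (intro sec_cong[OF g]) (simp add: dvd_diff_commute)
  finally show "sec (inverse g * h) i = inverse (sec g i) * sec h i" .
qed

text \<open>An element is coloured by its translation together with the colours of its
  \<open>q\<close> sections; agreement in both puts the quotient into \<open>S1\<close> with all
  sections in \<open>N\<close>.\<close>

lemma fin_index_lift: assumes "fin_index N G" shows "fin_index (lift N) G"
proof -
  obtain f :: "'g \<Rightarrow> nat" where f: "finite (f ` G)"
    "\<And>b c. b \<in> G \<Longrightarrow> c \<in> G \<Longrightarrow> f b = f c \<Longrightarrow> inverse b * c \<in> N"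
    using assms unfolding fin_index_def by blast
  let ?col = "\<lambda>g. (\<rho> g mod q, \<lambda>i\<in>{0..<q}. f (sec g i))"
  show ?thesis
  proof (rule fin_indexI[where f = ?col])
    have "finite ({0..<q} \<times> (\<Pi>\<^sub>E i\<in>{0..<q}. f ` G))" using f by (intro finite_cartesian_product finite_PiE) auto
    moreover have "?col ` G \<subseteq> {0..<q} \<times> (\<Pi>\<^sub>E i\<in>{0..<q}. f ` G)"
      using q_gt_1 sec_closed by auto
    ultimately show "finite (?col ` G)" by (rule finite_subset[rotated])
    fix b c assume bc: "b \<in> G" "c \<in> G" "?col b = ?col c"
    then have "q dvd \<rho> b - \<rho> c" using mod_eq_dvd_iff by blast
    note m = sec_inv_mult[OF bc(1,2) this]
    have "sec (inverse b * c) i \<in> N" for i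
    proof -
      have i: "i mod q \<in> {0..<q}" "q dvd i - i mod q" using q_gt_1 by auto
      have "f (sec b (i mod q)) = f (sec c (i mod q))"
        using bc(3) i(1) by (metis Pair_inject restrict_apply')
      then have "inverse (sec b (i mod q)) * sec c (i mod q) \<in> N"
        using f(2) sec_closed bc by blast
      then show ?thesis using m(2) sec_cong[OF bc(1) i(2)] sec_cong[OF bc(2) i(2)] by simp
    qed
    then show "inverse b * c \<in> lift N" using m(1) by (simp add: lift_def)
  qed
qed

lemma nrm_lev: "nrm (lev n) G"
  unfolding lev_def by (induction n) (auto simp: nrm_lift nrm_refl[OF G])

lemma fin_index_lev: "fin_index (lev n) G"
  unfolding lev_def by (induction n) (auto simp: fin_index_lift fin_index_refl[OF G])

lemma lev_0: "lev 0 = G" and lev_Suc: "lev (Suc n) = lift (lev n)" and lev_1: "lev (Suc 0) = S1"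
  using sec_closed S1_G by (auto simp: lev_def lift_def)

lemma fin_index_S1: "fin_index S1 G"
  using fin_index_lev[of "Suc 0"] by (simp add: lev_1)

lemma subgrp_rist: "subgrp (rist i)"
  unfolding subgrp_def rist_def
  using S1_one S1_mult S1_inv by (auto simp: sec_mult_S1 sec_inv_S1 S1_G)

lemma rist_conj: assumes g: "g \<in> G" and h: "h \<in> rist i" shows "g * h * inverse g \<in> rist (i + \<rho> g)"
proof -
  have h1: "h \<in> S1" "\<And>j. \<not> q dvd j - i \<Longrightarrow> sec h j = 1" using h by (auto simp: rist_def)
  have "sec (g * h * inverse g) j = 1" if "\<not> q dvd j - (i + \<rho> g)" for j
    using sec_conj[OF g h1(1), of "j - \<rho> g"] h1(2)[of "j - \<rho> g"] that by (simp add: algebra_simps)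
  then show ?thesis using S1_conj[OF g h1(1)] by (simp add: rist_def)
qed

lemma rist_comm_left: assumes "g \<in> S1" "h \<in> rist i" shows "comm g h \<in> rist i"
  and "comm h g \<in> rist i"
proof -
  have h1: "h \<in> S1" "\<And>j. \<not> q dvd j - i \<Longrightarrow> sec h j = 1" using assms by (auto simp: rist_def)
  then show "comm g h \<in> rist i" "comm h g \<in> rist i"
    using assms(1) by (auto simp: rist_def S1_comm sec_comm)
qed

lemma rist_cong: "q dvd i - j \<Longrightarrow> rist i = rist j"
  unfolding rist_def using dvd_diff_trans[of q _ i j] dvd_diff_trans[of q _ j i] dvd_diff_sym[of q i j]
  by blast

lemma rist_S1: "h \<in> rist i \<Longrightarrow> h \<in> S1" by (simp add: rist_def)

lemma rist_sec: "h \<in> rist i \<Longrightarrow> \<not> q dvd j - i \<Longrightarrow> sec h j = 1" by (simp add: rist_def)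

end

locale faithful_self_similar = self_similar +
  assumes residual: "g \<in> G \<Longrightarrow> (\<And>n. g \<in> lev n) \<Longrightarrow> g = 1"
begin

text \<open>The quotient \<open>inverse g * h\<close> has only trivial sections, so it lies in every
  \<open>lev n\<close> and \<open>residual\<close> applies.\<close>

lemma sec_ext:
  assumes g: "g \<in> G" "h \<in> G" "q dvd \<rho> g - \<rho> h" and eq: "\<And>i. sec g i = sec h i"
  shows "g = h"
proof -
  note m = sec_inv_mult[OF g]
  have "inverse g * h \<in> lev n" for n
  proof (cases n)
    case 0
    then show ?thesis using m(1) S1_G lev_0 by simp
  next
    case (Suc n')
    then show ?thesis using m eq subgrp_one[OF nrm_subgrp[OF nrm_lev]]
      by (simp add: lev_Suc lift_def)
  qed
  then have "inverse g * h = 1" using residual m(1) S1_G by blast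
  then show ?thesis by (simp add: mg_inv_mult_eq_1_iff)
qed

lemma S1_eq_oneI: "g \<in> S1 \<Longrightarrow> (\<And>i. sec g i = 1) \<Longrightarrow> g = 1"
  by (rule sec_ext) (auto simp: S1_def G_one rho_one dvd_diff)

lemma rist_eqI: assumes "g \<in> rist i" "h \<in> rist i" "sec g i = sec h i" shows "g = h"
proof (rule sec_ext)
  show "g \<in> G" "h \<in> G" "q dvd \<rho> g - \<rho> h" using assms by (auto simp: rist_def S1_def)
  then show "sec g j = sec h j" for j
    using assms sec_cong[of g j i] sec_cong[of h j i] by (cases "q dvd j - i") (auto simp: rist_def)
qed

text \<open>An element of \<open>S1\<close> is the product of its restrictions to the first-level subtrees.\<close>

lemma in_subgrp_if_rist:
  assumes M: "subgrp M" and g: "g \<in> S1" and r: "\<And>i. \<exists>h\<in>M \<inter> rist i. sec h i = sec g i"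
  shows "g \<in> M"
proof -
  obtain h where h: "\<And>i. h i \<in> M" "\<And>i. h i \<in> rist i" "\<And>i. sec (h i) i = sec g i"
    using r by (metis IntE)
  have hs: "sec (h i) j = (if q dvd j - i then sec g j else 1)" for i j
    using h(2)[of i] h(3)[of i] sec_cong[of "h i" j i] sec_cong[of g j i] S1_G[OF g]
    by (auto simp: rist_def S1_G)
  have "\<exists>x. x \<in> M \<and> x \<in> S1 \<and> (\<forall>j\<in>{0..<q}. sec x j = (if j < int n then sec g j else 1))"
    if "int n \<le> q" for n
    using that
  proof (induction n)
    case 0
    then show ?case using subgrp_one[OF M] S1_one by (intro exI[of _ 1]) simp
  next
    case (Suc n)
    then obtain x where x: "x \<in> M" "x \<in> S1" "\<And>j. j \<in> {0..<q} \<Longrightarrow> sec x j = (if j < int n then sec g j else 1)"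
      by auto
    have hn: "h (int n) \<in> S1" using h(2) rist_S1 by blast
    have "sec (x * h (int n)) j = (if j < int (Suc n) then sec g j else 1)" if j: "j \<in> {0..<q}" for j
    proof (cases "j = int n")
      case True
      then show ?thesis using x j hn by (simp add: sec_mult_S1 hs S1_G)
    next
      case False
      have "\<bar>j - int n\<bar> < \<bar>q\<bar>" using j Suc.prems by auto
      then have "\<not> q dvd j - int n" using False zdvd_not_zless dvd_imp_le_int by (metis eq_iff_diff_eq_0 not_le)
      then have "sec (x * h (int n)) j = sec x j" using x hn by (simp add: sec_mult_S1 hs S1_G)
      then show ?thesis using x(3)[OF j] False by auto
    qed
    then show ?case using x hn subgrp_mult[OF M x(1) h(1)] S1_mult
      by (intro exI[of _ "x * h (int n)"]) blast
  qed
  from this[of "nat q"] obtain x where x: "x \<in> M" "x \<in> S1" "\<And>j. j \<in> {0..<q} \<Longrightarrow> sec x j = sec g j"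
    using q_gt_1 by auto
  have "x = g"
  proof (rule sec_ext)
    show "x \<in> G" "g \<in> G" "q dvd \<rho> x - \<rho> g" using x g by (auto simp: S1_def)
    then show "sec x i = sec g i" for i
      using x(3)[of "i mod q"] q_gt_1 sec_cong[of x i "i mod q"] sec_cong[of g i "i mod q"] by simp
  qed
  then show ?thesis using x by simp
qed

end

section \<open>Periodic primary multi-GGS groups\<close>

text \<open>\<open>q div gcd r q\<close> is the order of \<open>r\<close> in the integers modulo
  \<open>q\<close>.\<close>

lemma dvd_mult_iff_div_gcd:
  fixes q r t :: int
  assumes q: "q > 0" shows "q dvd t * r \<longleftrightarrow> q div gcd r q dvd t"
proof -
  define g where "g = gcd r q"
  have gq: "g dvd q" "g dvd r" "g > 0" using q by (auto simp: g_def)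
  define n r' where "n = q div g" and "r' = r div g"
  have n: "q = n * g" "r = r' * g" using gq by (auto simp: n_def r'_def)
  have cop: "coprime r' n" unfolding n_def r'_def g_def using q by (intro div_gcd_coprime) auto
  have "q dvd t * r \<longleftrightarrow> n * g dvd (t * r') * g" using n by (simp add: mult.assoc)
  also have "\<dots> \<longleftrightarrow> n dvd t * r'" using gq(3) by simp
  also have "\<dots> \<longleftrightarrow> n dvd t" using cop by (simp add: coprime_commute coprime_dvd_mult_left_iff)
  finally show ?thesis by (simp add: n_def g_def)
qed

text \<open>\<open>rt s\<close> is the rooted automorphism of translation by \<open>s\<close>, and \<open>E d i\<close> is the exponent of the
  section of the directed element \<open>d\<close> at \<open>i\<close>, meaningful modulo \<open>q\<close> and for \<open>i\<close> not divisible by \<open>q\<close>.\<close>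

locale ggs = faithful_self_similar +
  fixes rt :: "int \<Rightarrow> 'a" and D :: "'a set" and E :: "'a \<Rightarrow> int \<Rightarrow> int"
    and p :: int and k :: nat and d0 :: 'a
  assumes prime_p: "prime p" and k_pos: "k > 0" and q_eq: "q = p ^ k"
    and rt_G: "rt s \<in> G"
    and rt_add: "rt (s + t) = rt s * rt t"
    and rt_cong: "q dvd s - t \<Longrightarrow> rt s = rt t"
    and rho_rt: "q dvd \<rho> (rt s) - s"
    and sec_rt: "sec (rt s) i = 1"
    and D_G: "D \<subseteq> G" and subgrp_D: "subgrp D"
    and rho_D: "d \<in> D \<Longrightarrow> q dvd \<rho> d"
    and sec_D_0: "d \<in> D \<Longrightarrow> q dvd i \<Longrightarrow> sec d i = d"
    and sec_D: "d \<in> D \<Longrightarrow> \<not> q dvd i \<Longrightarrow> sec d i = rt (E d i)"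
    and G_gen: "G = gen (range rt \<union> D)"
    and d0_D: "d0 \<in> D" and d0_unit: "\<not> p dvd E d0 1"
    and torsion: "g \<in> G \<Longrightarrow> \<exists>n::nat. n > 0 \<and> g ^ n = 1"
begin

section \<open>Rooted translations and the directed group\<close>

lemma p_dvd_q: "p dvd q" using q_eq k_pos by (simp add: dvd_power)

lemma p_gt_1: "p > 1" using prime_p prime_gt_1_int by blast

lemma coprime_q_iff: "coprime u q \<longleftrightarrow> \<not> p dvd u"
proof -
  have "coprime u q \<longleftrightarrow> coprime u p" using k_pos by (simp add: q_eq coprime_power_right_iff)
  also have "\<dots> \<longleftrightarrow> \<not> p dvd u"
  proof
    assume "coprime u p"
    then show "\<not> p dvd u" using not_prime_unit[of p] prime_p coprime_common_divisor[of u p p] by auto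
  next
    assume "\<not> p dvd u"
    then show "coprime u p" using prime_imp_coprime[OF prime_p] coprime_commute by blast
  qed
  finally show ?thesis .
qed

lemma rt_0 [simp]: "rt 0 = 1"
  using rt_add[of 0 0] by (metis add_0 mg_cancel(1) mult_1_right)

lemma rt_inv: "inverse (rt s) = rt (- s)"
proof -
  have "rt s * rt (- s) = 1" using rt_add[of s "- s"] by simp
  then show ?thesis using mg_eq_1_iff by metis
qed

lemma rt_power: "rt s ^ n = rt (int n * s)"
  by (induction n) (simp_all add: algebra_simps rt_add)

lemma rt_commute: "rt s * rt t = rt t * rt s"
  by (metis add.commute rt_add)

lemma comm_rt [simp]: "comm (rt s) (rt t) = 1"
  by (simp add: comm_eq_1_iff rt_commute)

lemma rt_eq_iff: "rt s = rt t \<longleftrightarrow> q dvd s - t"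
  using rho_rt[of s] rho_rt[of t] rt_cong by (metis dvd_diff_sym dvd_diff_trans)

text \<open>A unit \<open>u\<close> generates all residues modulo \<open>q\<close>, so a single
  rooted element with unit exponent brings in the whole rooted group.\<close>

lemma rt_in_subgrp:
  assumes H: "subgrp H" "rt u \<in> H" and u: "\<not> p dvd u" shows "rt s \<in> H"
proof -
  have "coprime u q" using u coprime_q_iff by simp
  then obtain v b where "v * u + b * q = 1" using bezout_int[of u q] by auto
  then have v: "q dvd u * v - 1" by Groebner_Basis.algebra
  define w where "w = (v * s) mod q"
  have w: "w \<ge> 0" "q dvd w - v * s" using q_gt_1 by (auto simp: w_def mod_eq_dvd_iff[symmetric])
  have "q dvd s - w * u" using v w(2) by Groebner_Basis.algebra
  then have "rt s = rt (w * u)" by (rule rt_cong)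
  also have "\<dots> = rt u ^ nat w" using w by (simp add: rt_power)
  finally show ?thesis using subgrp_power[OF H] by simp
qed

lemma D_S1: "d \<in> D \<Longrightarrow> d \<in> S1" using D_G rho_D by (auto simp: S1_def)

lemma D_in_G: "d \<in> D \<Longrightarrow> d \<in> G" using D_G by auto

text \<open>The section at 0 is \<open>d\<close> again, so induction on the level puts
  \<open>d\<close> into every stabiliser. Directed elements are thereby determined by their rooted
  sections.\<close>

lemma D_eq_oneI: assumes d: "d \<in> D" and "\<And>i. \<not> q dvd i \<Longrightarrow> sec d i = 1" shows "d = 1"
proof -
  have "d \<in> lev n" for n
  proof (induction n)
    case 0
    then show ?case using d D_in_G by (simp add: lev_0)
  next
    case (Suc n)
    have "sec d i \<in> lev n" for i
      using assms Suc sec_D_0[OF d] subgrp_one[OF nrm_subgrp[OF nrm_lev]] by (cases "q dvd i") auto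
    then show ?case using D_S1[OF d] by (simp add: lev_Suc lift_def)
  qed
  then show ?thesis using residual d D_in_G by blast
qed

lemma D_commute: assumes "d \<in> D" "e \<in> D" shows "d * e = e * d"
proof -
  have "comm d e \<in> D" using assms subgrp_comm[OF subgrp_D] by blast
  then have "comm d e = 1"
    by (rule D_eq_oneI) (use assms in \<open>simp add: sec_comm D_S1 sec_D\<close>)
  then show ?thesis by (simp add: comm_eq_1_iff)
qed

lemma D_eqI: assumes "d \<in> D" "e \<in> D" "\<And>i. \<not> q dvd i \<Longrightarrow> sec d i = sec e i" shows "d = e"
proof -
  have "inverse d * e \<in> D" using assms subgrp_mult[OF subgrp_D] subgrp_inv[OF subgrp_D] by blast
  then have "inverse d * e = 1"
    by (rule D_eq_oneI) (use assms in \<open>simp add: sec_mult_S1 D_S1 S1_inv S1_G sec_inv_S1\<close>)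
  then show ?thesis by (simp add: mg_inv_mult_eq_1_iff)
qed

lemma finite_range_rt: "finite (range rt)"
proof -
  have "range rt \<subseteq> rt ` {0..<q}"
  proof
    fix x assume "x \<in> range rt"
    then obtain s where "x = rt s" by blast
    then have "x = rt (s mod q)" using rt_cong[of s "s mod q"] by simp
    then show "x \<in> rt ` {0..<q}" using q_gt_1 by simp
  qed
  then show ?thesis by (rule finite_subset) simp
qed

lemma finite_D: "finite D"
proof -
  \<comment> \<open>At letter 0 the section is \<open>d\<close> itself and not rooted, so that entry
    is blanked by 1.\<close>
  let ?f = "\<lambda>d. \<lambda>i\<in>{0..<q}. if i = 0 then 1 else sec d i"
  have "inj_on ?f D"
  proof (rule inj_onI)
    fix d e assume de: "d \<in> D" "e \<in> D" "?f d = ?f e"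
    show "d = e"
    proof (rule D_eqI[OF de(1,2)])
      fix i assume i: "\<not> q dvd i"
      then have m: "i mod q \<noteq> 0" "i mod q \<in> {0..<q}" using q_gt_1 by (auto simp: dvd_eq_mod_eq_0)
      then have "sec d (i mod q) = sec e (i mod q)" using fun_cong[OF de(3), of "i mod q"] by simp
      then show "sec d i = sec e i"
        using sec_cong[of d i "i mod q"] sec_cong[of e i "i mod q"] de D_in_G by simp
    qed
  qed
  moreover have "?f ` D \<subseteq> (\<Pi>\<^sub>E i\<in>{0..<q}. range rt)"
  proof (rule image_subsetI)
    fix d assume d: "d \<in> D"
    have "sec d i = rt (E d i)" if "0 < i" "i < q" for i
      using sec_D[OF d, of i] that zdvd_not_zless by blast
    then show "?f d \<in> (\<Pi>\<^sub>E i\<in>{0..<q}. range rt)"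
      by (auto simp: le_less) (metis range_eqI rt_0)
  qed
  moreover have "finite (\<Pi>\<^sub>E i\<in>{0..<q}. range rt)" by (rule finite_PiE) (auto simp: finite_range_rt)
  ultimately show ?thesis by (meson finite_imageD finite_subset)
qed

lemma fin_index_derived: "subgrp A \<Longrightarrow> A \<subseteq> G \<Longrightarrow> fin_index A G \<Longrightarrow> fin_index (der A) G"
  using fin_index_der[OF G_gen _ torsion] finite_range_rt finite_D by blast

text \<open>The conjugate of \<open>d\<close> whose spine, the letter where the section is
  \<open>d\<close> again, is moved from 0 to \<open>s\<close>. These conjugates are the syllables of
  all later words.\<close>

definition dp :: "'a \<Rightarrow> int \<Rightarrow> 'a" where "dp d s = rt s * d * rt (- s)"

lemma dp_S1: "d \<in> D \<Longrightarrow> dp d s \<in> S1"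
  using S1_conj[OF rt_G D_S1, of d s] by (simp add: dp_def rt_inv)

lemma sec_dp:
  assumes "d \<in> D"
  shows "sec (dp d s) i = (if q dvd i - s then d else rt (E d (i - s)))"
proof -
  have "sec (dp d s) (i - s + \<rho> (rt s)) = sec d (i - s)"
    using sec_conj[OF rt_G D_S1[OF assms], of s "i - s"] by (simp add: dp_def rt_inv sec_rt)
  moreover have "q dvd (i - s + \<rho> (rt s)) - i" using rho_rt[of s] by (simp add: algebra_simps)
  ultimately have "sec (dp d s) i = sec d (i - s)"
    using sec_cong[OF S1_G[OF dp_S1[OF assms]]] by metis
  then show ?thesis using sec_D_0 sec_D assms by simp
qed

lemma rho_rt_minus: "q dvd i + s - (i + \<rho> (rt s))"
  using rho_rt[of s] by (simp add: dvd_diff_commute)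

lemma rist_conj_rt: "h \<in> rist i \<Longrightarrow> rt s * h * rt (- s) \<in> rist (i + s)"
  using rist_conj[OF rt_G, of h i s] rist_cong[OF rho_rt_minus, of i s] by (simp add: rt_inv)

lemma sec_conj_rt: assumes "h \<in> S1" shows "sec (rt s * h * rt (- s)) (i + s) = sec h i"
  using sec_conj[OF rt_G assms, of s i] sec_cong[OF _ rho_rt_minus, of _ i s] S1_G[OF S1_conj[OF rt_G assms]]
  by (simp add: rt_inv sec_rt)

text \<open>Self-replication: directed elements are their own sections at 0, and
  \<open>dp d0 (- 1)\<close> has the section \<open>rt (E d0 1)\<close> there, whose exponent is a
  unit.\<close>

lemma sect_G_0: "sect G 0 = G"
proof
  show "sect G 0 \<subseteq> G" by (rule sect_sub_G)
  have sub: "subgrp (sect G 0)" by (rule subgrp_sect[OF G])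
  have D: "D \<subseteq> sect G 0" using sect_I[of _ G 0] D_in_G D_S1 sec_D_0[of _ 0] by (metis dvd_0_right subsetI)
  have "sec (dp d0 (- 1)) 0 \<in> sect G 0" using dp_S1[OF d0_D] S1_G by (intro sect_I) auto
  moreover have "\<not> q dvd 1" using q_gt_1 by auto
  ultimately have "rt (E d0 1) \<in> sect G 0" by (simp add: sec_dp[OF d0_D])
  then have "range rt \<subseteq> sect G 0" using rt_in_subgrp[OF sub _ d0_unit] by blast
  then show "G \<subseteq> sect G 0" using gen_least[OF sub] D G_gen by auto
qed

lemma sect_conj_rt:
  assumes "subgrp H" "rt s \<in> H" shows "sect H (i + s) = sect H i"
proof -
  have sub: "sect H i \<subseteq> sect H (i + s)" if "rt s \<in> H" for i s
  proof
    fix x assume "x \<in> sect H i"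
    then obtain h where h: "h \<in> H" "h \<in> S1" "x = sec h i" by (auto simp: sect_def)
    have "rt s * h * rt (- s) \<in> H"
      using h(1) that assms(1) by (metis rt_inv subgrp_inv subgrp_mult)
    moreover have "rt s * h * rt (- s) \<in> S1" using S1_conj[OF rt_G h(2), of s] by (simp add: rt_inv)
    ultimately show "x \<in> sect H (i + s)" using sect_I sec_conj_rt[OF h(2)] h(3) by metis
  qed
  have "rt (- s) \<in> H" using assms by (metis rt_inv subgrp_inv)
  then show ?thesis using sub[OF assms(2), of i] sub[of "- s" "i + s"] by auto
qed

lemma sect_G: "sect G i = G"
  using sect_conj_rt[OF G rt_G, of 0 i] sect_G_0 by simp

text \<open>Self-replication maps the proper subset \<open>S1\<close> onto \<open>G\<close>, which
  no finite set allows.\<close>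

lemma infinite_G: "infinite G"
proof
  assume fin: "finite G"
  have "rt 1 \<notin> S1"
  proof
    assume "rt 1 \<in> S1"
    then have "q dvd 1" using rho_rt[of 1] S1_rho[of "rt 1"] by Groebner_Basis.algebra
    then show False using q_gt_1 by auto
  qed
  then have "S1 \<subset> G" using rt_G S1_G by blast
  then have "card S1 < card G" using fin by (rule psubset_card_mono[rotated])
  moreover have "G = (\<lambda>h. sec h 0) ` S1" using sect_G_0 S1_G by (auto simp: sect_def)
  then have "card G \<le> card S1" using card_image_le fin finite_subset[OF _ fin] S1_G by (metis subsetI)
  ultimately show False by simp
qed

text \<open>Translations carry \<open>K\<close> to every letter, so \<open>G\<close> contains a
  direct product of \<open>q\<close> copies of it; branching will mean that \<open>K\<close> has
  finite index.\<close>

definition K :: "'a set" where "K = (\<lambda>h. sec h 0) ` rist 0"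

lemma K_rist: assumes "x \<in> K" obtains h where "h \<in> rist i" "sec h i = x"
proof -
  obtain h where h: "h \<in> rist 0" "x = sec h 0" using assms by (auto simp: K_def)
  show ?thesis
    using that[OF rist_conj_rt[OF h(1), of i, simplified]] sec_conj_rt[OF rist_S1[OF h(1)], of i 0] h(2)
    by simp
qed

text \<open>Every element of \<open>G\<close> is the section at \<open>i\<close> of some
  \<open>x\<close> in \<open>S1\<close>, and conjugation by \<open>x\<close> preserves both
  \<open>N\<close> and \<open>rist i\<close>.\<close>

lemma nrm_sec_rist:
  assumes N: "nrm N G" shows "nrm ((\<lambda>h. sec h i) ` (N \<inter> rist i)) G"
  unfolding nrm_def
proof (intro conjI ballI)
  have sub: "subgrp (N \<inter> rist i)" using nrm_subgrp[OF N] subgrp_rist by (rule subgrp_Int)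
  have "(\<lambda>h. sec h i) ` (N \<inter> rist i) = sect (N \<inter> rist i) i" using rist_S1 by (auto simp: sect_def)
  then show "subgrp ((\<lambda>h. sec h i) ` (N \<inter> rist i))" using subgrp_sect[OF sub] by simp
  show "(\<lambda>h. sec h i) ` (N \<inter> rist i) \<subseteq> G" using rist_S1 S1_G sec_closed by auto
  fix g n assume g: "g \<in> G" and "n \<in> (\<lambda>h. sec h i) ` (N \<inter> rist i)"
  then obtain h where h: "h \<in> N" "h \<in> rist i" "n = sec h i" by auto
  obtain x where x: "x \<in> S1" "g = sec x i" using g sect_G[of i] by (auto simp: sect_def)
  have "x * h * inverse x \<in> N \<inter> rist i"
    using nrm_conj[OF N S1_G[OF x(1)] h(1)] rist_conj[OF S1_G[OF x(1)] h(2)]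
      rist_cong[of "i + \<rho> x" i] S1_rho[OF x(1)] by simp
  moreover have "sec (x * h * inverse x) i = g * n * inverse g"
    using sec_conj_S1[OF x(1) rist_S1[OF h(2)]] x h by simp
  ultimately show "g * n * inverse g \<in> (\<lambda>h. sec h i) ` (N \<inter> rist i)" by (metis image_eqI)
qed

lemma nrm_K: "nrm K G"
proof -
  have "rist 0 = G \<inter> rist 0" using rist_S1 S1_G by auto
  then show ?thesis using nrm_sec_rist[OF nrm_refl[OF G], of 0] by (simp add: K_def)
qed

section \<open>Orbit sums of exponents and periodicity\<close>

lemma rho_power: assumes "h \<in> G" shows "q dvd \<rho> (h ^ n) - int n * \<rho> h"
proof (induction n)
  case 0
  then show ?case using rho_one by simp
next
  case (Suc n)
  have "q dvd \<rho> (h * h ^ n) - (\<rho> h + \<rho> (h ^ n))" using assms G_power by (intro rho_mult)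
  then show ?case using Suc by (simp add: algebra_simps) Groebner_Basis.algebra
qed

lemma sec_power_Suc:
  assumes "h \<in> G" shows "sec (h ^ Suc n) i = sec h (i + int n * \<rho> h) * sec (h ^ n) i"
  using sec_mult[OF assms G_power[OF assms, of n], of i] rho_power[OF assms, of n]
    sec_cong[OF assms, of "i + \<rho> (h ^ n)" "i + int n * \<rho> h"] by simp

lemma rho_rt_mult_D: assumes "d \<in> D" shows "q dvd \<rho> (rt u * d) - u"
  using rho_mult[OF rt_G D_in_G[OF assms], of u] rho_rt[of u] rho_D[OF assms] by Groebner_Basis.algebra

text \<open>\<open>E\<close> matters only modulo \<open>q\<close> and away from 0. Reading it at the
  residue makes the exponent exactly periodic, and the value 0 at multiples of \<open>q\<close> lets
  it be summed over all letters.\<close>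

definition E0 :: "'a \<Rightarrow> int \<Rightarrow> int" where "E0 d j = (if q dvd j then 0 else E d (j mod q))"

lemma rt_E0: "d \<in> D \<Longrightarrow> \<not> q dvd j \<Longrightarrow> sec d j = rt (E0 d j)"
  using sec_D[of d "j mod q"] sec_cong[of d j "j mod q"] D_in_G
  by (simp add: E0_def dvd_mod_iff)

lemma E0_0: "q dvd j \<Longrightarrow> E0 d j = 0" by (simp add: E0_def)

lemma E0_cong: assumes "q dvd i - j" shows "E0 d i = E0 d j"
proof -
  have "i mod q = j mod q" using assms by (simp add: mod_eq_dvd_iff)
  then show ?thesis by (simp add: E0_def dvd_eq_mod_eq_0)
qed

lemma E0_power: assumes "d \<in> D" shows "q dvd E0 (d ^ n) j - int n * E0 d j"
proof (cases "q dvd j")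
  case False
  have "rt (E0 (d ^ n) j) = rt (int n * E0 d j)"
    using rt_E0[OF assms False] rt_E0[OF subgrp_power[OF subgrp_D assms] False, of n]
      sec_power[OF D_S1[OF assms], of n j] by (simp add: rt_power)
  then show ?thesis by (simp add: rt_eq_iff)
qed (simp add: E0_0)

text \<open>For \<open>g\<close> dividing \<open>q\<close> this sums over the subgroup generated by
  \<open>g\<close>: the rooted contribution of \<open>d\<close> along the orbit of 0 under a
  translation by \<open>r\<close> with \<open>gcd r q = g\<close>.\<close>

definition phi :: "int \<Rightarrow> 'a \<Rightarrow> int" where
  "phi g d = (\<Sum>j | 0 \<le> j \<and> j < q \<and> g dvd j. E0 d j)"

text \<open>As \<open>t\<close> runs up to the order of \<open>r\<close>, the letters
  \<open>x + t * r\<close> run once through the coset of \<open>x\<close> modulo \<open>g\<close>;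
  hence the sum depends on \<open>r\<close> only through \<open>g\<close>.\<close>

lemma sum_orbit:
  fixes f :: "int \<Rightarrow> int"
  assumes f: "\<And>i j. q dvd i - j \<Longrightarrow> f i = f j" and g: "gcd r q = g"
  shows "(\<Sum>t<nat (q div g). f (x + int t * r)) = (\<Sum>j | 0 \<le> j \<and> j < q \<and> g dvd j - x. f j)"
proof -
  have gq: "g dvd q" "g dvd r" "g > 0" using g q_gt_1 by (auto simp: gcd_pos_int)
  define n where "n = q div g"
  have n: "q = n * g" "n > 0" using gq q_gt_1 by (auto simp: n_def zdiv_mono1 pos_imp_zdiv_pos_iff zdvd_imp_le)
  have dvd_iff: "q dvd t * r \<longleftrightarrow> n dvd t" for t
    using dvd_mult_iff_div_gcd[of q t r] q_gt_1 g by (simp add: n_def)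
  have "bij_betw (\<lambda>t. (x + int t * r) mod q) {..<nat n} {j. 0 \<le> j \<and> j < q \<and> g dvd j - x}"
    unfolding bij_betw_def
  proof (intro conjI equalityI subsetI)
    show "inj_on (\<lambda>t. (x + int t * r) mod q) {..<nat n}"
    proof (rule inj_onI)
      fix s t assume st: "s \<in> {..<nat n}" "t \<in> {..<nat n}" "(x + int s * r) mod q = (x + int t * r) mod q"
      then have "q dvd (int s - int t) * r" by (simp add: mod_eq_dvd_iff algebra_simps)
      then have "n dvd int s - int t" using dvd_iff by blast
      moreover have "\<bar>int s - int t\<bar> < n" using st by auto
      ultimately have "int s - int t = 0" using dvd_imp_le_int[of "int s - int t" n] by linarith
      then show "s = t" by simp
    qed
  next
    fix j assume "j \<in> (\<lambda>t. (x + int t * r) mod q) ` {..<nat n}"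
    then obtain t where t: "j = (x + int t * r) mod q" by blast
    have "q dvd j - (x + int t * r)"
      unfolding t by (rule dvd_diff_sym) (rule dvd_minus_mod)
    then have "g dvd j - x" using gq(1,2) by (smt (verit) dvd_trans dvd_add dvd_mult)
    then show "j \<in> {j. 0 \<le> j \<and> j < q \<and> g dvd j - x}" using t q_gt_1 by simp
  next
    fix j assume j: "j \<in> {j. 0 \<le> j \<and> j < q \<and> g dvd j - x}"
    then obtain m where m: "j - x = g * m" by (auto elim: dvdE)
    \<comment> \<open>The Bezout coefficient \<open>a\<close> gives \<open>a * r = g\<close> modulo
      \<open>q\<close>, so \<open>m * a\<close> steps lead from \<open>x\<close> to
      \<open>j\<close>.\<close>
    obtain a b where ab: "a * r + b * q = g" using bezout_int[of r q] g by auto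
    define t where "t = (m * a) mod n"
    have t: "0 \<le> t" "t < n" "n dvd t - m * a" using n by (auto simp: t_def mod_eq_dvd_iff[symmetric])
    have "q dvd (t - m * a) * r" using dvd_iff t(3) by blast
    then have "q dvd j - (x + t * r)" using ab m by Groebner_Basis.algebra
    then have "(x + int (nat t) * r) mod q = j mod q" using t by (simp add: mod_eq_dvd_iff dvd_diff_commute)
    then have "(x + int (nat t) * r) mod q = j" using j by simp
    then show "j \<in> (\<lambda>t. (x + int t * r) mod q) ` {..<nat n}" using t by (intro image_eqI[of _ _ "nat t"]) auto
  qed
  then have "(\<Sum>t\<in>{..<nat n}. f ((x + int t * r) mod q)) = (\<Sum>j | 0 \<le> j \<and> j < q \<and> g dvd j - x. f j)"
    by (rule sum.reindex_bij_betw)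
  moreover have "f ((x + int t * r) mod q) = f (x + int t * r)" for t
    by (rule f, rule dvd_diff_sym, rule dvd_minus_mod)
  ultimately show ?thesis by (simp add: n_def)
qed

lemma phi_power: assumes "d \<in> D" shows "q dvd phi g (d ^ n) - int n * phi g d"
  unfolding phi_def sum_distrib_left sum_subtractf[symmetric]
  by (rule dvd_sum) (rule E0_power[OF assms])

text \<open>If \<open>phi (gcd u q) d\<close> generated the subgroup of \<open>u\<close>, the section at \<open>0\<close> of the first power of
  \<open>rt u * d\<close> in \<open>S1\<close> would be \<open>rt u' * d\<close> with \<open>gcd u' q = gcd u q\<close> again.\<close>

lemma no_torsion_if_phi_unit:
  assumes d: "d \<in> D" and g: "g < q" "gcd (phi g d) q = g"
  shows "gcd u q = g \<Longrightarrow> N > 0 \<Longrightarrow> (rt u * d) ^ N \<noteq> 1"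
proof (induction N arbitrary: u rule: less_induct)
  case (less N)
  have gq: "g dvd q" "g > 0" using g(2) q_gt_1 gcd_pos_int[of "phi g d" q] gcd_dvd2[of "phi g d" q] by auto
  define n where "n = nat (q div g)"
  have "q div g > 1"
  proof (rule ccontr)
    assume "\<not> 1 < q div g"
    then have "q div g * g \<le> 1 * g" using gq by (intro mult_right_mono) auto
    then show False using gq g(1) by simp
  qed
  then have n: "n > 1" "int n = q div g" by (auto simp: n_def)
  let ?h = "rt u * d"
  have hG: "?h \<in> G" using rt_G D_in_G[OF d] G_mult by blast
  have rho: "q dvd \<rho> ?h - u" by (rule rho_rt_mult_D[OF d])
  have dvd_iff: "q dvd t * u \<longleftrightarrow> int n dvd t" for t
    using dvd_mult_iff_div_gcd[of q t u] q_gt_1 less.prems(1) n by simp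
  \<comment> \<open>The factor \<open>d\<close> comes from the single passage through letter 0;
    later passages meet only rooted sections. The summand for \<open>s = 0\<close> vanishes by
    \<open>E0_0\<close>.\<close>
  have secs: "sec (?h ^ Suc t) 0 = rt (\<Sum>s<Suc t. E0 d (int s * u)) * d" if "t < n" for t
    using that
  proof (induction t)
    case 0
    have "sec ?h 0 = sec (rt u) 0 * sec d 0" by (rule sec_mult_S1[OF rt_G D_S1[OF d]])
    then show ?case using sec_D_0[OF d, of 0] by (simp add: sec_rt E0_0)
  next
    case (Suc t)
    have nd: "\<not> q dvd int (Suc t) * u" using dvd_iff[of "int (Suc t)"] Suc.prems zdvd_not_zless[of "int (Suc t)" "int n"] by linarith
    have "sec (?h ^ Suc (Suc t)) 0 = sec ?h (0 + int (Suc t) * \<rho> ?h) * sec (?h ^ Suc t) 0"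
      by (rule sec_power_Suc[OF hG])
    also have "sec ?h (0 + int (Suc t) * \<rho> ?h) = sec ?h (int (Suc t) * u)"
      using rho by (intro sec_cong[OF hG]) (simp only: add_0 right_diff_distrib[symmetric] dvd_mult)
    also have "\<dots> = rt (E0 d (int (Suc t) * u))"
      using sec_mult_S1[OF rt_G D_S1[OF d]] rt_E0[OF d nd] by (simp add: sec_rt)
    also have "sec (?h ^ Suc t) 0 = rt (\<Sum>s<Suc t. E0 d (int s * u)) * d" using Suc by simp
    finally show ?case
      by (simp only: sum.lessThan_Suc[of _ "Suc t"] rt_add mult.assoc[symmetric] rt_commute)
  qed
  define u' where "u' = phi g d"
  have sec_n: "sec (?h ^ n) 0 = rt u' * d"
  proof -
    have "sec (?h ^ n) 0 = rt (\<Sum>s<n. E0 d (int s * u)) * d" using secs[of "n - 1"] n by simp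
    also have "(\<Sum>s<n. E0 d (int s * u)) = u'"
      using sum_orbit[of "E0 d" u g 0] E0_cong less.prems(1) by (simp add: n_def u'_def phi_def)
    finally show ?thesis .
  qed
  show ?case
  proof
    assume one: "?h ^ N = 1"
    have "q dvd \<rho> 1 - int N * \<rho> ?h" using rho_power[OF hG, of N] one by simp
    with rho_one rho have "q dvd int N * u" by Groebner_Basis.algebra
    then have "int n dvd int N" using dvd_iff by blast
    \<comment> \<open>\<open>n\<close> divides the exponent \<open>N\<close>, and the section at 0
      turns it into the smaller exponent \<open>N'\<close> of an element of the same shape.\<close>
    then obtain N' where N': "N = n * N'" by (auto elim: dvdE simp: int_dvd_int_iff)
    have "q dvd int n * u" using dvd_iff by simp
    with rho_power[OF hG, of n] rho have "q dvd \<rho> (?h ^ n)" by Groebner_Basis.algebra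
    then have "?h ^ n \<in> S1" using hG G_power by (simp add: S1_def)
    then have "sec ((?h ^ n) ^ N') 0 = (rt u' * d) ^ N'" using sec_power sec_n by metis
    then have "(rt u' * d) ^ N' = 1" using one N' by (simp add: power_mult)
    moreover have "N' < N" "N' > 0" using N' n less.prems by auto
    moreover have "gcd u' q = g" using g by (simp add: u'_def)
    ultimately show False using less.IH by blast
  qed
qed

text \<open>Otherwise \<open>gcd (phi (p ^ j) d) q = p ^ i\<close> with \<open>i \<le> j\<close>.
  The power of \<open>d\<close> with exponent \<open>p ^ (j - i)\<close> raises this to exactly
  \<open>p ^ j\<close>, and \<open>rt (p ^ j)\<close> times that power would have infinite
  order.\<close>

lemma phi_dvd:
  assumes d: "d \<in> D" and j: "j < k" shows "p ^ Suc j dvd phi (p ^ j) d"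
proof (rule ccontr)
  assume nd: "\<not> p ^ Suc j dvd phi (p ^ j) d"
  let ?g = "p ^ j"
  have gq: "?g dvd q" "?g < q" using j p_gt_1 by (auto simp: q_eq le_imp_power_dvd power_strict_increasing)
  obtain i where i: "i \<le> k" "gcd (phi ?g d) q = p ^ i"
    using divides_primepow[OF prime_p, of "gcd (phi ?g d) q" k] q_eq by (auto simp: normalize_int_def)
  have ij: "i \<le> j"
  proof (rule ccontr)
    assume "\<not> i \<le> j"
    then have "p ^ Suc j dvd p ^ i" by (intro le_imp_power_dvd) simp
    then show False using nd i(2) by (metis dvd_trans gcd_dvd1)
  qed
  obtain w where w: "phi ?g d = p ^ i * w" using i(2) by (metis dvdE gcd_dvd1)
  have pw: "\<not> p dvd w"
  proof
    assume "p dvd w"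
    then have "p ^ Suc i dvd phi ?g d" using w by (simp add: mult_dvd_mono)
    moreover have "p ^ Suc i dvd q" using ij j by (simp add: q_eq le_imp_power_dvd del: power_Suc)
    ultimately have "p ^ Suc i dvd p ^ i" using i(2) by (metis gcd_greatest)
    then have "p ^ Suc i \<le> p ^ i" using p_gt_1 by (intro zdvd_imp_le) auto
    moreover have "p ^ i < p ^ Suc i" using p_gt_1 by (intro power_strict_increasing) auto
    ultimately show False by simp
  qed
  define m where "m = nat (p ^ (j - i))"
  have m: "int m = p ^ (j - i)" using p_gt_1 by (simp add: m_def)
  have dm: "d ^ m \<in> D" by (rule subgrp_power[OF subgrp_D d])
  have eq: "int m * phi ?g d = ?g * w"
    using m w ij by (simp add: power_add[symmetric])
  have "gcd (phi ?g (d ^ m)) q = gcd (?g * w) q"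
  proof -
    obtain c where "phi ?g (d ^ m) - ?g * w = q * c" using phi_power[OF d, of ?g m] eq by (auto elim: dvdE)
    then have "phi ?g (d ^ m) = c * q + ?g * w" by (simp add: algebra_simps)
    then show ?thesis by (metis gcd.commute gcd_add_mult)
  qed
  also have "\<dots> = gcd (?g * w) (?g * p ^ (k - j))" using j by (simp add: q_eq power_add[symmetric])
  also have "\<dots> = ?g * gcd w (p ^ (k - j))" using p_gt_1 by (simp add: gcd_mult_distrib_int[symmetric])
  also have "gcd w (p ^ (k - j)) = 1"
    using pw prime_p by (metis coprime_iff_gcd_eq_1 coprime_commute coprime_power_right_iff prime_imp_coprime)
  finally have g: "gcd (phi ?g (d ^ m)) q = ?g" by simp
  have "gcd ?g q = ?g" using gq p_gt_1 by (simp add: gcd_proj1_iff)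
  moreover obtain N :: nat where "N > 0" "(rt ?g * d ^ m) ^ N = 1"
    using torsion[of "rt ?g * d ^ m"] G_mult rt_G D_in_G[OF dm] by blast
  ultimately show False using no_torsion_if_phi_unit[OF dm gq(2) g] by blast
qed

subsection \<open>Branching\<close>

lemma sec_dp': "d \<in> D \<Longrightarrow> sec (dp d s) i = (if q dvd i - s then d else rt (E0 d (i - s)))"
  using sec_dp[of d s i] sec_D[of d "i - s"] rt_E0[of d "i - s"] by auto

lemma not_q_dvd: "\<bar>j\<bar> < q \<Longrightarrow> j \<noteq> 0 \<Longrightarrow> \<not> q dvd j"
  using dvd_imp_le_int[of j q] q_gt_1 by auto

lemma sec_0_in_K: "y \<in> S1 \<Longrightarrow> (\<And>i. \<not> q dvd i \<Longrightarrow> sec y i = 1) \<Longrightarrow> sec y 0 \<in> K"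
  by (auto simp: K_def rist_def)

text \<open>The preimage in \<open>G\<close> of the centre of \<open>G\<close> modulo
  \<open>K\<close>.\<close>

definition Z :: "'a set" where "Z = {z \<in> G. \<forall>g\<in>G. comm z g \<in> K}"

lemma nrm_Z: "nrm Z G"
proof -
  have "subgrp {x \<in> G. comm x g \<in> K}" for g by (rule subgrp_comm_left[OF nrm_K G])
  then have sub: "subgrp Z" using G unfolding Z_def subgrp_def by blast
  show ?thesis unfolding nrm_def
  proof (intro conjI ballI)
    show "Z \<subseteq> G" by (auto simp: Z_def)
    fix h z assume h: "h \<in> G" and z: "z \<in> Z"
    have "comm (h * z * inverse h) g \<in> K" if g: "g \<in> G" for g
    proof -
      have "comm (h * z * inverse h) g = h * comm z (inverse h * g * h) * inverse h"
        by (simp add: comm_def mult.assoc)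
      moreover have "inverse h * g * h \<in> G" using h g G_mult G_inv by blast
      ultimately show ?thesis using z nrm_conj[OF nrm_K h] by (simp add: Z_def)
    qed
    then show "h * z * inverse h \<in> Z" using h z G_mult G_inv by (simp add: Z_def)
  qed (rule sub)
qed

lemma K_sub_Z: "K \<subseteq> Z"
  using nrm_comm_left[OF nrm_K G] nrm_sub[OF nrm_K] by (auto simp: Z_def)

lemma gen_induct_G: "subgrp H \<Longrightarrow> (\<And>s. rt s \<in> H) \<Longrightarrow> D \<subseteq> H \<Longrightarrow> G \<subseteq> H"
  by (subst G_gen) (rule gen_least, auto)

text \<open>As \<open>u\<close> is a unit, commutation with \<open>rt u\<close> spreads to all
  rooted elements, and \<open>D\<close> is abelian; so the generators commute modulo
  \<open>Z\<close> and \<open>der G\<close> lies in \<open>Z\<close>. Then \<open>Z\<close> has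
  finite index, and so has \<open>der Z\<close>, which lies in \<open>K\<close> because
  \<open>Z\<close> is central modulo \<open>K\<close>.\<close>

lemma fin_index_K_if:
  assumes u: "\<not> p dvd u" and f: "\<And>f. f \<in> D \<Longrightarrow> comm f (rt u) \<in> Z"
  shows "fin_index K G"
proof -
  note R = subgrp_comm_right[OF nrm_Z G] and L = subgrp_comm_left[OF nrm_Z G]
  have one: "1 \<in> Z" using nrm_subgrp[OF nrm_Z] subgrp_one by blast
  have D: "comm f g \<in> Z" if fD: "f \<in> D" and g: "g \<in> G" for f g
  proof -
    have "rt u \<in> {g \<in> G. comm f g \<in> Z}" using f[OF fD] rt_G by simp
    then have "rt s \<in> {g \<in> G. comm f g \<in> Z}" for s by (rule rt_in_subgrp[OF R _ u])
    moreover have "comm f e = 1" if "e \<in> D" for e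
      using D_commute[OF fD that] by (simp add: comm_eq_1_iff)
    then have "D \<subseteq> {g \<in> G. comm f g \<in> Z}" using one D_in_G by auto
    ultimately have "G \<subseteq> {g \<in> G. comm f g \<in> Z}" by (rule gen_induct_G[OF R])
    then show ?thesis using g by blast
  qed
  have rt: "comm (rt s) g \<in> Z" if g: "g \<in> G" for s g
  proof -
    have "D \<subseteq> {g \<in> G. comm (rt s) g \<in> Z}"
      using D[OF _ rt_G] D_in_G comm_swap subgrp_inv[OF nrm_subgrp[OF nrm_Z]] by (metis (no_types, lifting) mem_Collect_eq subsetI)
    then have "G \<subseteq> {g \<in> G. comm (rt s) g \<in> Z}" by (intro gen_induct_G[OF R]) (simp_all add: one rt_G)
    then show ?thesis using g by blast
  qed
  have "comm h g \<in> Z" if hg: "h \<in> G" "g \<in> G" for h g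
  proof -
    have "G \<subseteq> {h \<in> G. comm h g \<in> Z}"
      using D hg(2) rt D_in_G rt_G by (intro gen_induct_G[OF L]) auto
    then show ?thesis using hg by blast
  qed
  then have "der G \<subseteq> Z" by (intro der_least nrm_subgrp[OF nrm_Z])
  then have "fin_index Z G" using fin_index_derived[OF G] fin_index_refl[OF G] fin_index_mono by blast
  then have "fin_index (der Z) G" using fin_index_derived nrm_subgrp[OF nrm_Z] nrm_sub[OF nrm_Z] by blast
  moreover have "der Z \<subseteq> K" by (intro der_least nrm_subgrp[OF nrm_K]) (auto simp: Z_def)
  ultimately show ?thesis by (rule fin_index_mono)
qed

lemma E0_d0_1: "\<not> p dvd E0 d0 1"
  using d0_unit q_gt_1 by (simp add: E0_def)

text \<open>The commutator of \<open>dp f 0\<close> and \<open>dp d0 (- t)\<close> lives on the coordinates \<open>0\<close> and \<open>- t\<close>.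
  The determinant condition provides elements that are trivial at \<open>- t\<close> and arbitrary rooted
  at \<open>0\<close>, which commute the coordinate at \<open>- t\<close> away.\<close>

lemma comm_in_Z_if_det:
  assumes t: "\<not> q dvd t" and j: "\<not> q dvd i" "\<not> q dvd i - t" "\<not> q dvd j" "\<not> q dvd j - t"
    and det: "\<not> p dvd E0 d0 i * E0 d0 (j - t) - E0 d0 j * E0 d0 (i - t)"
    and f: "f \<in> D"
  shows "comm f (rt (E0 d0 t)) \<in> Z"
proof -
  define a where "a = E0 d0 i"
  define b where "b = E0 d0 (i - t)"
  define a' where "a' = E0 d0 j"
  define b' where "b' = E0 d0 (j - t)"
  have nt: "\<not> q dvd - t" using t by simp
  have solve: "\<exists>h\<in>S1. sec h 0 = rt u \<and> sec h (- t) = rt v" for u v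
  proof -
    have "coprime (a * b' - a' * b) q" using det coprime_q_iff by (simp add: a_def b_def a'_def b'_def)
    then obtain w c where "w * (a * b' - a' * b) + c * q = 1" using bezout_int[of "a * b' - a' * b" q] by auto
    then have w: "q dvd w * (a * b' - a' * b) - 1" by Groebner_Basis.algebra
    \<comment> \<open>Cramer's rule modulo \<open>q\<close>: \<open>w\<close> inverts the
      determinant, and reduction modulo \<open>q\<close> makes the solutions nonnegative
      exponents.\<close>
    define x where "x = (w * (u * b' - v * a')) mod q"
    define y where "y = (w * (v * a - u * b)) mod q"
    have x: "q dvd w * (u * b' - v * a') - x" "x \<ge> 0" using q_gt_1 by (auto simp: x_def)
    have y: "q dvd w * (v * a - u * b) - y" "y \<ge> 0" using q_gt_1 by (auto simp: y_def)
    define h where "h = dp d0 (- i) ^ nat x * dp d0 (- j) ^ nat y"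
    have S: "dp d0 (- i) ^ nat x \<in> S1" "dp d0 (- j) ^ nat y \<in> S1" using dp_S1[OF d0_D] S1_power by auto
    have sec: "sec h l = sec (dp d0 (- i)) l ^ nat x * sec (dp d0 (- j)) l ^ nat y" for l
      using S dp_S1[OF d0_D] by (simp add: h_def sec_mult_S1 S1_G sec_power)
    have "sec h 0 = rt (x * a + y * a')"
      using j x(2) y(2) by (simp add: sec sec_dp'[OF d0_D] rt_power rt_add a_def a'_def)
    moreover have "q dvd x * a + y * a' - u" using w x(1) y(1) by Groebner_Basis.algebra
    ultimately have 1: "sec h 0 = rt u" using rt_cong by simp
    have "sec h (- t) = rt (x * b + y * b')"
      using j x(2) y(2) by (simp add: sec sec_dp'[OF d0_D] rt_power rt_add b_def b'_def)
    moreover have "q dvd x * b + y * b' - v" using w x(1) y(1) by Groebner_Basis.algebra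
    ultimately have "sec h (- t) = rt v" using rt_cong by simp
    then show ?thesis using 1 S S1_mult h_def by blast
  qed
  define y where "y = comm (dp f 0) (dp d0 (- t))"
  define c where "c = comm f (rt (E0 d0 t))"
  have yS: "y \<in> S1" using dp_S1 f d0_D S1_comm by (simp add: y_def)
  have sec_y: "sec y l = comm (sec (dp f 0) l) (sec (dp d0 (- t)) l)" for l
    using dp_S1 f d0_D by (simp add: y_def sec_comm)
  have y0: "sec y 0 = c" using t by (simp add: sec_y sec_dp' f d0_D c_def)
  have yl: "sec y l = 1" if "\<not> q dvd l" "\<not> q dvd l + t" for l
    using that by (simp add: sec_y sec_dp' f d0_D)
  have cK: "comm c (sec h 0) \<in> K" if h: "h \<in> S1" "sec h (- t) = 1" for h
  proof -
    have "sec (comm y h) l = 1" if l: "\<not> q dvd l" for l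
    proof (cases "q dvd l + t")
      case True
      then have "sec h l = 1" using sec_cong[OF S1_G[OF h(1)], of l "- t"] h(2) by simp
      then show ?thesis using yS h by (simp add: sec_comm)
    next
      case False
      then show ?thesis using yl[OF l] yS h by (simp add: sec_comm)
    qed
    then have "sec (comm y h) 0 \<in> K" using S1_comm[OF yS h(1)] by (rule sec_0_in_K[rotated])
    then show ?thesis using yS h y0 by (simp add: sec_comm)
  qed
  have cG: "c \<in> G" using f D_in_G rt_G G_comm by (simp add: c_def)
  have "comm c (rt s) \<in> K" for s using solve[of s 0] cK by force
  moreover have "comm c e \<in> K" if e: "e \<in> D" for e
  proof -
    \<comment> \<open>\<open>h\<close> cancels the rooted section of \<open>dp e 0\<close> at
      \<open>- t\<close> and leaves its section \<open>e\<close> at 0 intact.\<close>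
    obtain h where h: "h \<in> S1" "sec h 0 = rt 0" "sec h (- t) = rt (- E0 e (- t))" using solve by blast
    have "sec (dp e 0 * h) l = sec (dp e 0) l * sec h l" for l
      using dp_S1[OF e] h(1) by (simp add: sec_mult_S1 S1_G)
    then have "sec (dp e 0 * h) 0 = e" "sec (dp e 0 * h) (- t) = 1"
      using h nt by (simp_all add: sec_dp'[OF e] rt_add[symmetric])
    then show ?thesis using cK[of "dp e 0 * h"] S1_mult dp_S1[OF e] h(1) by simp
  qed
  ultimately have "G \<subseteq> {g \<in> G. comm c g \<in> K}"
    using rt_G D_in_G by (intro gen_induct_G subgrp_comm_right[OF nrm_K G]) auto
  then show ?thesis using cG by (auto simp: Z_def c_def)
qed

lemma E0_zero [simp]: "E0 d 0 = 0"
  by (simp add: E0_def)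

lemma phi_1: "(\<Sum>n<nat q. E0 d (int n)) = phi 1 d"
  using sum_orbit[of "E0 d" 1 1 0] E0_cong by (simp add: phi_def)

lemma p_dvd_phi_1: "d \<in> D \<Longrightarrow> p dvd phi 1 d"
  using phi_dvd[of d 0] k_pos by simp

text \<open>The exceptional case: for \<open>q = 3\<close> (the Gupta-Sidki group) there are too few coordinates
  for the determinant argument.\<close>

lemma comm_in_Z_3:
  assumes q3: "q = 3" and f: "f \<in> D"
  shows "comm f (rt (E0 d0 1)) \<in> Z"
proof -
  define b where "b = rt (E0 d0 1)"
  have p3: "p = 3"
  proof -
    have "p dvd 3" using p_dvd_q q3 by simp
    then have "p \<le> 3" using zdvd_imp_le by fastforce
    moreover have "p \<noteq> 2" using \<open>p dvd 3\<close> by auto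
    ultimately show ?thesis using p_gt_1 by simp
  qed
  have "E0 d0 2 + E0 d0 1 = phi 1 d0"
    using phi_1[of d0] q3 E0_zero[of d0] by (simp add: numeral_3_eq_3 lessThan_Suc numeral_2_eq_2)
  then have "q dvd E0 d0 2 - (- E0 d0 1)" using p_dvd_phi_1[OF d0_D] p3 q3 by simp
  then have b2: "rt (E0 d0 2) = inverse b" by (simp add: b_def rt_inv rt_eq_iff)
  have E: "rt (E0 d0 i) = b" if "q dvd i - 1" for i using E0_cong[OF that] by (simp add: b_def)
  have E': "rt (E0 d0 i) = inverse b" if "q dvd i - 2" for i using E0_cong[OF that] b2 by simp
  have b3: "b * b * b = 1" using rt_power[of "E0 d0 1" 3] rt_cong[of "3 * E0 d0 1" 0] q3
    by (simp add: b_def power3_eq_cube)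
  have Es: "rt (E0 d0 1) = b" "rt (E0 d0 (- 2)) = b" "rt (E0 d0 2) = inverse b"
    "rt (E0 d0 (- 1)) = inverse b"
    by (rule E E', simp add: q3)+
  have nd: "\<bar>q\<bar> \<noteq> 1" "\<not> q dvd 2" using q3 by auto
  let ?d = "dp d0"
  have S: "?d s \<in> S1" for s by (rule dp_S1[OF d0_D])
  have s: "sec (?d 0) 0 = d0" "sec (?d 0) 1 = b" "sec (?d 0) (- 1) = inverse b"
    "sec (?d 1) 1 = d0" "sec (?d 1) 0 = inverse b" "sec (?d 1) (- 1) = b"
    "sec (?d (- 1)) (- 1) = d0" "sec (?d (- 1)) 0 = b" "sec (?d (- 1)) 1 = inverse b"
    by (simp_all add: sec_dp'[OF d0_D] nd Es)
  define c where "c = comm d0 b"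
  \<comment> \<open>Each of the three commutators lives on two of the letters 0, 1, -1. In this
    order, with the middle one inverted and conjugated, the contributions at 1 and at -1 cancel and
    only letter 0 remains.\<close>
  define y where "y = comm (?d 0) (?d (- 1)) * inverse (?d 0 * comm (?d (- 1)) (?d 1) * inverse (?d 0))
     * comm (?d 1) (?d 0)"
  have yS: "y \<in> S1" unfolding y_def by (intro S1_mult S1_inv S1_comm S)
  have sec_y: "sec y l = comm (sec (?d 0) l) (sec (?d (- 1)) l)
     * inverse (sec (?d 0) l * comm (sec (?d (- 1)) l) (sec (?d 1) l) * inverse (sec (?d 0) l))
     * comm (sec (?d 1) l) (sec (?d 0) l)" for l
    unfolding y_def using S S1_comm S1_mult S1_inv
    by (simp add: sec_mult_S1 sec_inv_S1 sec_comm S1_G)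
  have cases3: "\<exists>j\<in>{0, 1, - 1}. q dvd l - j" for l
  proof -
    have "3 dvd l \<or> 3 dvd l - 1 \<or> 3 dvd l + 1" by presburger
    then show ?thesis using q3 by auto
  qed
  have y0: "sec y 0 = c * comm (inverse b) d0" by (simp add: sec_y s c_def comm_def mult.assoc)
  have y1: "sec y 1 = 1" "sec y (- 1) = 1" by (simp_all add: sec_y s comm_def mult.assoc)
  have "sec y l = 1" if "\<not> q dvd l" for l
    using cases3[of l] y1 that sec_cong[OF S1_G[OF yS], of l 1] sec_cong[OF S1_G[OF yS], of l "- 1"]
    by auto
  then have cc: "c * comm (inverse b) d0 \<in> K" using sec_0_in_K[OF yS] y0 by simp
  have bG: "b \<in> G" "d0 \<in> G" "c \<in> G" using rt_G D_in_G[OF d0_D] G_comm by (auto simp: b_def c_def)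
  note Ks = nrm_subgrp[OF nrm_K]
  \<comment> \<open>Membership of \<open>T\<close> in \<open>K\<close> says that \<open>b\<close>
    inverts \<open>c\<close> modulo \<open>K\<close>. Then \<open>(c * b) ^ 3 = 1\<close>, which is
    \<open>b ^ 3 = 1\<close> conjugated by \<open>d0\<close>, collapses to \<open>c = 1\<close>
    modulo \<open>K\<close>.\<close>
  define T where "T = b * c * inverse b * c"
  have "T = b * (c * comm (inverse b) d0) * inverse b" by (simp add: T_def c_def comm_def mult.assoc)
  then have TK: "T \<in> K" using nrm_conj[OF nrm_K bG(1) cc] by simp
  have bb: "inverse b * inverse b = b" 
  proof -
    have "b * (b * b) = 1" using b3 by (simp add: mult.assoc)
    then have "b * b = inverse b" by (simp only: mg_eq_1_iff)
    then have "inverse (b * b) = b" by (simp del: mg_simps(7))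
    then show ?thesis by simp
  qed
  have "1 = d0 * (b * b * b) * inverse d0" by (simp add: b3)
  also have "\<dots> = (c * b) * (c * b) * (c * b)" by (simp add: c_def comm_def mult.assoc)
  also have "\<dots> = (c * T * inverse c) * (b * T * inverse b) * c * inverse T"
    using bb by (simp add: T_def mult.assoc)
  finally have "(c * T * inverse c) * (b * T * inverse b) * c * inverse T = 1"
    by (rule sym)
  then have "(c * T * inverse c) * ((b * T * inverse b) * c * inverse T) = 1" by (simp only: mult.assoc)
  then have "inverse (c * T * inverse c) = (b * T * inverse b) * c * inverse T"
    by (simp only: mg_eq_1_iff)
  then have "c = inverse (b * T * inverse b) * (inverse (c * T * inverse c) * T)"
    by (simp only:) (simp add: mult.assoc)
  moreover have "inverse (b * T * inverse b) * (inverse (c * T * inverse c) * T) \<in> K"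
    using nrm_conj[OF nrm_K bG(1) TK] nrm_conj[OF nrm_K bG(3) TK] TK
      subgrp_mult[OF Ks] subgrp_inv[OF Ks] by (simp del: mg_simps(7))
  ultimately have cK: "comm d0 b \<in> K" by (simp add: c_def)
  have "b \<in> {g \<in> G. comm g d0 \<in> K}" using cK comm_swap[of b d0] subgrp_inv[OF Ks] bG by simp
  then have rt: "comm (rt s) d0 \<in> K" for s
    using rt_in_subgrp[OF subgrp_comm_left[OF nrm_K G] _ E0_d0_1] by (auto simp: b_def)
  \<comment> \<open>The section at -1 is a commutator of a rooted element with \<open>d0\<close>,
    which is known to lie in \<open>K\<close> by now; an element of \<open>rist (- 1)\<close>
    removes it and leaves \<open>comm f b\<close> at 0.\<close>
  define x where "x = comm (dp f 0) (?d (- 1))"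
  have xS: "x \<in> S1" using S dp_S1[OF f] S1_comm by (simp add: x_def)
  have sec_x: "sec x l = comm (sec (dp f 0) l) (sec (?d (- 1)) l)" for l
    using S dp_S1[OF f] by (simp add: x_def sec_comm)
  have x0: "sec x 0 = comm f b" by (simp add: sec_x s sec_dp'[OF f])
  have x1: "sec x 1 = 1" using q3 by (simp add: sec_x s sec_dp'[OF f] b_def rt_inv)
  have "sec x (- 1) \<in> K" using nd by (simp add: sec_x s sec_dp'[OF f] rt)
  then obtain h where h: "h \<in> rist (- 1)" "sec h (- 1) = sec x (- 1)" by (rule K_rist)
  have hS: "h \<in> S1" using h rist_S1 by blast
  have sec_xh: "sec (x * inverse h) l = sec x l * inverse (sec h l)" for l
    using xS hS by (simp add: sec_mult_S1 sec_inv_S1 S1_inv S1_G)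
  have h01: "sec h 0 = 1" "sec h 1 = 1" using rist_sec[OF h(1)] q3 by auto
  have "sec (x * inverse h) l = 1" if "\<not> q dvd l" for l
    using cases3[of l] that sec_cong[OF S1_G[OF S1_mult[OF xS S1_inv[OF hS]]], of l 1]
      sec_cong[OF S1_G[OF S1_mult[OF xS S1_inv[OF hS]]], of l "- 1"] x1 h h01
    by (auto simp: sec_xh)
  then have "sec (x * inverse h) 0 \<in> K" using S1_mult[OF xS S1_inv[OF hS]] by (rule sec_0_in_K[rotated])
  then show ?thesis using x0 h01 K_sub_Z by (auto simp: sec_xh b_def)
qed

lemma p_dvd_mult_iff: "p dvd a * b \<longleftrightarrow> p dvd a \<or> p dvd b"
  using prime_p by (simp add: prime_dvd_mult_iff)

text \<open>For \<open>q = 2\<close> the orbit sum would be a single unit exponent. For q >= 4 write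
  e_i for \<open>E0 d0 i\<close>. If all determinants with t = 1 and i = 2 vanish modulo
  \<open>p\<close>, the sequence e_1, ..., e_(q-1) is geometric modulo \<open>p\<close> with some
  ratio r. As \<open>p\<close> divides its sum, r is neither 0 nor 1 and r^(q-1) = 1, so e_(-1) =
  e_1 / r. The determinant with t = 2, i = 1, j = 3 is then e_1^2 (1 - r), a unit.\<close>

lemma fin_index_K: "fin_index K G"
proof -
  let ?e = "E0 d0"
  have q3: "q \<ge> 3"
  proof (rule ccontr)
    assume "\<not> q \<ge> 3"
    then have "q = 2" using q_gt_1 by simp
    then have "phi 1 d0 = ?e 1" using phi_1[of d0] E0_zero[of d0] by (simp add: numeral_2_eq_2)
    then show False using E0_d0_1 p_dvd_phi_1[OF d0_D] by simp
  qed
  show ?thesis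
  proof (cases "q = 3")
    case True
    then show ?thesis using fin_index_K_if[OF E0_d0_1] comm_in_Z_3 by blast
  next
    case False
    then have q4: "q \<ge> 4" using q3 by simp
    show ?thesis
    proof (cases "\<exists>j. 3 \<le> j \<and> j < q \<and> \<not> p dvd ?e 2 * ?e (j - 1) - ?e j * ?e 1")
      case True
      then obtain j where j: "3 \<le> j" "j < q" "\<not> p dvd ?e 2 * ?e (j - 1) - ?e j * ?e (2 - 1)" by auto
      have "comm f (rt (?e 1)) \<in> Z" if "f \<in> D" for f
        by (rule comm_in_Z_if_det[OF _ _ _ _ _ j(3) that])
           (use not_q_dvd[of 1] not_q_dvd[of 2] not_q_dvd[of j] not_q_dvd[of "j - 1"] j q4 in simp_all)
      then show ?thesis by (rule fin_index_K_if[OF E0_d0_1])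
    next
      case False
      have "coprime (?e 1) p" using E0_d0_1 prime_imp_coprime[OF prime_p] coprime_commute by blast
      then obtain v c where "v * ?e 1 + c * p = 1" using bezout_int[of "?e 1" p] by auto
      then have v: "p dvd v * ?e 1 - 1" by Groebner_Basis.algebra
      define r where "r = v * ?e 2"
      have r: "p dvd r * ?e 1 - ?e 2" using v unfolding r_def by Groebner_Basis.algebra
      have step: "p dvd ?e j - r * ?e (j - 1)" if "2 \<le> j" "j < q" for j
      proof -
        have "p dvd ?e 2 * ?e (j - 1) - ?e j * ?e 1" using False that by (cases "j = 2") auto
        with r have "p dvd (?e j - r * ?e (j - 1)) * ?e 1" by Groebner_Basis.algebra
        then show ?thesis using p_dvd_mult_iff E0_d0_1 by blast
      qed
      have geo: "p dvd ?e (int n + 1) - r ^ n * ?e 1" if "int n + 1 < q" for n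
        using that
      proof (induction n)
        case (Suc n)
        define w where "w = r ^ n"
        have "p dvd ?e (int n + 1) - w * ?e 1" using Suc by (simp add: w_def)
        moreover have "p dvd ?e (int n + 2) - r * ?e (int n + 1)" using step[of "int n + 2"] Suc.prems
          by (simp add: add.commute)
        ultimately have "p dvd ?e (int n + 2) - r * w * ?e 1" by Groebner_Basis.algebra
        then show ?case by (simp add: add.commute w_def)
      qed simp
      define m where "m = nat (q - 1)"
      have m: "int m = q - 1" "nat q = Suc m" "m > 0" using q4 by (auto simp: m_def)
      define s where "s = (\<Sum>n<m. r ^ n)"
      have "phi 1 d0 = (\<Sum>n<m. ?e (int n + 1))"
        using phi_1[of d0] by (simp add: m sum.lessThan_Suc_shift E0_0 add.commute del: sum.lessThan_Suc)
      moreover have "p dvd (\<Sum>n<m. ?e (int n + 1)) - s * ?e 1"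
        unfolding s_def sum_distrib_right sum_subtractf[symmetric] by (rule dvd_sum) (use m geo in auto)
      ultimately have "p dvd phi 1 d0 - s * ?e 1" by simp
      with p_dvd_phi_1[OF d0_D] have "p dvd s * ?e 1" by Groebner_Basis.algebra
      then have ps: "p dvd s" using p_dvd_mult_iff E0_d0_1 by blast
      have "(r - 1) * s = r ^ m - 1" unfolding s_def by (rule power_diff_1_eq[symmetric])
      then have rm: "p dvd r ^ m - 1" using ps by (metis dvd_mult)
      have nr: "\<not> p dvd r"
      proof
        assume "p dvd r"
        moreover have "r dvd r ^ m" using m(3) by simp
        ultimately have "p dvd r ^ m" by (rule dvd_trans)
        with rm have "p dvd 1" by (metis dvd_diff_right_iff)
        then show False using p_gt_1 by simp
      qed
      \<comment> \<open>For ratio 1 the sum \<open>s\<close> would be \<open>q - 1\<close>, that is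
        -1 modulo \<open>p\<close>.\<close>
      have nr1: "\<not> p dvd r - 1"
      proof
        assume "p dvd r - 1"
        then have "p dvd r ^ n - 1" for n
          using power_diff_1_eq[of r n] by simp
        then have "p dvd (\<Sum>n<m. r ^ n - 1)" by (intro dvd_sum) auto
        then have "p dvd s - (q - 1)" by (simp add: sum_subtractf s_def m(1))
        with ps p_dvd_q have "p dvd 1" by Groebner_Basis.algebra
        then show False using p_gt_1 by simp
      qed
      have e2: "\<not> p dvd ?e 2"
      proof
        assume "p dvd ?e 2"
        with r have "p dvd r * ?e 1" by Groebner_Basis.algebra
        then show False using nr E0_d0_1 p_dvd_mult_iff by blast
      qed
      have e3: "p dvd ?e 3 - r * r * ?e 1" using geo[of 2] q4 by (simp add: power2_eq_square)
      have "int (m - 1) + 1 < q" using m by simp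
      moreover have "int (m - 1) + 1 = q - 1" using m by simp
      moreover have "?e (q - 1) = ?e (- 1)" by (rule E0_cong) simp
      moreover define w where "w = r ^ (m - 1)"
      ultimately have "p dvd ?e (- 1) - w * ?e 1" using geo[of "m - 1"] by metis
      moreover have "r * w = r ^ m" unfolding w_def using m(3) by (metis power_minus_mult mult.commute)
      then have "p dvd r * w - 1" using rm by simp
      ultimately have e': "p dvd r * ?e (- 1) - ?e 1" by Groebner_Basis.algebra
      have "\<not> p dvd ?e 1 * ?e 1 - ?e 3 * ?e (- 1)"
      proof
        assume "p dvd ?e 1 * ?e 1 - ?e 3 * ?e (- 1)"
        with e3 e' have "p dvd (r - 1) * (?e 1 * ?e 1)" by Groebner_Basis.algebra
        then show False using nr1 E0_d0_1 p_dvd_mult_iff by blast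
      qed
      then have det: "\<not> p dvd ?e 1 * ?e (3 - 2) - ?e 3 * ?e (1 - 2)" by simp
      have "comm f (rt (?e 2)) \<in> Z" if "f \<in> D" for f
        by (rule comm_in_Z_if_det[OF _ _ _ _ _ det that])
           (use not_q_dvd[of 1] not_q_dvd[of 2] not_q_dvd[of 3] q4 in simp_all)
      then show ?thesis by (rule fin_index_K_if[OF e2])
    qed
  qed
qed

subsection \<open>Just infiniteness and dense subgroups\<close>

lemma sect_E:
  assumes "x \<in> sect H i" obtains h where "h \<in> H" "h \<in> S1" "x = sec h i"
  using assms by (auto simp: sect_def)

lemma G_sec_E:
  assumes "g \<in> G" obtains x where "x \<in> S1" "g = sec x i"
  using assms sect_E[of g G i] sect_G[of i] by auto

lemma nrm_sect: assumes N: "nrm N G" shows "nrm (sect N i) G"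
  unfolding nrm_def
proof (intro conjI ballI)
  show "subgrp (sect N i)" by (rule subgrp_sect[OF nrm_subgrp[OF N]])
  show "sect N i \<subseteq> G" by (rule sect_sub_G)
  fix g n assume g: "g \<in> G" and n: "n \<in> sect N i"
  obtain x where x: "x \<in> S1" "g = sec x i" using G_sec_E[OF g] by blast
  obtain h where h: "h \<in> N" "h \<in> S1" "n = sec h i" using n by (rule sect_E)
  have "x * h * inverse x \<in> N" by (rule nrm_conj[OF N S1_G[OF x(1)] h(1)])
  moreover have "x * h * inverse x \<in> S1" by (rule S1_conj[OF S1_G[OF x(1)] h(2)])
  moreover have "sec (x * h * inverse x) i = g * n * inverse g"
    using sec_conj_S1[OF x(1) h(2)] x h by simp
  ultimately show "g * n * inverse g \<in> sect N i" by (metis sect_I)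
qed

text \<open>For \<open>N = G\<close> and \<open>i = 0\<close> this is \<open>K\<close>.\<close>

definition rist_sec :: "'a set \<Rightarrow> int \<Rightarrow> 'a set" where
  "rist_sec N i = (\<lambda>h. sec h i) ` (N \<inter> rist i)"

lemma nrm_rist_sec: "nrm N G \<Longrightarrow> nrm (rist_sec N i) G"
  unfolding rist_sec_def by (rule nrm_sec_rist)

lemma rist_sec_conj: assumes N: "nrm N G" shows "rist_sec N 0 \<subseteq> rist_sec N i"
proof
  fix x assume "x \<in> rist_sec N 0"
  then obtain h where h: "h \<in> N" "h \<in> rist 0" "x = sec h 0" by (auto simp: rist_sec_def)
  have "rt i * h * rt (- i) \<in> N \<inter> rist (0 + i)"
    using nrm_conj[OF N rt_G h(1), of i] rist_conj_rt[OF h(2), of i] by (simp add: rt_inv)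
  moreover have "sec (rt i * h * rt (- i)) (0 + i) = x" using sec_conj_rt[OF rist_S1[OF h(2)], of i 0] h by simp
  ultimately show "x \<in> rist_sec N i" by (metis add_0 image_eqI rist_sec_def)
qed

text \<open>\<open>der L\<close> lies in \<open>rist_sec N 0\<close>, which thus has finite index.
  Elements of \<open>S1\<close> with all sections in it are products of elements of \<open>N\<close>
  supported at single letters, so they lie in \<open>N\<close>.\<close>

lemma fin_index_if_rist_sec:
  assumes N: "nrm N G" and L: "subgrp L" "L \<subseteq> G" "fin_index L G"
    and c: "\<And>x y. x \<in> L \<Longrightarrow> y \<in> L \<Longrightarrow> comm x y \<in> rist_sec N 0"
  shows "fin_index N G"
proof -
  have "der L \<subseteq> rist_sec N 0" using c by (intro der_least nrm_subgrp[OF nrm_rist_sec[OF N]])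
  then have "fin_index (rist_sec N 0) G" using fin_index_derived[OF L] fin_index_mono by blast
  then have "fin_index (lift (rist_sec N 0)) G" by (rule fin_index_lift)
  moreover have "lift (rist_sec N 0) \<subseteq> N"
  proof
    fix g assume g: "g \<in> lift (rist_sec N 0)"
    show "g \<in> N"
    proof (rule in_subgrp_if_rist[OF nrm_subgrp[OF N]])
      show "g \<in> S1" using g lift_sub_S1 by blast
      fix i
      have "sec g i \<in> rist_sec N i" using g rist_sec_conj[OF N] by (auto simp: lift_def)
      then show "\<exists>h\<in>N \<inter> rist i. sec h i = sec g i" by (auto simp: rist_sec_def)
    qed
  qed
  ultimately show ?thesis by (rule fin_index_mono)
qed

lemma sect_not_sub_lev:
  assumes N: "nrm N G" "N \<subseteq> S1" "\<not> N \<subseteq> lev (Suc m)" shows "\<not> sect N 0 \<subseteq> lev m"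
proof -
  obtain n where n: "n \<in> N" "n \<notin> lev (Suc m)" using N(3) by blast
  then obtain i where i: "sec n i \<notin> lev m" using N(2) by (auto simp: lev_Suc lift_def)
  have c: "rt (- i) * n * rt (- (- i)) \<in> N" using nrm_conj[OF N(1) rt_G n(1), of "- i"] by (simp add: rt_inv)
  have "sec (rt (- i) * n * rt (- (- i))) (i + - i) = sec n i"
    using n N(2) by (intro sec_conj_rt) auto
  then have "sec n i \<in> sect N 0" using sect_I[OF c, of 0] c N(2) by auto
  then show ?thesis using i by blast
qed

text \<open>If \<open>N\<close> moves letters, double commutators with elements of
  \<open>rist 0\<close> put all commutators of \<open>K\<close> into \<open>N\<close> at letter 0.
  Otherwise \<open>sect N 0\<close> leaves a stabiliser of one level less, so it has finite index by
  induction, and single commutators with \<open>rist 0\<close> suffice.\<close>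

lemma just_infinite_lev:
  "nrm N G \<Longrightarrow> \<not> N \<subseteq> lev (Suc m) \<Longrightarrow> fin_index N G"
proof (induction m arbitrary: N)
  have base: "fin_index N G" if N: "nrm N G" "\<not> N \<subseteq> S1" for N
  proof (rule fin_index_if_rist_sec[OF N(1) nrm_subgrp[OF nrm_K] nrm_sub[OF nrm_K] fin_index_K])
    obtain n where n: "n \<in> N" "n \<notin> S1" using N(2) by blast
    have nG: "n \<in> G" using n nrm_sub[OF N(1)] by blast
    have rho: "\<not> q dvd 0 - (0 + \<rho> n)" using n nG by (simp add: S1_def)
    fix x y assume xy: "x \<in> K" "y \<in> K"
    \<comment> \<open>Inverted, because \<open>n\<close> carries \<open>r\<close> to another letter
      and only the factor \<open>inverse r\<close> of \<open>comm n r\<close> is visible at letter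
      0.\<close>
    obtain r where r: "r \<in> rist 0" "sec r 0 = inverse x"
      using K_rist subgrp_inv[OF nrm_subgrp[OF nrm_K] xy(1)] by blast
    obtain s where s: "s \<in> rist 0" "sec s 0 = y" using K_rist[OF xy(2)] by blast
    have nr: "comm n r = (n * r * inverse n) * inverse r" by (simp add: comm_def mult.assoc)
    have c: "n * r * inverse n \<in> rist (0 + \<rho> n)" by (rule rist_conj[OF nG r(1)])
    have S: "n * r * inverse n \<in> S1" "r \<in> S1" using c r rist_S1 by auto
    then have cS: "comm n r \<in> S1" unfolding nr using S1_mult S1_inv by blast
    have "sec (comm n r) 0 = sec (n * r * inverse n) 0 * inverse (sec r 0)"
      unfolding nr using S S1_inv by (metis S1_G sec_inv_S1 sec_mult_S1)
    then have s0: "sec (comm n r) 0 = x" using rist_sec[OF c rho] r by simp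
    have "comm (comm n r) s \<in> N"
      using nrm_comm_left[OF N(1) G] n(1) S1_G S(2) rist_S1[OF s(1)] by blast
    moreover have "comm (comm n r) s \<in> rist 0" by (rule rist_comm_left(1)[OF cS s(1)])
    moreover have "sec (comm (comm n r) s) 0 = comm x y"
      using sec_comm[OF cS rist_S1[OF s(1)]] s0 s(2) by simp
    ultimately show "comm x y \<in> rist_sec N 0" unfolding rist_sec_def by (metis IntI image_eqI)
  qed
  {
    case 0
    then show ?case using base by (simp add: lev_1)
  next
    case (Suc m)
    show ?case
    proof (cases "N \<subseteq> S1")
      case True
      note N = Suc.prems(1)
      have "fin_index (sect N 0) G"
        using Suc.IH[OF nrm_sect[OF N]] sect_not_sub_lev[OF N True Suc.prems(2)] by blast
      then have fi: "fin_index (sect N 0 \<inter> K) G" using fin_index_K by (rule fin_index_Int)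
      have nr: "nrm (sect N 0 \<inter> K) G" using nrm_sect[OF N] nrm_K by (rule nrm_Int)
      show ?thesis
      proof (rule fin_index_if_rist_sec[OF N nrm_subgrp[OF nr] nrm_sub[OF nr] fi])
        fix x y assume "x \<in> sect N 0 \<inter> K" "y \<in> sect N 0 \<inter> K"
        then obtain n where n: "n \<in> N" "n \<in> S1" "x = sec n 0" and yK: "y \<in> K" by (auto simp: sect_def)
        obtain s where s: "s \<in> rist 0" "sec s 0 = y" using K_rist[OF yK] by blast
        have "comm n s \<in> N \<inter> rist 0"
          using nrm_comm_left[OF N G n(1)] S1_G rist_S1[OF s(1)] rist_comm_left(1)[OF n(2) s(1)] by blast
        moreover have "sec (comm n s) 0 = comm x y" using sec_comm[OF n(2) rist_S1[OF s(1)]] n s by simp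
        ultimately show "comm x y \<in> rist_sec N 0" unfolding rist_sec_def by (metis image_eqI)
      qed
    next
      case False
      then show ?thesis using base Suc.prems by blast
    qed
  }
qed

lemma ex_not_in_lev: assumes "g \<in> G" "g \<noteq> 1" shows "\<exists>m. g \<notin> lev (Suc m)"
proof -
  obtain n where "g \<notin> lev n" using residual assms by blast
  then show ?thesis using assms lev_0 by (cases n) auto
qed

lemma just_infinite: assumes N: "nrm N G" "N \<noteq> {1}" shows "fin_index N G"
proof -
  obtain n where "n \<in> N" "n \<noteq> 1" using N subgrp_one[OF nrm_subgrp[OF N(1)]] by blast
  then obtain m where "\<not> N \<subseteq> lev (Suc m)" using ex_not_in_lev nrm_sub[OF N(1)] by blast
  then show ?thesis using just_infinite_lev N by blast
qed

lemma fin_index_not_trivial: "fin_index N G \<Longrightarrow> N \<noteq> {1}"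
  using fin_index_one_imp_finite infinite_G by blast

text \<open>An abelian subgroup has trivial derived subgroup, which would have finite index in the
  infinite group \<open>G\<close>.\<close>

lemma fin_index_not_abelian:
  assumes "subgrp A" "A \<subseteq> G" "fin_index A G" shows "\<exists>x\<in>A. \<exists>y\<in>A. comm x y \<noteq> 1"
proof (rule ccontr)
  assume "\<not> ?thesis"
  then have "der A \<subseteq> {1}" by (intro der_least) (auto simp: subgrp_def)
  then have "fin_index {1} G" using fin_index_derived[OF assms] fin_index_mono by blast
  then show False using fin_index_not_trivial by blast
qed

text \<open>\<open>K\<close> is isomorphic to \<open>rist 0\<close> by \<open>\<phi>\<close>, the
  inverse of taking sections at 0. The elements that \<open>\<phi>\<close> sends into
  \<open>N\<close> have finite index in \<open>K\<close>, hence in \<open>G\<close>.\<close>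

lemma fin_index_rist_sec: assumes N: "nrm N G" "fin_index N G" shows "fin_index (rist_sec N 0) G"
proof -
  obtain \<phi> where \<phi>: "\<And>x. x \<in> K \<Longrightarrow> \<phi> x \<in> rist 0" "\<And>x. x \<in> K \<Longrightarrow> sec (\<phi> x) 0 = x"
  proof -
    have "\<forall>x\<in>K. \<exists>h. h \<in> rist 0 \<and> sec h 0 = x" using K_rist by blast
    then show ?thesis using that by metis
  qed
  have K: "subgrp K" by (rule nrm_subgrp[OF nrm_K])
  have "\<phi> (inverse b * c) = inverse (\<phi> b) * \<phi> c" if "b \<in> K" "c \<in> K" for b c
  proof (rule rist_eqI)
    have bc: "inverse b * c \<in> K" by (intro subgrp_mult[OF K] subgrp_inv[OF K] that)
    show "\<phi> (inverse b * c) \<in> rist 0" by (rule \<phi>(1)[OF bc])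
    show "inverse (\<phi> b) * \<phi> c \<in> rist 0"
      by (intro subgrp_mult[OF subgrp_rist] subgrp_inv[OF subgrp_rist] \<phi>(1) that)
    have "\<phi> b \<in> S1" "\<phi> c \<in> S1" using \<phi>(1) that rist_S1 by auto
    then show "sec (\<phi> (inverse b * c)) 0 = sec (inverse (\<phi> b) * \<phi> c) 0"
      using \<phi>(2) that bc by (simp add: sec_mult_S1 sec_inv_S1 S1_inv S1_G)
  qed
  moreover have "\<phi> c \<in> G" if "c \<in> K" for c by (rule S1_G[OF rist_S1[OF \<phi>(1)[OF that]]])
  ultimately have "fin_index {c \<in> K. \<phi> c \<in> N} K" using fin_index_preimage[OF N(2) K] by blast
  then have "fin_index {c \<in> K. \<phi> c \<in> N} G"
    using fin_index_K G nrm_sub[OF nrm_K] by (rule fin_index_trans)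
  moreover have "{c \<in> K. \<phi> c \<in> N} \<subseteq> rist_sec N 0"
  proof
    fix c assume "c \<in> {c \<in> K. \<phi> c \<in> N}"
    then have "\<phi> c \<in> N \<inter> rist 0" "c = sec (\<phi> c) 0" using \<phi> by auto
    then show "c \<in> rist_sec N 0" unfolding rist_sec_def by (rule image_eqI[rotated])
  qed
  ultimately show ?thesis by (rule fin_index_mono)
qed

lemma rist_disjoint_comm:
  assumes "g \<in> rist i" "h \<in> rist j" "\<not> q dvd i - j" shows "comm g h = 1"
proof (rule S1_eq_oneI)
  have S: "g \<in> S1" "h \<in> S1" using assms rist_S1 by auto
  then show "comm g h \<in> S1" by (rule S1_comm)
  fix l
  have "\<not> q dvd l - i \<or> \<not> q dvd l - j" using assms(3) by (metis dvd_diff_sym dvd_diff_trans)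
  then show "sec (comm g h) l = 1" using S assms rist_sec by (auto simp: sec_comm)
qed

text \<open>The conclusion is stable under perturbation of \<open>x\<close> by \<open>N'\<close>, so that \<open>x\<close> may later be
  replaced by an element of a dense subgroup.\<close>

lemma ex_commuting_conjugate_lev:
  "nrm N G \<Longrightarrow> fin_index N G \<Longrightarrow> nrm H G \<Longrightarrow> fin_index H G \<Longrightarrow> \<not> H \<subseteq> lev (Suc m) \<Longrightarrow>
   \<exists>a\<in>N. \<exists>b\<in>N. \<exists>x\<in>H. \<exists>N'. nrm N' G \<and> fin_index N' G \<and> comm a b \<noteq> 1 \<and>
     (\<forall>w\<in>N'. comm ((x * w) * a * inverse (x * w)) b = 1)"
proof (induction m arbitrary: N H)
  have base: "\<exists>a\<in>N. \<exists>b\<in>N. \<exists>x\<in>H. \<exists>N'. nrm N' G \<and> fin_index N' G \<and> comm a b \<noteq> 1 \<and>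
     (\<forall>w\<in>N'. comm ((x * w) * a * inverse (x * w)) b = 1)"
    if N: "nrm N G" "fin_index N G" and H: "nrm H G" "\<not> H \<subseteq> S1" for N H
  proof -
    obtain x where x: "x \<in> H" "x \<notin> S1" using H(2) by blast
    have xG: "x \<in> G" using x nrm_sub[OF H(1)] by blast
    note r = nrm_rist_sec[OF N(1), of 0]
    obtain a' b' where "a' \<in> rist_sec N 0" "b' \<in> rist_sec N 0" "comm a' b' \<noteq> 1"
      using fin_index_not_abelian[OF nrm_subgrp[OF r] nrm_sub[OF r] fin_index_rist_sec[OF N]] by blast
    then obtain a b where ab: "a \<in> N" "a \<in> rist 0" "b \<in> N" "b \<in> rist 0" "comm (sec a 0) (sec b 0) \<noteq> 1"
      by (auto simp: rist_sec_def)
    have "comm a b \<noteq> 1" using ab sec_comm[OF rist_S1 rist_S1, of a 0 b 0 0] by auto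
    moreover have "comm ((x * w) * a * inverse (x * w)) b = 1" if w: "w \<in> S1" for w
    proof -
      have xw: "x * w \<in> G" using xG S1_G[OF w] G_mult by blast
      \<comment> \<open>\<open>x * w\<close> still moves letter 0, so the conjugate of
        \<open>a\<close> is supported on another letter than \<open>b\<close>.\<close>
      have "x * w \<notin> S1" using x w subgrp_mult_iff(2)[OF subgrp_S1] by blast
      then have "\<not> q dvd (0 + \<rho> (x * w)) - 0" using xw by (simp add: S1_def)
      then show ?thesis using rist_disjoint_comm[OF rist_conj[OF xw ab(2)] ab(4)] by blast
    qed
    ultimately show ?thesis using ab x nrm_S1 fin_index_S1 by blast
  qed
  {
    case 0
    then show ?case using base by (simp add: lev_1)
  next
    case (Suc m)
    show ?case
    proof (cases "H \<subseteq> S1")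
      case False
      then show ?thesis using base Suc.prems by blast
    next
      case True
      note N = Suc.prems(1,2) and H = Suc.prems(3,4)
      have ns: "\<not> sect H 0 \<subseteq> lev (Suc m)" by (rule sect_not_sub_lev[OF H(1) True Suc.prems(5)])
      note sH = nrm_sect[OF H(1), of 0]
      have "fin_index (sect H 0) G" by (rule just_infinite_lev[OF sH ns])
      from Suc.IH[OF nrm_rist_sec[OF N(1)] fin_index_rist_sec[OF N] sH this ns]
      obtain a' b' x' N' where 1: "a' \<in> rist_sec N 0" "b' \<in> rist_sec N 0" "x' \<in> sect H 0"
        "nrm N' G" "fin_index N' G" "comm a' b' \<noteq> 1"
        "\<And>w. w \<in> N' \<Longrightarrow> comm ((x' * w) * a' * inverse (x' * w)) b' = 1" by blast
      obtain a where a: "a \<in> N" "a \<in> rist 0" "a' = sec a 0" using 1(1) by (auto simp: rist_sec_def)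
      obtain b where b: "b \<in> N" "b \<in> rist 0" "b' = sec b 0" using 1(2) by (auto simp: rist_sec_def)
      obtain x where x: "x \<in> H" "x \<in> S1" "x' = sec x 0" using 1(3) by (auto simp: sect_def)
      have S: "a \<in> S1" "b \<in> S1" using a b rist_S1 by auto
      have "comm a b \<noteq> 1" using 1(6) sec_comm[OF S, of 0] a b by auto
      \<comment> \<open>Letter 0 is settled by the induction hypothesis; elsewhere \<open>b\<close>
        is trivial.\<close>
      moreover have "comm ((x * w) * a * inverse (x * w)) b = 1" if w: "w \<in> lift N'" for w
      proof (rule S1_eq_oneI)
        have wS: "w \<in> S1" "sec w 0 \<in> N'" using w by (auto simp: lift_def)
        have xw: "x * w \<in> S1" using x wS S1_mult by blast
        have cS: "(x * w) * a * inverse (x * w) \<in> S1" by (rule S1_conj[OF S1_G[OF xw] S(1)])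
        then show "comm ((x * w) * a * inverse (x * w)) b \<in> S1" using S(2) by (rule S1_comm)
        fix l
        have s: "sec (comm ((x * w) * a * inverse (x * w)) b) l
          = comm ((sec x l * sec w l) * sec a l * inverse (sec x l * sec w l)) (sec b l)" for l
          using sec_comm[OF cS S(2)] sec_conj_S1[OF xw S(1)] sec_mult_S1[OF S1_G[OF x(2)] wS(1)] by simp
        show "sec (comm ((x * w) * a * inverse (x * w)) b) l = 1"
        proof (cases "q dvd l")
          case True
          then have "sec (comm ((x * w) * a * inverse (x * w)) b) l
            = sec (comm ((x * w) * a * inverse (x * w)) b) 0"
            using S1_comm[OF cS S(2)] by (intro sec_cong S1_G) auto
          then show ?thesis using s[of 0] 1(7)[OF wS(2)] a b x by simp
        next
          case False
          then have "sec b l = 1" using rist_sec[OF b(2)] by simp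
          then show ?thesis by (simp only: s comm_one)
        qed
      qed
      ultimately show ?thesis using a b x nrm_lift[OF 1(4)] fin_index_lift[OF 1(5)] by blast
    qed
  }
qed

lemma ex_commuting_conjugate:
  assumes "nrm N G" "fin_index N G" "nrm H G" "fin_index H G"
  obtains a b x N' where "a \<in> N" "b \<in> N" "x \<in> H" "nrm N' G" "fin_index N' G" "comm a b \<noteq> 1"
    "\<And>w. w \<in> N' \<Longrightarrow> comm ((x * w) * a * inverse (x * w)) b = 1"
proof -
  have "\<exists>n\<in>H. n \<noteq> 1"
    using fin_index_not_trivial[OF assms(4)] subgrp_one[OF nrm_subgrp[OF assms(3)]] by blast
  then obtain m where "\<not> H \<subseteq> lev (Suc m)" using ex_not_in_lev nrm_sub[OF assms(3)] by blast
  from ex_commuting_conjugate_lev[OF assms this] show ?thesis using that by blast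
qed

section \<open>Subgroups dense in the profinite topology\<close>

definition dense :: "'a set \<Rightarrow> bool" where
  "dense M \<longleftrightarrow> subgrp M \<and> M \<subseteq> G \<and>
     (\<forall>N. nrm N G \<longrightarrow> fin_index N G \<longrightarrow> (\<forall>g\<in>G. \<exists>n\<in>N. g * n \<in> M))"

lemma dense_subgrp: "dense M \<Longrightarrow> subgrp M" and dense_sub: "dense M \<Longrightarrow> M \<subseteq> G"
  and denseD: "dense M \<Longrightarrow> nrm N G \<Longrightarrow> fin_index N G \<Longrightarrow> g \<in> G \<Longrightarrow> \<exists>n\<in>N. g * n \<in> M"
  by (auto simp: dense_def)

text \<open>Density of \<open>M\<close> is used against \<open>lift N\<close>: an element of
  \<open>S1\<close> with section \<open>g\<close> gets corrected by an element all of whose sections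
  lie in \<open>N\<close>.\<close>

lemma dense_sect: assumes M: "dense M" shows "dense (sect M i)"
  unfolding dense_def
proof (intro conjI allI impI ballI)
  show "subgrp (sect M i)" by (rule subgrp_sect[OF dense_subgrp[OF M]])
  show "sect M i \<subseteq> G" by (rule sect_sub_G)
  fix N g assume N: "nrm N G" "fin_index N G" and g: "g \<in> G"
  obtain h where h: "h \<in> S1" "sec h i = g" using G_sec_E[OF g] by metis
  obtain n where n: "n \<in> lift N" "h * n \<in> M"
    using denseD[OF M nrm_lift[OF N(1)] fin_index_lift[OF N(2)] S1_G[OF h(1)]] by blast
  have nS: "n \<in> S1" "sec n i \<in> N" using n by (auto simp: lift_def)
  have "sec (h * n) i = g * sec n i" using sec_mult_S1[OF S1_G[OF h(1)] nS(1)] h by simp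
  moreover have "sec (h * n) i \<in> sect M i" using n(2) S1_mult[OF h(1) nS(1)] by (rule sect_I)
  ultimately show "\<exists>n\<in>N. g * n \<in> sect M i" using nS by auto
qed

lemma subgrp_conj:
  assumes M: "subgrp M" shows "subgrp ((\<lambda>x. g * x * inverse g) ` M)"
  unfolding subgrp_def
proof (intro conjI ballI)
  have "1 = g * 1 * inverse g" by simp
  then show "1 \<in> (\<lambda>x. g * x * inverse g) ` M" using subgrp_one[OF M] by (rule image_eqI)
next
  fix x y assume "x \<in> (\<lambda>x. g * x * inverse g) ` M" "y \<in> (\<lambda>x. g * x * inverse g) ` M"
  then obtain x' y' where xy: "x' \<in> M" "x = g * x' * inverse g" "y' \<in> M" "y = g * y' * inverse g" by blast
  then have "x * y = g * (x' * y') * inverse g" by (simp add: mult.assoc)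
  then show "x * y \<in> (\<lambda>x. g * x * inverse g) ` M" using subgrp_mult[OF M xy(1,3)] by (rule image_eqI)
next
  fix x assume "x \<in> (\<lambda>x. g * x * inverse g) ` M"
  then obtain x' where x: "x' \<in> M" "x = g * x' * inverse g" by blast
  then have "inverse x = g * inverse x' * inverse g" by (simp add: mult.assoc)
  then show "inverse x \<in> (\<lambda>x. g * x * inverse g) ` M" using subgrp_inv[OF M x(1)] by (rule image_eqI)
qed

lemma dense_conj: assumes M: "dense M" and g: "g \<in> G" shows "dense ((\<lambda>x. g * x * inverse g) ` M)"
  unfolding dense_def
proof (intro conjI allI impI ballI)
  show "subgrp ((\<lambda>x. g * x * inverse g) ` M)" by (rule subgrp_conj[OF dense_subgrp[OF M]])
  show "(\<lambda>x. g * x * inverse g) ` M \<subseteq> G" using dense_sub[OF M] g by (auto intro!: G_mult G_inv)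
  fix N x assume N: "nrm N G" "fin_index N G" and x: "x \<in> G"
  have "inverse g * x * g \<in> G" using x g G_mult G_inv by blast
  from denseD[OF M N this] obtain n where n: "n \<in> N" "inverse g * x * g * n \<in> M" by blast
  have "x * (g * n * inverse g) = g * (inverse g * x * g * n) * inverse g" by (simp add: mult.assoc)
  then have "x * (g * n * inverse g) \<in> (\<lambda>x. g * x * inverse g) ` M" using n(2) by blast
  then show "\<exists>n\<in>N. x * n \<in> (\<lambda>x. g * x * inverse g) ` M" using nrm_conj[OF N(1) g n(1)] by blast
qed

lemma dense_transitive: assumes M: "dense M" obtains m where "m \<in> M" "q dvd \<rho> m - i"
proof -
  obtain n where n: "n \<in> S1" "rt i * n \<in> M" using denseD[OF M nrm_S1 fin_index_S1 rt_G] by blast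
  have "q dvd \<rho> (rt i * n) - i" using rho_mult[OF rt_G S1_G[OF n(1)], of i] rho_rt[of i] S1_rho[OF n(1)]
    by Groebner_Basis.algebra
  then show ?thesis using n that by blast
qed

lemma sect_conj:
  assumes "subgrp M" "M \<subseteq> G" "m \<in> M" "x \<in> sect M j"
  shows "sec m j * x * inverse (sec m j) \<in> sect M (j + \<rho> m)"
proof -
  obtain h where h: "h \<in> M" "h \<in> S1" "x = sec h j" using assms(4) by (auto simp: sect_def)
  have mG: "m \<in> G" using assms by blast
  have "m * h * inverse m \<in> M" using assms h subgrp_mult[OF assms(1)] subgrp_inv[OF assms(1)] by simp
  from sect_I[OF this S1_conj[OF mG h(2)], of "j + \<rho> m"] show ?thesis
    using sec_conj[OF mG h(2), of j] h(3) by simp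
qed

text \<open>Conjugation by an element of \<open>N\<close> does not change \<open>x\<close> modulo
  \<open>N\<close>, so a commutation that holds after it holds modulo \<open>N\<close> before
  it.\<close>

lemma comm_in_nrm_if_conj:
  assumes N: "nrm N G" and l: "l \<in> N" "x \<in> G" "y \<in> G" "comm (l * x * inverse l) y = 1"
  shows "comm x y \<in> N"
proof -
  have lG: "l \<in> G" using l nrm_sub[OF N] by blast
  define c where "c = l * x * inverse l"
  define n where "n = comm l (inverse x)"
  have c: "c \<in> G" "n \<in> N" using l lG G_mult G_inv nrm_comm_left[OF N G l(1)] by (auto simp: c_def n_def)
  have "x = c * n" by (simp add: c_def n_def comm_def mult.assoc)
  then have "comm x y = c * comm n y * inverse c * comm c y" using comm_mult_left[of c n y] by metis
  also have "comm c y = 1" using l(4) by (simp only: c_def)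
  finally show ?thesis using nrm_conj[OF N c(1) nrm_comm_left[OF N G c(2) l(3)]] by (simp only: mult_1_right)
qed

lemma dense_eq_G_if_contains_fin_index:
  assumes M: "dense M" and N: "nrm N G" "fin_index N G" "N \<subseteq> M" shows "M = G"
proof
  show "G \<subseteq> M"
  proof
    fix g assume "g \<in> G"
    then obtain n where "n \<in> N" "g * n \<in> M" using denseD[OF M N(1,2)] by blast
    then show "g \<in> M" using subgrp_mult_iff(2)[OF dense_subgrp[OF M]] N(3) by blast
  qed
qed (rule dense_sub[OF M])

text \<open>Consider a minimal set \<open>T\<close> of coordinates supporting a nontrivial element of \<open>M\<close>. If \<open>T\<close> had
  two elements \<open>u\<close> and \<open>w\<close>, then by density one could conjugate so that two elements supported on
  \<open>T\<close> commute at \<open>u\<close> but not at \<open>w\<close>, and their commutator would have smaller support.\<close>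

lemma dense_eq_G_if_sect_eq_G:
  assumes M: "dense M" and full: "sect M j = G" shows "M = G"
proof -
  note sM = dense_subgrp[OF M] and MG = dense_sub[OF M]
  have sect_full: "sect M i = G" for i
  proof
    show "sect M i \<subseteq> G" by (rule sect_sub_G)
    obtain m where m: "m \<in> M" "q dvd \<rho> m - (i - j)" using dense_transitive[OF M] by blast
    have mG: "sec m j \<in> G" using m MG sec_closed by blast
    have eq: "sect M (j + \<rho> m) = sect M i" using m by (intro sect_cong) (simp add: algebra_simps)
    show "G \<subseteq> sect M i"
    proof
      fix g assume g: "g \<in> G"
      have "inverse (sec m j) * g * sec m j \<in> sect M j" unfolding full by (intro G_mult G_inv mG g)
      from sect_conj[OF sM MG m(1) this] show "g \<in> sect M i" using eq by (simp add: mult.assoc)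
    qed
  qed
  define MS where "MS = (\<lambda>T. {m \<in> M \<inter> S1. \<forall>j\<in>{0..<q} - T. sec m j = 1})"
  have MS_sub: "subgrp (MS T)" for T
    unfolding subgrp_def MS_def using subgrp_one[OF sM] subgrp_mult[OF sM] subgrp_inv[OF sM]
      S1_one S1_mult S1_inv by (auto simp: sec_mult_S1 sec_inv_S1 S1_G)
  have MS_conj: "x * m * inverse x \<in> MS T" if "x \<in> M" "x \<in> S1" "m \<in> MS T" for x m T
    using that subgrp_mult[OF sM] subgrp_inv[OF sM] S1_conj[OF S1_G] sec_conj_S1
    by (auto simp: MS_def)
  have MS_S1: "m \<in> S1" and MS_M: "m \<in> M" if "m \<in> MS T" for m T using that by (auto simp: MS_def)
  define P where "P = (\<lambda>T. T \<subseteq> {0..<q} \<and> (\<exists>m\<in>MS T. m \<noteq> 1))"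
  have "P {0..<q}"
  proof -
    have "\<exists>h\<in>M \<inter> S1. h \<noteq> 1"
    proof (rule ccontr)
      assume "\<not> ?thesis"
      then have one: "h = 1" if "h \<in> M" "h \<in> S1" for h using that by blast
      have "sect M 0 \<subseteq> {1}"
      proof
        fix x assume "x \<in> sect M 0"
        then obtain h where h: "h \<in> M" "h \<in> S1" "x = sec h 0" by (rule sect_E)
        then show "x \<in> {1}" by (simp add: one[OF h(1,2)])
      qed
      then have "G \<subseteq> {1}" using sect_full by simp
      then show False using infinite_G finite_subset[of G "{1}"] by simp
    qed
    then obtain h where "h \<in> M" "h \<in> S1" "h \<noteq> 1" by blast
    then have "h \<in> MS {0..<q}" "h \<noteq> 1" by (simp_all add: MS_def)
    then show ?thesis unfolding P_def by blast
  qed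
  then obtain T where T: "P T" and T_min: "\<And>T'. P T' \<Longrightarrow> card T \<le> card T'"
    using ex_has_least_nat[of P "{0..<q}" card] by blast
  have Tsub: "T \<subseteq> {0..<q}" and finT: "finite T" using T finite_subset by (auto simp: P_def)
  have smaller: "m = 1" if "u \<in> T" "m \<in> MS T" "sec m u = 1" for u m
  proof (rule ccontr)
    assume "m \<noteq> 1"
    then have "P (T - {u})" using that Tsub by (auto simp: P_def MS_def)
    then have "card T \<le> card (T - {u})" by (rule T_min)
    then show False using card_Diff1_less[OF finT that(1)] by simp
  qed
  obtain m0 where m0: "m0 \<in> MS T" "m0 \<noteq> 1" using T by (auto simp: P_def)
  have "T \<noteq> {}"
  proof
    assume "T = {}"
    then have "sec m0 (j mod q) = 1" for j using m0 q_gt_1 by (auto simp: MS_def)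
    then have "sec m0 j = 1" for j using sec_cong[OF S1_G[OF MS_S1[OF m0(1)]], of j "j mod q"] by simp
    then show False using S1_eq_oneI MS_S1 m0 by blast
  qed
  then obtain u where u: "u \<in> T" by blast
  \<comment> \<open>This is normal because conjugation by elements of \<open>M\<close> in
    \<open>S1\<close> preserves \<open>MS T\<close> and their sections at \<open>u\<close> fill
    \<open>G\<close>. By minimality of \<open>T\<close> it is nontrivial, hence of finite
    index.\<close>
  define N where "N = sect (MS T) u"
  have N: "nrm N G" unfolding nrm_def
  proof (intro conjI ballI)
    show "subgrp N" unfolding N_def by (rule subgrp_sect[OF MS_sub])
    show "N \<subseteq> G" unfolding N_def by (rule sect_sub_G)
    fix g n assume "g \<in> G" "n \<in> N"
    then obtain x m where x: "x \<in> M" "x \<in> S1" "g = sec x u" and m: "m \<in> MS T" "n = sec m u"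
      using sect_E[of g M u] sect_E[of n "MS T" u] sect_full[of u] unfolding N_def by metis
    have "x * m * inverse x \<in> MS T" using x m MS_conj by blast
    from sect_I[OF this MS_S1[OF this], of u] show "g * n * inverse g \<in> N"
      using sec_conj_S1[OF x(2) MS_S1[OF m(1)]] x m by (simp add: N_def)
  qed
  have Nt: "fin_index N G"
  proof (rule just_infinite[OF N])
    have "sec m0 u \<noteq> 1" using smaller[OF u m0(1)] m0(2) by blast
    then show "N \<noteq> {1}" using sect_I[OF m0(1) MS_S1[OF m0(1)], of u] by (auto simp: N_def)
  qed
  have single: "T = {u}"
  proof (rule ccontr)
    assume "T \<noteq> {u}"
    then obtain w where w: "w \<in> T" "w \<noteq> u" using u by blast
    have "w \<in> {0..<q}" "u \<in> {0..<q}" using w u Tsub by blast+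
    then have uw: "\<not> q dvd w - u" using w(2) by (intro not_q_dvd) auto
    obtain a b x N' where 1: "a \<in> N" "b \<in> N" "x \<in> K" "nrm N' G" "fin_index N' G" "comm a b \<noteq> 1"
      "\<And>w. w \<in> N' \<Longrightarrow> comm ((x * w) * a * inverse (x * w)) b = 1"
      using ex_commuting_conjugate[OF N Nt nrm_K fin_index_K] by blast
    obtain a' where a: "a' \<in> MS T" "sec a' u = a" using 1(1) by (auto simp: N_def sect_def)
    obtain b' where b: "b' \<in> MS T" "sec b' u = b" using 1(2) by (auto simp: N_def sect_def)
    have S: "a' \<in> S1" "b' \<in> S1" using a b MS_S1 by auto
    have cMS: "comm a' b' \<in> MS T" using a b subgrp_comm[OF MS_sub] by blast
    have "comm a' b' \<noteq> 1" using 1(6) sec_comm[OF S, of u] a b by auto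
    then have cw: "sec (comm a' b') w \<noteq> 1" using smaller[OF w(1) cMS] by blast
    have "sec (comm a' b') w \<in> G" by (intro sec_closed S1_G S1_comm S)
    then obtain m where m: "sec (comm a' b') w \<notin> lev (Suc m)" using ex_not_in_lev[OF _ cw] by blast
    \<comment> \<open>\<open>d\<close> acts as \<open>x\<close> at \<open>u\<close> and trivially at
      \<open>w\<close>. The correction that moves it into \<open>M\<close> is taken so small that it
      lies in \<open>N'\<close> at \<open>u\<close> and in \<open>lev (Suc m)\<close> at
      \<open>w\<close>.\<close>
    obtain d where d: "d \<in> rist u" "sec d u = x" using K_rist[OF 1(3)] by blast
    have dS: "d \<in> S1" using d rist_S1 by blast
    have "nrm (lift (N' \<inter> lev (Suc m))) G" by (intro nrm_lift nrm_Int 1(4) nrm_lev)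
    moreover have "fin_index (lift (N' \<inter> lev (Suc m))) G"
      by (intro fin_index_lift fin_index_Int 1(5) fin_index_lev)
    ultimately obtain n where n: "n \<in> lift (N' \<inter> lev (Suc m))" "d * n \<in> M"
      using denseD[OF M _ _ S1_G[OF dS]] by blast
    have nS: "n \<in> S1" "sec n u \<in> N'" "sec n w \<in> lev (Suc m)" using n by (auto simp: lift_def)
    define y where "y = d * n"
    have y: "y \<in> M" "y \<in> S1" using n S1_mult[OF dS nS(1)] by (auto simp: y_def)
    have sec_y: "sec y l = sec d l * sec n l" for l
      unfolding y_def by (rule sec_mult_S1[OF S1_G[OF dS] nS(1)])
    define c where "c = comm (y * a' * inverse y) b'"
    have yay: "y * a' * inverse y \<in> MS T" using MS_conj y a by blast
    have cMS': "c \<in> MS T" unfolding c_def using yay b subgrp_comm[OF MS_sub] by blast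
    have sec_c: "sec c l = comm (sec y l * sec a' l * inverse (sec y l)) (sec b' l)" for l
      unfolding c_def using sec_comm[OF MS_S1[OF yay] S(2)] sec_conj_S1[OF y(2) S(1)] by simp
    have "sec c u = 1" using 1(7)[OF nS(2)] a b d by (simp only: sec_c sec_y)
    then have "c = 1" using smaller[OF u cMS'] by blast
    then have "comm (sec n w * sec a' w * inverse (sec n w)) (sec b' w) = 1"
      using sec_c[of w] sec_y[of w] rist_sec[OF d(1) uw] by simp
    \<comment> \<open>At \<open>w\<close> the conjugator is the correction alone, so the commutator
      of \<open>a'\<close> and \<open>b'\<close> there is trivial modulo \<open>lev (Suc m)\<close>,
      against the choice of \<open>m\<close>.\<close>
    then have "comm (sec a' w) (sec b' w) \<in> lev (Suc m)"
      using comm_in_nrm_if_conj[OF nrm_lev nS(3)] sec_closed S1_G[OF S(1)] S1_G[OF S(2)] by blast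
    then show False using m sec_comm[OF S] by simp
  qed
  have MSr: "MS T \<subseteq> rist u"
  proof
    fix m assume m: "m \<in> MS T"
    have "sec m j = 1" if j: "\<not> q dvd j - u" for j
    proof -
      have "j mod q \<noteq> u" using j by auto
      then have "sec m (j mod q) = 1" using m single q_gt_1 by (auto simp: MS_def)
      then show ?thesis using sec_cong[OF S1_G[OF MS_S1[OF m]], of j "j mod q"] by simp
    qed
    then show "m \<in> rist u" using MS_S1[OF m] by (simp add: rist_def)
  qed
  have "lift N \<subseteq> M"
  proof
    fix g assume g: "g \<in> lift N"
    show "g \<in> M"
    proof (rule in_subgrp_if_rist[OF sM])
      show "g \<in> S1" using g lift_sub_S1 by blast
      fix i
      \<comment> \<open>\<open>M\<close> is transitive on letters, so the copy of \<open>N\<close>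
        at \<open>u\<close> can be carried to every \<open>i\<close>; the conjugation by
        \<open>sec y u\<close> which this causes is undone in advance.\<close>
      obtain y where y: "y \<in> M" "q dvd \<rho> y - (i - u)" using dense_transitive[OF M] by blast
      have yG: "y \<in> G" using y MG by blast
      have sy: "sec y u \<in> G" by (rule sec_closed[OF yG])
      have "sec g i \<in> N" using g by (simp add: lift_def)
      then have "inverse (sec y u) * sec g i * sec y u \<in> N" by (rule nrm_conj'[OF N G sy])
      then obtain m where m: "m \<in> MS T" "sec m u = inverse (sec y u) * sec g i * sec y u"
        by (auto simp: N_def sect_def)
      have i: "q dvd (u + \<rho> y) - i" using y(2) by (simp add: algebra_simps)
      have "y * m * inverse y \<in> M" 
        by (intro subgrp_mult[OF sM] subgrp_inv[OF sM] y MS_M[OF m(1)])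
      moreover have "y * m * inverse y \<in> rist i"
        using rist_conj[OF yG, of m u] MSr m(1) rist_cong[OF i] by blast
      moreover have "sec (y * m * inverse y) i = sec g i"
      proof -
        have "sec (y * m * inverse y) i = sec (y * m * inverse y) (u + \<rho> y)"
          using S1_G[OF S1_conj[OF yG MS_S1[OF m(1)]]] dvd_diff_sym[OF i] by (rule sec_cong)
        also have "\<dots> = sec y u * sec m u * inverse (sec y u)" by (rule sec_conj[OF yG MS_S1[OF m(1)]])
        also have "\<dots> = sec g i" by (simp add: m(2) mult.assoc)
        finally show ?thesis .
      qed
      ultimately show "\<exists>h\<in>M \<inter> rist i. sec h i = sec g i" by blast
    qed
  qed
  then show ?thesis by (rule dense_eq_G_if_contains_fin_index[OF M nrm_lift[OF N] fin_index_lift[OF Nt]])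
qed

subsection \<open>Length reduction\<close>

definition ev :: "(int \<times> 'a) list \<Rightarrow> 'a" where
  "ev w = prod_list (map (\<lambda>x. dp (snd x) (fst x)) w)"

definition tot :: "(int \<times> 'a) list \<Rightarrow> 'a" where "tot w = prod_list (map snd w)"

definition valid :: "(int \<times> 'a) list \<Rightarrow> bool" where "valid w \<longleftrightarrow> (\<forall>x\<in>set w. snd x \<in> D)"

text \<open>\<open>wrd g d n r\<close>: \<open>g\<close> is a product of \<open>n\<close> conjugates \<open>dp\<close> of directed elements, whose product is
  \<open>d\<close>, followed by \<open>rt r\<close>. The total \<open>d\<close> is never needed to be a function of \<open>g\<close>.\<close>

definition wrd :: "'a \<Rightarrow> 'a \<Rightarrow> nat \<Rightarrow> int \<Rightarrow> bool" where
  "wrd g d n r \<longleftrightarrow> (\<exists>w. valid w \<and> length w = n \<and> tot w = d \<and> g = ev w * rt r)"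

lemma ev_simps [simp]: "ev [] = 1" "ev (x # w) = dp (snd x) (fst x) * ev w" "ev (v @ w) = ev v * ev w"
  and tot_simps [simp]: "tot [] = 1" "tot (x # w) = snd x * tot w" "tot (v @ w) = tot v * tot w"
  and valid_simps [simp]: "valid []" "valid (x # w) \<longleftrightarrow> snd x \<in> D \<and> valid w"
    "valid (v @ w) \<longleftrightarrow> valid v \<and> valid w"
  by (auto simp: ev_def tot_def valid_def)

lemma valid_filter: "valid w \<Longrightarrow> valid (filter P w)" by (auto simp: valid_def)

lemma tot_D: "valid w \<Longrightarrow> tot w \<in> D"
  by (induction w) (auto simp: subgrp_one[OF subgrp_D] subgrp_mult[OF subgrp_D])

lemma ev_S1: "valid w \<Longrightarrow> ev w \<in> S1"
  by (induction w) (auto simp: S1_one dp_S1 S1_mult)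

lemma ev_shift: "ev (map (\<lambda>x. (fst x + r, snd x)) w) = rt r * ev w * rt (- r)"
proof (induction w)
  case Nil
  then show ?case by (simp add: rt_inv[symmetric])
next
  case (Cons x w)
  have "dp (snd x) (fst x + r) = rt r * dp (snd x) (fst x) * rt (- r)"
  proof -
    have "rt (fst x + r) = rt r * rt (fst x)" "rt (- (fst x + r)) = rt (- fst x) * rt (- r)"
      using rt_add[of r "fst x"] rt_add[of "- fst x" "- r"] by (simp_all add: add.commute)
    then show ?thesis by (simp only: dp_def mult.assoc)
  qed
  then show ?case using Cons by (simp add: rt_inv[symmetric] mult.assoc)
qed

text \<open>Moving \<open>rt r\<close> past the second word shifts all positions in it by
  \<open>r\<close>.\<close>

lemma wrd_mult: assumes "wrd g d m r" "wrd h e n s" shows "wrd (g * h) (d * e) (m + n) (r + s)"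
proof -
  obtain v w where v: "valid v" "length v = m" "tot v = d" "g = ev v * rt r"
    and w: "valid w" "length w = n" "tot w = e" "h = ev w * rt s"
    using assms unfolding wrd_def by blast
  define w' where "w' = map (\<lambda>x. (fst x + r, snd x)) w"
  have "valid w'" "length w' = n" "tot w' = e" using w by (auto simp: w'_def valid_def tot_def comp_def)
  moreover have "g * h = ev (v @ w') * rt (r + s)"
    using v w by (simp add: w'_def ev_shift rt_add rt_inv[symmetric] mult.assoc)
  ultimately show ?thesis unfolding wrd_def using v by (intro exI[of _ "v @ w'"]) simp
qed

lemma wrd_rt: "wrd (rt s) 1 0 s"
  unfolding wrd_def by (rule exI[of _ "[]"]) simp

lemma wrd_one: "wrd 1 1 0 0"
  using wrd_rt[of 0] by simp

lemma wrd_dp: "d \<in> D \<Longrightarrow> wrd (dp d s) d 1 0"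
  unfolding wrd_def by (rule exI[of _ "[(s, d)]"]) simp

lemma dp_0 [simp]: "dp d 0 = d" by (simp add: dp_def)

lemma wrd_D: "d \<in> D \<Longrightarrow> wrd d d 1 0"
  using wrd_dp[of d 0] by simp

lemma wrd_inv: assumes "wrd g d n r" shows "wrd (inverse g) (inverse d) n (- r)"
proof -
  have "wrd (inverse (ev w)) (inverse (tot w)) (length w) 0" if "valid w" for w
    using that
  proof (induction w)
    case Nil
    then show ?case by (simp add: wrd_one)
  next
    case (Cons x w)
    have "inverse (dp (snd x) (fst x)) = dp (inverse (snd x)) (fst x)"
      by (simp add: dp_def rt_inv mult.assoc)
    then have "wrd (inverse (dp (snd x) (fst x))) (inverse (snd x)) 1 0"
      using wrd_dp[of "inverse (snd x)" "fst x"] subgrp_inv[OF subgrp_D] Cons.prems by simp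
    then show ?case using wrd_mult[OF Cons.IH] Cons.prems by fastforce
  qed
  moreover obtain w where w: "valid w" "length w = n" "tot w = d" "g = ev w * rt r"
    using assms unfolding wrd_def by blast
  ultimately have "wrd (inverse (ev w)) (inverse d) n 0" by blast
  from wrd_mult[OF wrd_rt[of "- r"] this] show ?thesis using w by (simp add: rt_inv)
qed

lemma wrd_G: assumes "wrd g d n r" shows "g \<in> G" "d \<in> D"
  using assms unfolding wrd_def by (auto intro: G_mult[OF S1_G[OF ev_S1] rt_G] tot_D)

lemma wrd_ex: assumes "g \<in> G" shows "\<exists>d n r. wrd g d n r"
proof -
  let ?H = "{g. \<exists>d n r. wrd g d n r}"
  have "subgrp ?H" unfolding subgrp_def
  proof (intro conjI ballI)
    show "1 \<in> ?H" using wrd_one by blast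
    fix x y assume x: "x \<in> ?H"
    then show "inverse x \<in> ?H" by (auto dest: wrd_inv)
    assume "y \<in> ?H"
    with x show "x * y \<in> ?H" by (auto dest: wrd_mult)
  qed
  then have "G \<subseteq> ?H"
  proof (rule gen_induct_G)
    show "rt s \<in> ?H" for s using wrd_rt by blast
    show "D \<subseteq> ?H" using wrd_D by blast
  qed
  then show ?thesis using assms by blast
qed

text \<open>Substitute for the kernel of a total that need not be well defined. Elements sharing
  some total differ by an element of this set, so finiteness of \<open>D\<close> makes its index
  finite, and a dense subgroup contains words of every total.\<close>

definition tot_ker :: "'a set" where "tot_ker = {g. \<exists>n r. wrd g 1 n r}"

lemma nrm_tot_ker: "nrm tot_ker G"
  unfolding nrm_def
proof (intro conjI ballI)
  show "tot_ker \<subseteq> G" using wrd_G by (auto simp: tot_ker_def)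
  show "subgrp tot_ker" unfolding subgrp_def
  proof (intro conjI ballI)
    show "1 \<in> tot_ker" using wrd_one by (auto simp: tot_ker_def)
    fix x y assume "x \<in> tot_ker"
    then obtain n r where x: "wrd x 1 n r" by (auto simp: tot_ker_def)
    from wrd_inv[OF this] show "inverse x \<in> tot_ker" by (auto simp: tot_ker_def)
    assume "y \<in> tot_ker"
    then obtain m s where "wrd y 1 m s" by (auto simp: tot_ker_def)
    from wrd_mult[OF x this] show "x * y \<in> tot_ker" by (auto simp: tot_ker_def)
  qed
  fix g h assume g: "g \<in> G" and h: "h \<in> tot_ker"
  obtain d n r where 1: "wrd g d n r" using wrd_ex[OF g] by blast
  obtain m s where 2: "wrd h 1 m s" using h by (auto simp: tot_ker_def)
  from wrd_mult[OF wrd_mult[OF 1 2] wrd_inv[OF 1]]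
  show "g * h * inverse g \<in> tot_ker" unfolding tot_ker_def by auto
qed

lemma fin_index_tot_ker: "fin_index tot_ker G"
proof -
  obtain f where f: "\<And>g. g \<in> G \<Longrightarrow> \<exists>n r. wrd g (f g) n r" using wrd_ex by metis
  show ?thesis
  proof (rule fin_indexI[where f = f])
    have "f ` G \<subseteq> D" using f wrd_G(2) by blast
    then show "finite (f ` G)" using finite_D finite_subset by blast
    fix b c assume bc: "b \<in> G" "c \<in> G" "f b = f c"
    obtain n r m s where "wrd b (f b) n r" "wrd c (f b) m s" using f bc by metis
    from wrd_mult[OF wrd_inv[OF this(1)] this(2)] show "inverse b * c \<in> tot_ker"
      unfolding tot_ker_def by auto
  qed
qed

lemma dense_wrd: assumes M: "dense M" and d: "d \<in> D" shows "\<exists>m\<in>M. \<exists>n r. wrd m d n r"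
proof -
  obtain h where h: "h \<in> tot_ker" "d * h \<in> M"
    using denseD[OF M nrm_tot_ker fin_index_tot_ker D_in_G[OF d]] by blast
  then obtain n r where "wrd h 1 n r" by (auto simp: tot_ker_def)
  from wrd_mult[OF wrd_D[OF d] this] show ?thesis using h by auto
qed

lemma tot_filter_disj:
  assumes "valid w" "\<And>x. x \<in> set w \<Longrightarrow> \<not> (P x \<and> Q x)"
  shows "tot (filter P w) * tot (filter Q w) = tot (filter (\<lambda>x. P x \<or> Q x) w)"
    "length (filter P w) + length (filter Q w) = length (filter (\<lambda>x. P x \<or> Q x) w)"
proof -
  show "tot (filter P w) * tot (filter Q w) = tot (filter (\<lambda>x. P x \<or> Q x) w)"
    using assms
  proof (induction w)
    case (Cons x w)
    have IH: "tot (filter P w) * tot (filter Q w) = tot (filter (\<lambda>x. P x \<or> Q x) w)"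
      using Cons by simp
    have c: "tot (filter P w) * snd x = snd x * tot (filter P w)"
      using Cons.prems(1) by (intro D_commute tot_D valid_filter) auto
    consider "P x" "\<not> Q x" | "\<not> P x" "Q x" | "\<not> P x" "\<not> Q x" using Cons.prems(2)[of x] by auto
    then show ?case
    proof cases
      case 2
      have "tot (filter P w) * (snd x * tot (filter Q w)) = snd x * tot (filter (\<lambda>x. P x \<or> Q x) w)"
        unfolding IH[symmetric] mult.assoc[symmetric] c ..
      then show ?thesis using 2 by simp
    qed (simp_all add: IH mult.assoc)
  qed simp
  show "length (filter P w) + length (filter Q w) = length (filter (\<lambda>x. P x \<or> Q x) w)"
    using assms(2) by (induction w) auto
qed

text \<open>Syllables positioned at \<open>i\<close> contribute their directed element, all others
  only a translation.\<close>

lemma sec_ev: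
  "valid w \<Longrightarrow> wrd (sec (ev w) i) (tot (filter (\<lambda>x. q dvd i - fst x) w))
     (length (filter (\<lambda>x. q dvd i - fst x) w)) (\<Sum>x\<leftarrow>w. E0 (snd x) (i - fst x))"
proof (induction w)
  case Nil
  then show ?case using wrd_one by simp
next
  case (Cons x w)
  then have x: "snd x \<in> D" and w: "valid w" by auto
  have s: "sec (ev (x # w)) i = sec (dp (snd x) (fst x)) i * sec (ev w) i"
    using dp_S1[OF x] ev_S1[OF w] by (simp add: sec_mult_S1 S1_G)
  show ?case
  proof (cases "q dvd i - fst x")
    case True
    have "wrd (sec (dp (snd x) (fst x)) i) (snd x) 1 (E0 (snd x) (i - fst x))"
      using wrd_D[OF x] True by (simp add: sec_dp'[OF x] E0_0)
    from wrd_mult[OF this Cons.IH[OF w]] show ?thesis using True s by simp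
  next
    case False
    have "wrd (sec (dp (snd x) (fst x)) i) 1 0 (E0 (snd x) (i - fst x))"
      using wrd_rt False by (simp add: sec_dp'[OF x])
    from wrd_mult[OF this Cons.IH[OF w]] show ?thesis using False s by simp
  qed
qed

lemma sec_ev_const:
  "valid w \<Longrightarrow> (\<And>x. x \<in> set w \<Longrightarrow> q dvd i - fst x) \<Longrightarrow> sec (ev w) i = tot w"
proof (induction w)
  case (Cons x w)
  then show ?case using dp_S1 ev_S1 by (simp add: sec_mult_S1 S1_G sec_dp')
qed simp

lemma sec_ev_rt: "valid w \<Longrightarrow> sec (ev w * rt r) j = sec (ev w) (j + r)"
proof -
  assume w: "valid w"
  note G = S1_G[OF ev_S1[OF w]]
  have "sec (ev w * rt r) j = sec (ev w) (j + \<rho> (rt r))" using sec_mult[OF G rt_G] by (simp add: sec_rt)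
  also have "\<dots> = sec (ev w) (j + r)" using rho_rt[of r] by (intro sec_cong[OF G]) simp
  finally show ?thesis .
qed

lemma rho_ev_rt: "valid w \<Longrightarrow> q dvd \<rho> (ev w * rt r) - r"
  using rho_mult[OF S1_G[OF ev_S1] rt_G, of w r] S1_rho[OF ev_S1, of w] rho_rt[of r] by Groebner_Basis.algebra

text \<open>The first power of a word that lies in \<open>S1\<close> has, at each coordinate, a section that
  collects the letters whose positions lie in one coset of the subgroup generated by \<open>r\<close>.\<close>

lemma sec_power_ev:
  assumes w: "valid w" and g: "gcd r q = g"
  defines "n \<equiv> nat (q div g)"
  shows "(ev w * rt r) ^ n \<in> S1"
    and "wrd (sec ((ev w * rt r) ^ n) i) (tot (filter (\<lambda>x. g dvd i - fst x) w))
      (length (filter (\<lambda>x. g dvd i - fst x) w)) (\<Sum>t<n. \<Sum>x\<leftarrow>w. E0 (snd x) (i + r - fst x + int t * r))"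
proof -
  let ?h = "ev w * rt r"
  have hG: "?h \<in> G" using w by (intro G_mult rt_G S1_G ev_S1)
  have rho: "q dvd \<rho> ?h - r" by (rule rho_ev_rt[OF w])
  have gq: "g dvd q" "g dvd r" "g > 0" using g q_gt_1 gcd_pos_int[of r q] gcd_dvd2[of r q] by auto
  have n: "int n = q div g" "n > 0"
  proof -
    have "q div g > 0" using gq q_gt_1 by (simp add: pos_imp_zdiv_pos_iff zdvd_imp_le)
    then show "int n = q div g" "n > 0" by (simp_all add: n_def)
  qed
  have dvd_iff: "q dvd t * r \<longleftrightarrow> int n dvd t" for t
    using dvd_mult_iff_div_gcd[of q t r] q_gt_1 g n by simp
  have "q dvd int n * r" using dvd_iff by simp
  with rho_power[OF hG, of n] rho have "q dvd \<rho> (?h ^ n)" by Groebner_Basis.algebra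
  then show "?h ^ n \<in> S1" using G_power[OF hG] by (simp add: S1_def)
  \<comment> \<open>\<open>C m\<close> marks the syllables whose spine is met in the first
    \<open>m\<close> passages. The extra \<open>r\<close> arises because \<open>ev w * rt r\<close>
    translates before \<open>ev w\<close> acts.\<close>
  define C where "C = (\<lambda>m x. \<exists>t<m. q dvd i + r + int t * r - fst (x :: int \<times> 'a))"
  have ind: "wrd (sec (?h ^ m) i) (tot (filter (C m) w)) (length (filter (C m) w))
      (\<Sum>t<m. \<Sum>x\<leftarrow>w. E0 (snd x) (i + r - fst x + int t * r))" if "m \<le> n" for m
    using that
  proof (induction m)
    case 0
    then show ?case using wrd_one by (simp add: C_def)
  next
    case (Suc m)
    define Q where "Q = (\<lambda>x. q dvd i + r + int m * r - fst (x :: int \<times> 'a))"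
    have "sec (?h ^ Suc m) i = sec ?h (i + int m * \<rho> ?h) * sec (?h ^ m) i" by (rule sec_power_Suc[OF hG])
    also have "sec ?h (i + int m * \<rho> ?h) = sec ?h (i + int m * r)"
    proof (rule sec_cong[OF hG])
      have "i + int m * \<rho> ?h - (i + int m * r) = int m * (\<rho> ?h - r)" by (simp add: algebra_simps)
      then show "q dvd i + int m * \<rho> ?h - (i + int m * r)" using rho by simp
    qed
    also have "\<dots> = sec (ev w) (i + r + int m * r)" by (simp add: sec_ev_rt[OF w] algebra_simps)
    finally have s: "sec (?h ^ Suc m) i = sec (ev w) (i + r + int m * r) * sec (?h ^ m) i" .
    have 1: "wrd (sec (ev w) (i + r + int m * r)) (tot (filter Q w)) (length (filter Q w))
        (\<Sum>x\<leftarrow>w. E0 (snd x) (i + r - fst x + int m * r))"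
      using sec_ev[OF w, of "i + r + int m * r"] by (simp add: Q_def algebra_simps)
    have disj: "\<not> (Q x \<and> C m x)" for x
    proof
      assume "Q x \<and> C m x"
      then obtain t where t: "t < m" "q dvd i + r + int t * r - fst x" "q dvd i + r + int m * r - fst x"
        by (auto simp: C_def Q_def)
      then have "q dvd (int m - int t) * r" by Groebner_Basis.algebra
      then have "int n dvd int m - int t" using dvd_iff by blast
      then have "int n \<le> int m - int t" using t(1) by (intro zdvd_imp_le) auto
      then show False using Suc.prems by simp
    qed
    have CS: "(\<lambda>x. Q x \<or> C m x) = C (Suc m)" by (auto simp: C_def Q_def less_Suc_eq)
    note d = tot_filter_disj[of w Q "C m", OF w disj, unfolded CS]
    have "wrd (sec (?h ^ Suc m) i) (tot (filter Q w) * tot (filter (C m) w))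
      (length (filter Q w) + length (filter (C m) w))
      ((\<Sum>x\<leftarrow>w. E0 (snd x) (i + r - fst x + int m * r)) + (\<Sum>t<m. \<Sum>x\<leftarrow>w. E0 (snd x) (i + r - fst x + int t * r)))"
      unfolding s by (rule wrd_mult[OF 1 Suc.IH]) (use Suc.prems in simp)
    then show ?case unfolding d sum.lessThan_Suc[of _ m] by (simp only: add.commute)
  qed
  have "C n = (\<lambda>x. g dvd i - fst x)"
  proof (intro ext iffI)
    fix x assume "C n x"
    then obtain t where "q dvd i + r + int t * r - fst x" by (auto simp: C_def)
    then have "g dvd i + r + int t * r - fst x" using gq(1) dvd_trans by blast
    with gq(2) show "g dvd i - fst x" by Groebner_Basis.algebra
  next
    fix x :: "int \<times> 'a" assume "g dvd i - fst x"
    then obtain m where m: "i - fst x = g * m" by (auto elim: dvdE)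
    obtain a b where ab: "a * r + b * q = g" using bezout_int[of r q] g by auto
    \<comment> \<open>This solves \<open>i + r + t * r = fst x\<close> modulo \<open>q\<close>, as
      \<open>a * r\<close> is \<open>g\<close> modulo \<open>q\<close>; the \<open>- 1\<close>
      absorbs the extra \<open>r\<close>.\<close>
    define t where "t = (- m * a - 1) mod int n"
    have t: "0 \<le> t" "t < int n" using n by (auto simp: t_def)
    have "int n dvd (- m * a - 1) - t" unfolding t_def by (rule dvd_minus_mod)
    then have "q dvd ((- m * a - 1) - t) * r" using dvd_iff by blast
    with m ab have "q dvd i + r + t * r - fst x" by Groebner_Basis.algebra
    then show "C n x" using t unfolding C_def by (intro exI[of _ "nat t"]) auto
  qed
  then show "wrd (sec (?h ^ n) i) (tot (filter (\<lambda>x. g dvd i - fst x) w))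
      (length (filter (\<lambda>x. g dvd i - fst x) w)) (\<Sum>t<n. \<Sum>x\<leftarrow>w. E0 (snd x) (i + r - fst x + int t * r))"
    using ind[of n] by simp
qed

text \<open>\<open>D\<close> is abelian, so the total is the product of the totals over the classes
  of positions modulo \<open>g\<close>. Splitting off the class of the first syllable leaves every
  other class unchanged.\<close>

lemma tot_in_if_classes:
  assumes D0: "subgrp D0"
  shows "valid w \<Longrightarrow> (\<And>c. tot (filter (\<lambda>x. g dvd c - fst x) w) \<in> D0) \<Longrightarrow> tot w \<in> D0"
proof (induction w rule: length_induct)
  case (1 w)
  show ?case
  proof (cases w)
    case Nil
    then show ?thesis using subgrp_one[OF D0] by simp
  next
    case (Cons y w')
    let ?P = "\<lambda>x. g dvd fst y - fst x"
    have "tot (filter (\<lambda>x. \<not> ?P x) w) \<in> D0"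
    proof (rule 1(1)[rule_format])
      show "length (filter (\<lambda>x. \<not> ?P x) w) < length w"
        unfolding Cons by (simp add: le_imp_less_Suc)
      show "valid (filter (\<lambda>x. \<not> ?P x) w)" by (rule valid_filter[OF 1(2)])
      fix c
      show "tot (filter (\<lambda>x. g dvd c - fst x) (filter (\<lambda>x. \<not> ?P x) w)) \<in> D0"
      proof (cases "g dvd c - fst y")
        case True
        then have "\<not> (g dvd c - fst x \<and> \<not> ?P x)" for x
          using dvd_diff_trans[of g "fst y" c "fst x"] dvd_diff_sym[of g c "fst y"] by blast
        then have "filter (\<lambda>x. g dvd c - fst x) (filter (\<lambda>x. \<not> ?P x) w) = []"
          by (auto simp: filter_empty_conv)
        then show ?thesis using subgrp_one[OF D0] by (simp only: tot_simps)
      next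
        case False
        then have iff: "(g dvd c - fst x \<and> \<not> ?P x) \<longleftrightarrow> g dvd c - fst x" for x
          using dvd_diff_trans[of g c "fst x" "fst y"] dvd_diff_sym[of g "fst y" "fst x"] by blast
        have "filter (\<lambda>x. g dvd c - fst x) (filter (\<lambda>x. \<not> ?P x) w) = filter (\<lambda>x. g dvd c - fst x) w"
          unfolding filter_filter by (intro filter_cong refl) (use iff in blast)
        then show ?thesis using 1(3) by (simp only:)
      qed
    qed
    moreover have "tot (filter ?P w) * tot (filter (\<lambda>x. \<not> ?P x) w) = tot w"
      using tot_filter_disj(1)[OF 1(2), of ?P "\<lambda>x. \<not> ?P x"] by simp
    ultimately show ?thesis using subgrp_mult[OF D0 1(3)] by metis
  qed
qed

inductive secs :: "'a set \<Rightarrow> 'a set \<Rightarrow> bool" where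
  secs_refl: "secs M M"
| secs_step: "secs (sect M i) L \<Longrightarrow> secs M L"

lemma sum_phi:
  assumes d: "\<And>x. x \<in> set w \<Longrightarrow> g dvd i - fst x" and g: "gcd r q = g"
  shows "(\<Sum>t<nat (q div g). \<Sum>x\<leftarrow>w. E0 (snd x) (i + r - fst x + int t * r)) = (\<Sum>x\<leftarrow>w. phi g (snd x))"
  using d
proof (induction w)
  case (Cons x w)
  have gr: "g dvd r" using g by auto
  have "g dvd i - fst x" using Cons.prems by simp
  then have "g dvd i + r - fst x" using gr by Groebner_Basis.algebra
  then have "g dvd j - (i + r - fst x) \<longleftrightarrow> g dvd j" for j by (rule dvd_diff_left_iff)
  then have "(\<Sum>t<nat (q div g). E0 (snd x) (i + r - fst x + int t * r)) = phi g (snd x)"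
    using sum_orbit[of "E0 (snd x)" r g "i + r - fst x"] E0_cong g by (simp add: phi_def)
  then show ?case using Cons by (simp add: sum.distrib)
qed simp

text \<open>\<open>D0\<close> is a subgroup to be avoided. The measure compares lengths first and
  then \<open>q - gcd r q\<close>, which is below \<open>q\<close>. Sections of the first power in
  \<open>S1\<close> split the word into classes of positions modulo \<open>g = gcd r q\<close>. With
  several classes, one of them has total outside \<open>D0\<close> and fewer syllables. With one
  class, length and total persist, but \<open>phi_dvd\<close> makes the new rooted exponent more
  divisible by \<open>p\<close>, until \<open>r\<close> vanishes modulo \<open>q\<close> and the
  section is the total itself.\<close>

lemma secs_ex_directed:
  assumes D0: "subgrp D0"
  shows "subgrp M \<Longrightarrow> ev w * rt r \<in> M \<Longrightarrow> valid w \<Longrightarrow> tot w \<notin> D0 \<Longrightarrow>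
    \<exists>L. secs M L \<and> (\<exists>d\<in>L \<inter> D. d \<notin> D0)"
proof (induction "length w * nat q + nat (q - gcd r q)" arbitrary: M w r rule: less_induct)
  case less
  note M = less.prems(1) and w = less.prems(3)
  define g where "g = gcd r q"
  obtain j where j: "j \<le> k" "g = p ^ j"
    using divides_primepow[OF prime_p, of g k] q_eq by (auto simp: g_def normalize_int_def)
  define n where "n = nat (q div g)"
  let ?h = "ev w * rt r"
  note sp = sec_power_ev[OF w g_def[symmetric], folded n_def]
  have hn: "sec (?h ^ n) i \<in> sect M i" for i
    using sect_I[OF subgrp_power[OF M less.prems(2)] sp(1)] .
  have g0: "g > 0" "g \<le> q" using q_gt_1 by (auto simp: g_def intro: gcd_le2_int)
  have step: "\<exists>L. secs M L \<and> (\<exists>d\<in>L \<inter> D. d \<notin> D0)"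
    if v: "valid v" "sec (?h ^ n) i = ev v * rt s" "tot v \<notin> D0"
      "length v * nat q + nat (q - gcd s q) < length w * nat q + nat (q - g)" for v s i
    using less.hyps[of v s "sect M i"] v hn[of i] subgrp_sect[OF M] secs_step by (metis g_def)
  show ?case
  proof (cases "\<exists>c. \<forall>x\<in>set w. g dvd c - fst x")
    case True
    then obtain c where c: "\<And>x. x \<in> set w \<Longrightarrow> g dvd c - fst x" by blast
    then have f: "filter (\<lambda>x. g dvd c - fst x) w = w" by (simp add: filter_id_conv)
    show ?thesis
    proof (cases "j = k")
      case True
      then have "g = q" using j q_eq by simp
      then have r: "q dvd r" by (metis g_def gcd_dvd1)
      then have "?h = ev w" using rt_cong[of r 0] by simp
      then have "tot w \<in> sect M c"
        using sect_I[of "ev w" M c] less.prems(2) ev_S1[OF w] sec_ev_const[OF w, of c] c \<open>g = q\<close> by simp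
      then show ?thesis using tot_D[OF w] less.prems(4) secs_step[OF secs_refl] by blast
    next
      case False
      then have jk: "j < k" using j by simp
      obtain v where v: "valid v" "length v = length w" "tot v = tot w"
        "sec (?h ^ n) c = ev v * rt (\<Sum>x\<leftarrow>w. phi g (snd x))"
        using sp(2)[of c] sum_phi[OF c g_def[symmetric]] f unfolding wrd_def n_def by auto
      have "p ^ Suc j dvd phi g (snd x)" if "x \<in> set w" for x
        using phi_dvd[OF _ jk, of "snd x"] that w j(2) by (simp add: valid_def)
      then have "p ^ Suc j dvd (\<Sum>x\<leftarrow>w. phi g (snd x))"
        by (induction w) (auto simp: dvd_add)
      moreover have "p ^ Suc j dvd q" using jk by (simp add: q_eq le_imp_power_dvd del: power_Suc)
      ultimately have "p ^ Suc j dvd gcd (\<Sum>x\<leftarrow>w. phi g (snd x)) q" by (rule gcd_greatest)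
      then have "p ^ Suc j \<le> gcd (\<Sum>x\<leftarrow>w. phi g (snd x)) q" using q_gt_1 by (intro zdvd_imp_le) auto
      moreover have "g < p ^ Suc j" using p_gt_1 j(2) by (simp add: power_strict_increasing del: power_Suc)
      moreover have "gcd (\<Sum>x\<leftarrow>w. phi g (snd x)) q \<le> q" using q_gt_1 by (intro gcd_le2_int) auto
      ultimately show ?thesis using step[OF v(1,4)] v(2,3) less.prems(4) by simp
    qed
  next
    case False
    obtain c where c: "tot (filter (\<lambda>x. g dvd c - fst x) w) \<notin> D0"
      using tot_in_if_classes[OF D0 w, of g] less.prems(4) by blast
    obtain v s where v: "valid v" "length v = length (filter (\<lambda>x. g dvd c - fst x) w)"
        "tot v = tot (filter (\<lambda>x. g dvd c - fst x) w)" "sec (?h ^ n) c = ev v * rt s"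
      using sp(2)[of c] unfolding wrd_def by blast
    have "\<exists>x\<in>set w. \<not> g dvd c - fst x" using False by blast
    then have "length v < length w" unfolding v(2) by (auto intro: length_filter_less)
    then have "Suc (length v) * nat q \<le> length w * nat q" by (intro mult_le_mono1) simp
    moreover have "gcd s q > 0" using q_gt_1 by (simp add: gcd_pos_int)
    then have "nat (q - gcd s q) < nat q" using q_gt_1 by linarith
    ultimately have "length v * nat q + nat (q - gcd s q) < length w * nat q + nat (q - g)"
      unfolding mult_Suc by linarith
    then show ?thesis using step[OF v(1,4)] v(3) c by simp
  qed
qed

section \<open>Descent from a dense subgroup to the whole group\<close>

inductive desc :: "'a set \<Rightarrow> 'a set \<Rightarrow> bool" where
  desc_refl: "desc M M"
| desc_sect: "desc (sect M i) L \<Longrightarrow> desc M L"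
| desc_conj: "g \<in> G \<Longrightarrow> desc ((\<lambda>x. g * x * inverse g) ` M) L \<Longrightarrow> desc M L"

lemma desc_trans: "desc M L \<Longrightarrow> desc L L' \<Longrightarrow> desc M L'"
  by (induction rule: desc.induct) (auto intro: desc.intros)

lemma secs_desc: "secs M L \<Longrightarrow> desc M L"
  by (induction rule: secs.induct) (auto intro: desc.intros)

lemma secs_trans: "secs M L \<Longrightarrow> secs L L' \<Longrightarrow> secs M L'"
  by (induction rule: secs.induct) (auto intro: secs.intros)

lemma desc_dense: "desc M L \<Longrightarrow> dense M \<Longrightarrow> dense L"
  by (induction rule: desc.induct) (auto simp: dense_sect dense_conj)

lemma desc_eq_G: "desc M L \<Longrightarrow> dense M \<Longrightarrow> L = G \<Longrightarrow> M = G"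
proof (induction rule: desc.induct)
  case (desc_sect M i L)
  then show ?case using dense_eq_G_if_sect_eq_G[OF desc_sect.prems(1)] dense_sect by blast
next
  case (desc_conj g M L)
  then have eq: "(\<lambda>x. g * x * inverse g) ` M = G" using dense_conj by blast
  show ?case
  proof
    show "M \<subseteq> G" by (rule dense_sub[OF desc_conj.prems(1)])
    show "G \<subseteq> M"
    proof
      fix x assume "x \<in> G"
      then have "g * x * inverse g \<in> (\<lambda>x. g * x * inverse g) ` M"
        unfolding eq using desc_conj.hyps(1) by (intro G_mult G_inv)
      then show "x \<in> M" by (auto simp: mult.assoc)
    qed
  qed
qed simp

text \<open>The exponents sum to a multiple of \<open>p\<close>, so a unit among them cannot be
  alone.\<close>

lemma ex_second_unit:
  assumes d: "d \<in> D" and u: "\<not> p dvd E0 d 1"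
  shows "\<exists>y. \<not> q dvd y \<and> \<not> q dvd y - 1 \<and> \<not> p dvd E0 d y"
proof (rule ccontr)
  assume no: "\<not> ?thesis"
  have "p dvd E0 d (int n)" if "n \<in> {..<nat q} - {1}" for n
  proof (cases "n = 0")
    case False
    then have "\<not> q dvd int n" "\<not> q dvd int n - 1" 
      using that not_q_dvd[of "int n"] not_q_dvd[of "int n - 1"] q_gt_1 by (auto simp: zless_nat_eq_int_zless)
    then show ?thesis using no by blast
  qed simp
  then have "p dvd (\<Sum>n\<in>{..<nat q} - {1}. E0 d (int n))" by (rule dvd_sum)
  moreover have "phi 1 d = E0 d (int 1) + (\<Sum>n\<in>{..<nat q} - {1}. E0 d (int n))"
    unfolding phi_1[symmetric] using q_gt_1 by (intro sum.remove) auto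
  ultimately show False using p_dvd_phi_1[OF d] u by (simp add: dvd_add_left_iff)
qed

lemma sec_conj_D:
  assumes "d \<in> D" "g \<in> G"
  shows "g * d * inverse g \<in> S1"
    "sec (g * d * inverse g) (j + \<rho> g) = sec g j * sec d j * inverse (sec g j)"
  using S1_conj[OF assms(2) D_S1[OF assms(1)]] sec_conj[OF assms(2) D_S1[OF assms(1)]] by auto

lemma length_filter_disj3:
  assumes "\<And>x. \<not> (P x \<and> Q x)" "\<And>x. \<not> (P x \<and> R x)" "\<And>x. \<not> (Q x \<and> R x)"
  shows "length (filter P w) + length (filter Q w) + length (filter R w) \<le> length w"
  using assms by (induction w) auto

lemma ev_const:
  "valid w \<Longrightarrow> (\<And>x. x \<in> set w \<Longrightarrow> q dvd s - fst x) \<Longrightarrow> ev w = dp (tot w) s"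
proof (induction w)
  case Nil
  then show ?case by (simp add: dp_def rt_inv[symmetric])
next
  case (Cons x w)
  have "q dvd s - fst x" using Cons.prems by simp
  then have "rt (fst x) = rt s" "rt (- fst x) = rt (- s)"
    by (auto intro!: rt_cong simp: dvd_diff_commute)
  then show ?case using Cons by (simp add: dp_def rt_inv[symmetric] mult.assoc)
qed

lemma rt_all: "subgrp H \<Longrightarrow> rt 1 \<in> H \<Longrightarrow> rt s \<in> H"
  by (rule rt_in_subgrp[of H 1]) (use p_gt_1 in auto)

text \<open>Induction on the number of directed syllables of the conjugator. As \<open>rt 1\<close>
  lies in \<open>L\<close>, the sections of \<open>L\<close> at all letters coincide. For a letter
  \<open>j\<close> with unit exponent, conjugating them by the inverse of
  \<open>sec \<gamma> j\<close> yields a subgroup with \<open>rt 1\<close> and with \<open>d\<close>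
  conjugated by a word of length \<open>len j + len 0\<close>. If neither \<open>j = 1\<close> nor
  \<open>j = y\<close> shortens the word, all syllables sit at one position; then
  \<open>\<gamma>\<close> is a rooted element of \<open>L\<close> times an element of
  \<open>D\<close>, and the latter commutes with \<open>d\<close>.\<close>

lemma desc_ex_rooted_directed:
  assumes d: "d \<in> D" "\<not> p dvd E0 d 1"
  shows "subgrp L \<Longrightarrow> rt 1 \<in> L \<Longrightarrow> wrd \<gamma> f n r \<Longrightarrow> \<gamma> * d * inverse \<gamma> \<in> L \<Longrightarrow>
    \<exists>L'. desc L L' \<and> rt 1 \<in> L' \<and> d \<in> L'"
proof (induction n arbitrary: L \<gamma> f r rule: less_induct)
  case (less n)
  note L = less.prems(1) and rtL = rt_all[OF less.prems(1,2)]
  have \<gamma>G: "\<gamma> \<in> G" using less.prems(3) wrd_G by blast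
  obtain w where w: "valid w" "length w = n" "\<gamma> = ev w * rt r"
    using less.prems(3) unfolding wrd_def by blast
  obtain y where y: "\<not> q dvd y" "\<not> q dvd y - 1" "\<not> p dvd E0 d y" using ex_second_unit[OF d] by blast
  define len where "len = (\<lambda>j. length (filter (\<lambda>x. q dvd j + r - fst x) w))"
  have sec\<gamma>: "\<exists>f s. wrd (sec \<gamma> j) f (len j) s" for j
    using sec_ev[OF w(1), of "j + r"] sec_ev_rt[OF w(1), of r j] w(3) unfolding len_def by auto
  have sect_L: "sect L i = sect L 0" for i using sect_conj_rt[OF L rtL, of 0 i] by simp
  note L0 = subgrp_sect[OF L, of 0]
  have in_L0: "sec \<gamma> j * sec d j * inverse (sec \<gamma> j) \<in> sect L 0" for j
    using sect_I[OF less.prems(4) sec_conj_D(1)[OF d(1) \<gamma>G], of "j + \<rho> \<gamma>"]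
    unfolding sec_conj_D(2)[OF d(1) \<gamma>G] sect_L[of "j + \<rho> \<gamma>"] .
  have reduce: ?case if j: "\<not> q dvd j" "\<not> p dvd E0 d j" and lt: "len 0 + len j < n" for j
  proof -
    define g where "g = inverse (sec \<gamma> j)"
    have gG: "g \<in> G" unfolding g_def by (intro G_inv sec_closed \<gamma>G)
    define L2 where "L2 = (\<lambda>x. g * x * inverse g) ` sect L 0"
    have L2: "subgrp L2" unfolding L2_def by (rule subgrp_conj[OF L0])
    have "g * (sec \<gamma> j * sec d j * inverse (sec \<gamma> j)) * inverse g \<in> L2"
      unfolding L2_def using in_L0 by blast
    then have "rt (E0 d j) \<in> L2" using rt_E0[OF d(1) j(1)] by (simp add: g_def mult.assoc)
    then have rt2: "rt 1 \<in> L2" using rt_in_subgrp[OF L2 _ j(2)] by blast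
    have "g * (sec \<gamma> 0 * sec d 0 * inverse (sec \<gamma> 0)) * inverse g \<in> L2"
      unfolding L2_def using in_L0 by blast
    moreover have "sec d 0 = d" using sec_D_0[OF d(1), of 0] by simp
    ultimately have d2: "(g * sec \<gamma> 0) * d * inverse (g * sec \<gamma> 0) \<in> L2" by (simp add: mult.assoc)
    obtain f1 s1 f2 s2 where "wrd (sec \<gamma> j) f1 (len j) s1" "wrd (sec \<gamma> 0) f2 (len 0) s2" using sec\<gamma> by metis
    from wrd_mult[OF wrd_inv[OF this(1)] this(2)]
    have "wrd (g * sec \<gamma> 0) (inverse f1 * f2) (len j + len 0) (- s1 + s2)" by (simp add: g_def)
    from less.IH[OF _ L2 rt2 this d2] obtain L' where "desc L2 L'" "rt 1 \<in> L'" "d \<in> L'"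
      using lt by (auto simp: add.commute)
    moreover have "desc L L2" unfolding L2_def
      by (rule desc_sect[of L 0], rule desc_conj[OF gG], rule desc_refl)
    ultimately show ?thesis using desc_trans by blast
  qed
  show ?case
  proof (cases "len 0 + len 1 < n \<or> len 0 + len y < n")
    case True
    have "\<not> q dvd 1" using q_gt_1 by auto
    then show ?thesis using True reduce[of 1] reduce[of y] y d by blast
  next
    case False
    have nq1: "\<not> q dvd 1" using q_gt_1 by auto
    have "len 0 + len 1 + len y \<le> length w" unfolding len_def
    proof (rule length_filter_disj3)
      fix x :: "int \<times> 'a"
      show "\<not> (q dvd 0 + r - fst x \<and> q dvd 1 + r - fst x)"
      proof
        assume "q dvd 0 + r - fst x \<and> q dvd 1 + r - fst x"
        then have "q dvd 1" by Groebner_Basis.algebra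
        then show False using nq1 by blast
      qed
      show "\<not> (q dvd 0 + r - fst x \<and> q dvd y + r - fst x)"
      proof
        assume "q dvd 0 + r - fst x \<and> q dvd y + r - fst x"
        then have "q dvd y" by Groebner_Basis.algebra
        then show False using y by blast
      qed
      show "\<not> (q dvd 1 + r - fst x \<and> q dvd y + r - fst x)"
      proof
        assume "q dvd 1 + r - fst x \<and> q dvd y + r - fst x"
        then have "q dvd y - 1" by Groebner_Basis.algebra
        then show False using y by blast
      qed
    qed
    \<comment> \<open>Both failures add up to \<open>2 * len 0 + len 1 + len y >= 2 * n\<close>,
      while the three counts together are at most \<open>n\<close>.\<close>
    then have "len 0 = length w" using False w(2) by simp
    then have "q dvd r - fst x" if "x \<in> set w" for x
      using length_filter_less[OF that, of "\<lambda>x. q dvd 0 + r - fst x"] by (auto simp: len_def)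
    then have ev: "ev w = dp (tot w) r" by (rule ev_const[OF w(1)])
    have eq: "\<gamma> * d * inverse \<gamma> = rt r * (tot w * d * inverse (tot w)) * inverse (rt r)"
      unfolding w(3) ev dp_def by (simp add: rt_inv[symmetric] mult.assoc)
    have "tot w * d * inverse (tot w) = d"
      using D_commute[OF tot_D[OF w(1)] d(1)] by (simp add: mult.assoc)
    with eq have "\<gamma> * d * inverse \<gamma> = rt r * d * inverse (rt r)" by (simp only:)
    then have "rt r * d * inverse (rt r) \<in> L" using less.prems(4) by (simp only:)
    then have "inverse (rt r) * (rt r * d * inverse (rt r)) * rt r \<in> L"
      using subgrp_mult[OF L] subgrp_inv[OF L rtL] rtL by blast
    then have "d \<in> L" by (simp add: mult.assoc)
    then show ?thesis using less.prems(2) desc_refl by blast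
  qed
qed

text \<open>With \<open>rt 1\<close> in \<open>M\<close> the sections at all letters agree. Those at
  0 keep \<open>D \<inter> M\<close>, and the section of \<open>d\<close> at 1 is rooted with unit
  exponent, which restores \<open>rt 1\<close>.\<close>

lemma secs_keep:
  assumes d: "d \<in> D" "\<not> p dvd E0 d 1"
  shows "secs M L \<Longrightarrow> subgrp M \<Longrightarrow> rt 1 \<in> M \<Longrightarrow> d \<in> M \<Longrightarrow> subgrp L \<and> rt 1 \<in> L \<and> D \<inter> M \<subseteq> L"
proof (induction rule: secs.induct)
  case (secs_step M i L)
  have eq: "sect M i = sect M j" for i j
    using sect_conj_rt[OF secs_step.prems(1) rt_all[OF secs_step.prems(1,2)], of j "i - j"] by simp
  note S = subgrp_sect[OF secs_step.prems(1)]
  have nq1: "\<not> q dvd 1" using q_gt_1 by auto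
  have "rt (E0 d 1) \<in> sect M 1"
    using sect_I[OF secs_step.prems(3) D_S1[OF d(1)], of 1] rt_E0[OF d(1) nq1] by simp
  then have "rt 1 \<in> sect M 1" by (rule rt_in_subgrp[OF S _ d(2)])
  moreover have DM: "D \<inter> M \<subseteq> sect M 0"
    using sect_I[of _ M 0] D_S1 sec_D_0[of _ 0] by (metis IntE dvd_0_right subsetI)
  ultimately show ?case
    using secs_step.IH[OF S] eq[of i 1] eq[of i 0] d secs_step.prems(3) by blast
qed simp

theorem dense_eq_G: assumes M: "dense M" shows "M = G"
proof -
  \<comment> \<open>Directed elements without unit exponent at 1; additivity of that exponent modulo
    \<open>q\<close> makes them a subgroup, as \<open>secs_ex_directed\<close> demands.\<close>
  define D0 where "D0 = {f \<in> D. p dvd E0 f 1}"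
  have nq1: "\<not> q dvd 1" using q_gt_1 by auto
  have add: "q dvd E0 (x * y) 1 - (E0 x 1 + E0 y 1)" if "x \<in> D" "y \<in> D" for x y
  proof -
    have "rt (E0 (x * y) 1) = rt (E0 x 1 + E0 y 1)"
      using rt_E0[OF _ nq1] that subgrp_mult[OF subgrp_D that] sec_mult_S1[OF D_in_G D_S1, of x y 1]
      by (simp add: rt_add)
    then show ?thesis by (simp add: rt_eq_iff)
  qed
  have D0: "subgrp D0" unfolding subgrp_def D0_def
  proof (intro conjI ballI)
    have e1: "p dvd E0 1 1"
    proof -
      have "q dvd E0 (1 * 1) 1 - (E0 1 1 + E0 1 1)" using subgrp_one[OF subgrp_D] by (intro add)
      then have "q dvd E0 1 1" by simp
      then show ?thesis using p_dvd_q dvd_trans by blast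
    qed
    then show "1 \<in> {f \<in> D. p dvd E0 f 1}" using subgrp_one[OF subgrp_D] by simp
    fix x y assume x: "x \<in> {f \<in> D. p dvd E0 f 1}"
    {
      assume y: "y \<in> {f \<in> D. p dvd E0 f 1}"
      have "p dvd E0 (x * y) 1 - (E0 x 1 + E0 y 1)" using add x y p_dvd_q dvd_trans by blast
      moreover have "p dvd E0 x 1" "p dvd E0 y 1" using x y by auto
      ultimately have "p dvd E0 (x * y) 1" by Groebner_Basis.algebra
      then show "x * y \<in> {f \<in> D. p dvd E0 f 1}" using x y subgrp_mult[OF subgrp_D] by simp
    }
    have "q dvd E0 (x * inverse x) 1 - (E0 x 1 + E0 (inverse x) 1)"
      using x subgrp_inv[OF subgrp_D] by (intro add) auto
    then have "p dvd E0 1 1 - (E0 x 1 + E0 (inverse x) 1)" using p_dvd_q dvd_trans by simp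
    moreover have "p dvd E0 x 1" using x by simp
    ultimately have "p dvd E0 (inverse x) 1" using e1 by Groebner_Basis.algebra
    then show "inverse x \<in> {f \<in> D. p dvd E0 f 1}" using x subgrp_inv[OF subgrp_D] by simp
  qed
  have "d0 \<notin> D0" using E0_d0_1 by (simp add: D0_def)
  obtain m n r where "m \<in> M" "wrd m d0 n r" using dense_wrd[OF M d0_D] by blast
  then obtain w where w: "valid w" "tot w = d0" "ev w * rt r \<in> M" unfolding wrd_def by blast
  obtain L d where L: "secs M L" and dL: "d \<in> L" "d \<in> D" "d \<notin> D0"
    using secs_ex_directed[OF D0 dense_subgrp[OF M] w(3,1)] w(2) \<open>d0 \<notin> D0\<close> by blast
  have du: "\<not> p dvd E0 d 1" using dL by (simp add: D0_def)
  have Ld: "dense L" using desc_dense[OF secs_desc[OF L] M] .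
  \<comment> \<open>At letter 1 the section of \<open>d\<close> is rooted with unit exponent, and
    \<open>t\<close> carries a conjugate of \<open>d\<close> there, so \<open>sect L 1\<close> has
    both.\<close>
  obtain t where t: "t \<in> L" "q dvd \<rho> t - 1" using dense_transitive[OF Ld] by blast
  have tG: "t \<in> G" using t dense_sub[OF Ld] by blast
  define L1 where "L1 = sect L 1"
  have L1: "subgrp L1" unfolding L1_def by (rule subgrp_sect[OF dense_subgrp[OF Ld]])
  have "t * d * inverse t \<in> L"
    using t dL subgrp_mult[OF dense_subgrp[OF Ld]] subgrp_inv[OF dense_subgrp[OF Ld]] by simp
  from sect_I[OF this sec_conj_D(1)[OF dL(2) tG], of "0 + \<rho> t"]
  have "sec t 0 * d * inverse (sec t 0) \<in> sect L (\<rho> t)"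
    unfolding sec_conj_D(2)[OF dL(2) tG] using sec_D_0[OF dL(2), of 0] by simp
  then have conj: "sec t 0 * d * inverse (sec t 0) \<in> L1" using sect_cong[OF t(2)] by (simp add: L1_def)
  have "rt (E0 d 1) \<in> L1"
    using sect_I[OF dL(1) D_S1[OF dL(2)], of 1] rt_E0[OF dL(2) nq1] by (simp add: L1_def)
  then have rt1: "rt 1 \<in> L1" by (rule rt_in_subgrp[OF L1 _ du])
  obtain f n' r' where "wrd (sec t 0) f n' r'" using wrd_ex[OF sec_closed[OF tG]] by blast
  from desc_ex_rooted_directed[OF dL(2) du L1 rt1 this conj]
  obtain L' where L': "desc L1 L'" "rt 1 \<in> L'" "d \<in> L'" by blast
  have desc_L': "desc M L'"
    using desc_trans[OF secs_desc[OF L] desc_sect] L'(1) by (simp add: L1_def)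
  have L'd: "dense L'" by (rule desc_dense[OF desc_L' M])
  note keep = secs_keep[OF dL(2) du _ dense_subgrp[OF L'd] L'(2,3)]
  \<comment> \<open>All iterated sections of \<open>L'\<close> contain \<open>rt 1\<close> and
    \<open>d\<close>; one with the most directed elements is chosen.\<close>
  obtain H where H: "secs L' H" and H_max: "\<And>H'. secs L' H' \<Longrightarrow> card (D \<inter> H') \<le> card (D \<inter> H)"
  proof -
    have "\<forall>H. secs L' H \<longrightarrow> card (D \<inter> H) < Suc (card D)"
      using card_mono[OF finite_D, of "D \<inter> _"] by (simp add: less_Suc_eq_le)
    with ex_has_greatest_nat[of "secs L'" L' "\<lambda>H. card (D \<inter> H)" "Suc (card D)"] secs_refl that
    show ?thesis by blast
  qed
  have Hk: "subgrp H" "rt 1 \<in> H" "D \<inter> L' \<subseteq> H" using keep[OF H] by auto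
  have dH: "d \<in> H" using Hk(3) dL(2) L'(3) by blast
  have MH: "desc M H" using desc_trans[OF desc_L' secs_desc[OF H]] .
  have Hd: "dense H" by (rule desc_dense[OF MH M])
  have "D \<subseteq> H"
  proof (rule ccontr)
    assume "\<not> D \<subseteq> H"
    then obtain e where e: "e \<in> D" "e \<notin> H" by blast
    obtain m n r where "m \<in> H" "wrd m e n r" using dense_wrd[OF Hd e(1)] by blast
    then obtain w where w: "valid w" "tot w = e" "ev w * rt r \<in> H" unfolding wrd_def by blast
    \<comment> \<open>\<open>H\<close> itself serves as the subgroup to be avoided, so the directed
      element found is new, while \<open>secs_keep\<close> loses none of the old ones.\<close>
    obtain H' e' where H': "secs H H'" "e' \<in> H'" "e' \<in> D" "e' \<notin> H"
      using secs_ex_directed[OF Hk(1,1) w(3,1)] w(2) e(2) by blast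
    have "D \<inter> H \<subseteq> D \<inter> H'" using secs_keep[OF dL(2) du H'(1) Hk(1,2) dH] by blast
    then have "D \<inter> H \<subset> D \<inter> H'" using H' by blast
    then have "card (D \<inter> H) < card (D \<inter> H')" using finite_D by (intro psubset_card_mono) auto
    then show False using H_max[OF secs_trans[OF H H'(1)]] by simp
  qed
  then have "G \<subseteq> H" using rt_all[OF Hk(1,2)] by (intro gen_induct_G Hk(1))
  then have "H = G" using dense_sub[OF Hd] by blast
  then show ?thesis using desc_eq_G[OF MH M] by blast
qed

text \<open>For \<open>N\<close> normal of finite index, the product of \<open>M\<close> and
  \<open>N\<close> is a subgroup containing \<open>M\<close>. If it were \<open>M\<close>, then
  \<open>N\<close> would lie in \<open>M\<close> and \<open>M\<close> would have finite index; so it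
  is \<open>G\<close>, and \<open>M\<close> is dense.\<close>

theorem maximal_fin_index:
  assumes M: "subgrp M" "M \<subseteq> G" "M \<noteq> G"
    and max: "\<And>H. subgrp H \<Longrightarrow> H \<subseteq> G \<Longrightarrow> M \<subseteq> H \<Longrightarrow> H = M \<or> H = G"
  shows "fin_index M G"
proof (rule ccontr)
  assume inf: "\<not> fin_index M G"
  have "dense M" unfolding dense_def
  proof (intro conjI allI impI ballI)
    fix N g assume N: "nrm N G" "fin_index N G" and g: "g \<in> G"
    note Ns = nrm_subgrp[OF N(1)]
    define H where "H = {m * n | m n. m \<in> M \<and> n \<in> N}"
    have H: "subgrp H" unfolding subgrp_def
    proof (intro conjI ballI)
      show "1 \<in> H" unfolding H_def using subgrp_one[OF M(1)] subgrp_one[OF Ns]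
        by (intro CollectI exI[of _ 1]) simp
    next
      fix x y assume "x \<in> H" "y \<in> H"
      then obtain m n m' n' where xy: "m \<in> M" "n \<in> N" "x = m * n" "m' \<in> M" "n' \<in> N" "y = m' * n'"
        by (auto simp: H_def)
      have "x * y = (m * m') * ((inverse m' * n * m') * n')" using xy by (simp add: mult.assoc)
      moreover have "inverse m' * n * m' \<in> N" using nrm_conj'[OF N(1) G _ xy(2)] xy(4) M(2) by blast
      ultimately show "x * y \<in> H" unfolding H_def
        using subgrp_mult[OF M(1) xy(1,4)] subgrp_mult[OF Ns _ xy(5)] by blast
    next
      fix x assume "x \<in> H"
      then obtain m n where x: "m \<in> M" "n \<in> N" "x = m * n" by (auto simp: H_def)
      have "inverse x = inverse m * (m * inverse n * inverse m)" using x by (simp add: mult.assoc)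
      moreover have "m * inverse n * inverse m \<in> N"
        using nrm_conj[OF N(1) _ subgrp_inv[OF Ns x(2)]] x(1) M(2) by blast
      ultimately show "inverse x \<in> H" unfolding H_def using subgrp_inv[OF M(1) x(1)] by blast
    qed
    have HG: "H \<subseteq> G" using M(2) nrm_sub[OF N(1)] by (auto simp: H_def intro!: G_mult)
    have MH: "M \<subseteq> H" using subgrp_one[OF Ns] by (force simp: H_def)
    have NH: "N \<subseteq> H" using subgrp_one[OF M(1)] by (force simp: H_def)
    have "H \<noteq> M" using NH N(2) inf fin_index_mono by blast
    then have "H = G" using max[OF H HG MH] by blast
    then obtain m n where mn: "m \<in> M" "n \<in> N" "g = m * n" using g by (auto simp: H_def)
    have "g * inverse n \<in> M" using mn by (simp add: mult.assoc)
    then show "\<exists>n\<in>N. g * n \<in> M" using subgrp_inv[OF Ns mn(2)] by blast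
  qed (use M in auto)
  then show False using dense_eq_G M(3) by blast
qed

end

section \<open>Constant spinal groups with cyclic rooted group\<close>

text \<open>The class \<open>mult_group\<close> wants total operations on a type, while tree
  automorphisms depend on the set of letters; the permutations of all lists form such a
  type.\<close>

typedef 'a list_perm = "{f :: 'a list \<Rightarrow> 'a list. bij f}"
  by (rule exI[of _ id]) simp

lemma bij_Rep_list_perm: "bij (Rep_list_perm f)"
  using Rep_list_perm[of f] by simp

instantiation list_perm :: (type) mult_group
begin

definition "1 = Abs_list_perm (id :: 'a list \<Rightarrow> 'a list)"
definition "f * g = Abs_list_perm (Rep_list_perm f \<circ> Rep_list_perm (g :: 'a list_perm))"
definition "inverse f = Abs_list_perm (inv_into UNIV (Rep_list_perm (f :: 'a list_perm)))"

lemma Rep_list_perm_one: "Rep_list_perm (1 :: 'a list_perm) = id"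
  unfolding one_list_perm_def by (rule Abs_list_perm_inverse) simp

lemma Rep_list_perm_mult: "Rep_list_perm (f * g) = Rep_list_perm f \<circ> Rep_list_perm (g :: 'a list_perm)"
  unfolding times_list_perm_def
  by (rule Abs_list_perm_inverse) (simp add: bij_comp bij_Rep_list_perm)

lemma Rep_list_perm_inverse': "Rep_list_perm (inverse f) = inv_into UNIV (Rep_list_perm (f :: 'a list_perm))"
  unfolding inverse_list_perm_def
  by (rule Abs_list_perm_inverse) (simp add: bij_imp_bij_inv bij_Rep_list_perm)

instance
proof
  fix x y z :: "'a list_perm"
  note [simp] = Rep_list_perm_inject[symmetric] Rep_list_perm_one Rep_list_perm_mult
    Rep_list_perm_inverse'
  show "x * y * z = x * (y * z)" by (simp add: comp_assoc)
  show "1 * x = x" "x * 1 = x" by simp_all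
  show "inverse x * x = 1" using bij_Rep_list_perm[of x] by (simp add: bij_is_inj)
qed

end

text \<open>Tree automorphisms are extensional; extending them by the identity turns them into
  permutations of all lists.\<close>

definition emb :: "'a set \<Rightarrow> ('a list \<Rightarrow> 'a list) \<Rightarrow> 'a list_perm" where
  "emb X f = Abs_list_perm (\<lambda>w. if w \<in> lists X then f w else w)"

lemma tree_auts_bij: "f \<in> tree_auts X \<Longrightarrow> bij_betw f (lists X) (lists X)"
  by (simp add: tree_auts_def Bij_def)

lemma tree_auts_extensional: "f \<in> tree_auts X \<Longrightarrow> f \<in> extensional (lists X)"
  by (simp add: tree_auts_def Bij_def)

lemma bij_extend:
  assumes "f \<in> tree_auts X" shows "bij (\<lambda>w. if w \<in> lists X then f w else w)"
proof -
  have "bij_betw (\<lambda>w. if w \<in> lists X then f w else id w) (lists X \<union> - lists X) (lists X \<union> - lists X)"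
    by (rule bij_betw_disjoint_Un[OF tree_auts_bij[OF assms] bij_betw_id]) auto
  then show ?thesis unfolding id_def by simp
qed

lemma Rep_emb: "f \<in> tree_auts X \<Longrightarrow> Rep_list_perm (emb X f) w = (if w \<in> lists X then f w else w)"
  unfolding emb_def by (subst Abs_list_perm_inverse) (simp_all add: bij_extend)

lemma emb_inj: assumes "f \<in> tree_auts X" "g \<in> tree_auts X" "emb X f = emb X g" shows "f = g"
proof (rule extensionalityI)
  show "f \<in> extensional (lists X)" "g \<in> extensional (lists X)" using assms tree_auts_extensional by auto
  fix w assume "w \<in> lists X"
  then show "f w = g w" using Rep_emb[OF assms(1), of w] Rep_emb[OF assms(2), of w] assms(3) by simp
qed

lemma tree_mult: "f \<in> tree_auts X \<Longrightarrow> g \<in> tree_auts X \<Longrightarrow>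
    f \<otimes>\<^bsub>tree_aut_group X\<^esub> g = compose (lists X) f g"
  by (simp add: tree_aut_group_def BijGroup_def tree_auts_def)

lemma tree_mult_apply: "f \<in> tree_auts X \<Longrightarrow> g \<in> tree_auts X \<Longrightarrow> w \<in> lists X \<Longrightarrow>
    (f \<otimes>\<^bsub>tree_aut_group X\<^esub> g) w = f (g w)"
  by (simp add: tree_mult compose_eq)

lemma tree_mult_closed: "f \<in> tree_auts X \<Longrightarrow> g \<in> tree_auts X \<Longrightarrow>
    f \<otimes>\<^bsub>tree_aut_group X\<^esub> g \<in> tree_auts X"
  using monoid.m_closed[OF group.is_monoid[OF group_tree_aut_group], of f X g]
  by (simp add: tree_aut_group_def)

lemma tree_one: "\<one>\<^bsub>tree_aut_group X\<^esub> = (\<lambda>w\<in>lists X. w)"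
  by (simp add: tree_aut_group_def BijGroup_def)

lemma tree_one_in: "\<one>\<^bsub>tree_aut_group X\<^esub> \<in> tree_auts X"
  using monoid.one_closed[OF group.is_monoid[OF group_tree_aut_group], of X]
  by (simp add: tree_aut_group_def)

lemma emb_mult:
  assumes "f \<in> tree_auts X" "g \<in> tree_auts X"
  shows "emb X (f \<otimes>\<^bsub>tree_aut_group X\<^esub> g) = emb X f * emb X g"
proof -
  have "Rep_list_perm (emb X (f \<otimes>\<^bsub>tree_aut_group X\<^esub> g)) w = Rep_list_perm (emb X f * emb X g) w" for w
    using assms tree_auts_closed[OF assms(2), of w]
    by (simp add: Rep_emb tree_mult_closed tree_mult_apply Rep_list_perm_mult)
  then show ?thesis by (metis Rep_list_perm_inject ext)
qed

lemma emb_one: "emb X (\<one>\<^bsub>tree_aut_group X\<^esub>) = 1"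
proof -
  have "Rep_list_perm (emb X (\<one>\<^bsub>tree_aut_group X\<^esub>)) w = Rep_list_perm 1 w" for w
    by (simp add: Rep_emb tree_one_in Rep_list_perm_one) (simp add: tree_one)
  then show ?thesis by (metis Rep_list_perm_inject ext)
qed

lemma tree_section_unique:
  assumes "g \<in> tree_auts X" "v \<in> lists X" "h \<in> tree_auts X" "\<And>u. u \<in> lists X \<Longrightarrow> g (v @ u) = g v @ h u"
  shows "tree_section X g v = h"
  using tree_section_ex1[OF assms(1,2)] tree_section_in_tree_auts[OF assms(1,2)]
    tree_section_eq[OF assms(1,2)] assms(3,4) by blast

lemma tree_section_mult:
  assumes f: "f \<in> tree_auts X" and g: "g \<in> tree_auts X" and v: "v \<in> lists X"
  shows "tree_section X (f \<otimes>\<^bsub>tree_aut_group X\<^esub> g) v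
    = tree_section X f (g v) \<otimes>\<^bsub>tree_aut_group X\<^esub> tree_section X g v"
proof (rule tree_section_unique[OF tree_mult_closed[OF f g] v])
  have gv: "g v \<in> lists X" by (rule tree_auts_closed[OF g v])
  note s = tree_section_in_tree_auts[OF f gv] tree_section_in_tree_auts[OF g v]
  show "tree_section X f (g v) \<otimes>\<^bsub>tree_aut_group X\<^esub> tree_section X g v \<in> tree_auts X"
    by (rule tree_mult_closed[OF s])
  fix u assume u: "u \<in> lists X"
  then have vu: "v @ u \<in> lists X" using v by simp
  have "(f \<otimes>\<^bsub>tree_aut_group X\<^esub> g) (v @ u) = f (g v @ tree_section X g v u)"
    using tree_mult_apply[OF f g vu] tree_section_eq[OF g v u] by simp
  also have "\<dots> = f (g v) @ tree_section X f (g v) (tree_section X g v u)"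
    by (rule tree_section_eq[OF f gv tree_auts_closed[OF s(2) u]])
  finally show "(f \<otimes>\<^bsub>tree_aut_group X\<^esub> g) (v @ u) = (f \<otimes>\<^bsub>tree_aut_group X\<^esub> g) v
      @ (tree_section X f (g v) \<otimes>\<^bsub>tree_aut_group X\<^esub> tree_section X g v) u"
    by (simp add: tree_mult_apply f g v u s)
qed

section \<open>The spinal group as an instance of the abstract setting\<close>

locale cyclic_spinal = R: group R
  for R :: "('a, 'b) monoid_scheme" (structure) +
  fixes D :: "('a list \<Rightarrow> 'a list) set" and x r :: 'a and p k :: nat and d0 :: "'a list \<Rightarrow> 'a list"
  assumes fin: "finite (carrier R)"
    and D: "subgroup D (tree_aut_group (carrier R))"
    and directed: "d \<in> D \<Longrightarrow> directed_aut R d"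
    and prime_p: "prime p" and k_pos: "k > 0" and order_R: "order R = p ^ k"
    and x: "x \<in> carrier R" "generate R {x} = carrier R"
    and d0: "d0 \<in> D"
    and r: "r \<in> carrier R" "tree_section (carrier R) d0 [x] = rooted R r" "generate R {r} = carrier R"
    and periodic: "periodic_group (spinal_group R D)"
begin

abbreviation X :: "'a set" where "X \<equiv> carrier R"

abbreviation A :: "('a list \<Rightarrow> 'a list) monoid" where "A \<equiv> tree_aut_group X"

abbreviation S :: "('a list \<Rightarrow> 'a list) monoid" where "S \<equiv> spinal_group R D"

text \<open>Letters are numbered by exponents of the generator \<open>x\<close>, so the identity
  becomes letter 0 and the distinguished vertex letter 1.\<close>

definition ltr :: "int \<Rightarrow> 'a" where "ltr i = x [^] i"

definition qq :: int where "qq = int (p ^ k)"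

lemma carrier_A: "carrier A = tree_auts X" by (simp add: tree_aut_group_def)

lemma ltr_closed [simp]: "ltr i \<in> X" using x by (simp add: ltr_def)

lemma ltr_add: "ltr (i + j) = ltr i \<otimes> ltr j"
  using x by (simp add: ltr_def R.int_pow_mult)

lemma ltr_0: "ltr 0 = \<one>" by (simp add: ltr_def)

lemma ltr_surj: "y \<in> X \<Longrightarrow> \<exists>i. y = ltr i"
  using R.generate_pow[OF x(1)] x(2) by (auto simp: ltr_def)

lemma ltr_eq_iff: "ltr i = ltr j \<longleftrightarrow> qq dvd i - j"
proof -
  have "R.ord x = p ^ k" using R.generate_pow_card[OF x(1)] x(2) order_R by (simp add: order_def)
  then show ?thesis using R.int_pow_eq[OF x(1), of j i] by (auto simp: ltr_def qq_def)
qed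

lemma rooted_auts_in: "f \<in> rooted_auts R \<Longrightarrow> f \<in> tree_auts X"
  using rooted_in_tree_auts[OF R.is_group] by (auto simp: rooted_auts_def)

lemma D_in: "f \<in> D \<Longrightarrow> f \<in> tree_auts X"
  using subgroup.subset[OF D] carrier_A by auto

lemma carrier_S: "carrier S = generate A (rooted_auts R \<union> D)"
proof -
  have "rooted_auts R \<union> D \<subseteq> carrier A" using rooted_auts_in D_in carrier_A by auto
  then show ?thesis by (simp add: spinal_group_def carrier_subgroup_generated Int_absorb1)
qed

lemma mult_S: "f \<otimes>\<^bsub>S\<^esub> g = f \<otimes>\<^bsub>A\<^esub> g"
  by (simp add: spinal_group_def subgroup_generated_def)

lemma one_S: "\<one>\<^bsub>S\<^esub> = \<one>\<^bsub>A\<^esub>" by (simp add: spinal_group_def)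

lemma group_S: "group S"
  unfolding spinal_group_def by (rule group.group_subgroup_generated[OF group_tree_aut_group])

lemma S_sub: "f \<in> carrier S \<Longrightarrow> f \<in> tree_auts X"
  using group.generate_in_carrier[OF group_tree_aut_group, of "rooted_auts R \<union> D" X f]
    rooted_auts_in D_in carrier_A carrier_S by auto

lemma emb_mult_S: "f \<in> carrier S \<Longrightarrow> g \<in> carrier S \<Longrightarrow> emb X (f \<otimes>\<^bsub>S\<^esub> g) = emb X f * emb X g"
  by (simp add: mult_S emb_mult S_sub)

lemma emb_inv_S: "f \<in> carrier S \<Longrightarrow> emb X (inv\<^bsub>S\<^esub> f) = inverse (emb X f)"
proof -
  assume f: "f \<in> carrier S"
  have "emb X f * emb X (inv\<^bsub>S\<^esub> f) = 1"
    using emb_mult_S[OF f group.inv_closed[OF group_S f]] group.r_inv[OF group_S f]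
    by (simp add: one_S emb_one)
  then show ?thesis by (simp only: mg_eq_1_iff)
qed

lemma rooted_apply: "s \<in> X \<Longrightarrow> y \<in> X \<Longrightarrow> u \<in> lists X \<Longrightarrow> rooted R s (y # u) = (s \<otimes> y) # u"
  by (simp add: rooted_def)

lemma rooted_mult: assumes "s \<in> X" "t \<in> X" shows "rooted R (s \<otimes> t) = rooted R s \<otimes>\<^bsub>A\<^esub> rooted R t"
proof (rule extensionalityI)
  have st: "rooted R s \<in> tree_auts X" "rooted R t \<in> tree_auts X"
    using assms rooted_in_tree_auts[OF R.is_group] by auto
  show "rooted R (s \<otimes> t) \<in> extensional (lists X)" by (simp add: rooted_def)
  show "rooted R s \<otimes>\<^bsub>A\<^esub> rooted R t \<in> extensional (lists X)"
    by (rule tree_auts_extensional[OF tree_mult_closed[OF st]])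
  fix w assume w: "w \<in> lists X"
  show "rooted R (s \<otimes> t) w = (rooted R s \<otimes>\<^bsub>A\<^esub> rooted R t) w"
    unfolding tree_mult_apply[OF st w] using assms w by (cases w) (auto simp: rooted_def R.m_assoc)
qed

lemma rooted_one: "rooted R \<one> = \<one>\<^bsub>A\<^esub>"
  unfolding tree_one by (rule extensionalityI[of _ "lists X"]) (auto simp: rooted_def split: list.split)

lemma section_rooted: assumes "s \<in> X" "y \<in> X" shows "tree_section X (rooted R s) [y] = \<one>\<^bsub>A\<^esub>"
proof (rule tree_section_unique[OF _ _ tree_one_in])
  show "rooted R s \<in> tree_auts X" by (rule rooted_in_tree_auts[OF R.is_group assms(1)])
qed (use assms in \<open>auto simp: tree_one rooted_apply\<close>)

definition trans_by :: "('a list \<Rightarrow> 'a list) \<Rightarrow> int \<Rightarrow> bool" where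
  "trans_by f s \<longleftrightarrow> (\<forall>y\<in>X. f [y] = [ltr s \<otimes> y])"

lemma gens_S: "rooted_auts R \<union> D \<subseteq> carrier S"
  unfolding carrier_S by (auto intro: generate.incl)

lemma gens_inv: assumes "f \<in> rooted_auts R \<union> D" shows "inv\<^bsub>A\<^esub> f \<in> rooted_auts R \<union> D"
  using assms
proof
  assume "f \<in> D"
  then show ?thesis using subgroup.m_inv_closed[OF D] by blast
next
  assume "f \<in> rooted_auts R"
  then obtain s where s: "s \<in> X" "f = rooted R s" by (auto simp: rooted_auts_def)
  have "rooted R (inv s) \<otimes>\<^bsub>A\<^esub> f = \<one>\<^bsub>A\<^esub>" using s rooted_mult[of "inv s" s] rooted_one by simp
  then have "inv\<^bsub>A\<^esub> f = rooted R (inv s)"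
    using s by (intro group.inv_equality[OF group_tree_aut_group])
      (auto simp: carrier_A rooted_in_tree_auts[OF R.is_group])
  then show ?thesis using s by (auto simp: rooted_auts_def)
qed

text \<open>The generating set is closed under inverses, so no separate case for them
  remains.\<close>

lemma S_induct [consumes 1, case_names one gen mult]:
  assumes "f \<in> carrier S" "P \<one>\<^bsub>A\<^esub>" "\<And>f. f \<in> rooted_auts R \<union> D \<Longrightarrow> P f"
    "\<And>f g. f \<in> carrier S \<Longrightarrow> g \<in> carrier S \<Longrightarrow> P f \<Longrightarrow> P g \<Longrightarrow> P (f \<otimes>\<^bsub>A\<^esub> g)"
  shows "P f"
proof -
  from assms(1) have "f \<in> generate A (rooted_auts R \<union> D)" by (simp add: carrier_S)
  then show ?thesis
    by induction (use assms gens_inv carrier_S in auto)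
qed

lemma S_self_similar:
  "f \<in> carrier S \<Longrightarrow> (\<exists>s. trans_by f s) \<and> (\<forall>y\<in>X. tree_section X f [y] \<in> carrier S)"
proof (induction rule: S_induct)
  case one
  have "trans_by (\<one>\<^bsub>A\<^esub>) 0" by (auto simp: trans_by_def tree_one ltr_0)
  moreover have "tree_section X (\<one>\<^bsub>A\<^esub>) [y] = \<one>\<^bsub>A\<^esub>" if "y \<in> X" for y
    using section_rooted[of "\<one>" y] that by (simp add: rooted_one)
  ultimately show ?case using generate.one[of A] carrier_S by auto
next
  case (gen f)
  then show ?case
  proof
    assume "f \<in> rooted_auts R"
    then obtain s where s: "s \<in> X" "f = rooted R s" by (auto simp: rooted_auts_def)
    obtain i where "s = ltr i" using ltr_surj[OF s(1)] by blast
    then have "trans_by f i" using s by (simp add: trans_by_def rooted_apply)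
    then show ?thesis using section_rooted[OF s(1)] s(2) generate.one[of A] carrier_S by auto
  next
    assume f: "f \<in> D"
    note d = directed[OF f, unfolded directed_aut_def]
    have "trans_by f 0" using d by (simp add: trans_by_def ltr_0)
    moreover have "tree_section X f [y] \<in> carrier S" if "y \<in> X" for y
      using d f that gens_S by (cases "y = \<one>") auto
    ultimately show ?thesis by blast
  qed
next
  case (mult f g)
  then obtain s t where st: "trans_by f s" "trans_by g t" by blast
  note fg = S_sub[OF mult.hyps(1)] S_sub[OF mult.hyps(2)]
  have "trans_by (f \<otimes>\<^bsub>A\<^esub> g) (s + t)"
    using st by (simp add: trans_by_def tree_mult_apply[OF fg] ltr_add R.m_assoc)
  moreover have "tree_section X (f \<otimes>\<^bsub>A\<^esub> g) [y] \<in> carrier S" if y: "y \<in> X" for y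
  proof -
    have "tree_section X f (g [y]) \<in> carrier S" "tree_section X g [y] \<in> carrier S"
      using mult.IH st(2) y by (auto simp: trans_by_def)
    then have "tree_section X f (g [y]) \<otimes>\<^bsub>S\<^esub> tree_section X g [y] \<in> carrier S"
      using monoid.m_closed[OF group.is_monoid[OF group_S]] by blast
    then show ?thesis using tree_section_mult[OF fg, of "[y]"] y by (simp add: mult_S)
  qed
  ultimately show ?case by blast
qed

lemma trans_by_unique: "trans_by f s \<Longrightarrow> trans_by f t \<Longrightarrow> qq dvd s - t"
proof -
  assume "trans_by f s" "trans_by f t"
  then have "[ltr s \<otimes> \<one>] = [ltr t \<otimes> \<one>]" unfolding trans_by_def by (metis R.one_closed)
  then show ?thesis by (simp add: ltr_eq_iff)
qed

definition GG :: "'a list_perm set" where "GG = emb X ` carrier S"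

text \<open>\<open>emb\<close> is injective on tree automorphisms, so \<open>un\<close> inverts it
  on \<open>GG\<close>. The choice in \<open>rh\<close> below is determined only modulo
  \<open>qq\<close>, which is all that \<open>self_similar\<close> asks.\<close>

definition un :: "'a list_perm \<Rightarrow> 'a list \<Rightarrow> 'a list" where "un g = (SOME f. f \<in> carrier S \<and> emb X f = g)"

definition rh :: "'a list_perm \<Rightarrow> int" where "rh g = (SOME s. trans_by (un g) s)"

definition sc :: "'a list_perm \<Rightarrow> int \<Rightarrow> 'a list_perm" where
  "sc g i = emb X (tree_section X (un g) [ltr i])"

definition ro :: "int \<Rightarrow> 'a list_perm" where "ro s = emb X (rooted R (ltr s))"

lemma un_emb: "f \<in> carrier S \<Longrightarrow> un (emb X f) = f"
  unfolding un_def by (rule some_equality) (auto intro: emb_inj S_sub)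

lemma rh_emb: "f \<in> carrier S \<Longrightarrow> trans_by f (rh (emb X f))"
  using S_self_similar[of f] unfolding rh_def by (simp add: un_emb) (metis someI)

lemma sc_emb: "f \<in> carrier S \<Longrightarrow> sc (emb X f) i = emb X (tree_section X f [ltr i])"
  by (simp add: sc_def un_emb)

lemma sect_S: "f \<in> carrier S \<Longrightarrow> tree_section X f [ltr i] \<in> carrier S"
  using S_self_similar[of f] by simp

lemma S_mult: "f \<in> carrier S \<Longrightarrow> g \<in> carrier S \<Longrightarrow> f \<otimes>\<^bsub>A\<^esub> g \<in> carrier S"
  using monoid.m_closed[OF group.is_monoid[OF group_S], of f g] by (simp add: mult_S)

lemma trans_by_mult:
  assumes "f \<in> carrier S" "g \<in> carrier S" "trans_by f s" "trans_by g t"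
  shows "trans_by (f \<otimes>\<^bsub>A\<^esub> g) (s + t)"
  using assms by (simp add: trans_by_def tree_mult_apply[OF S_sub S_sub] ltr_add R.m_assoc)

sublocale self_similar GG qq rh sc
proof
  show "subgrp GG" unfolding subgrp_def GG_def
  proof (intro conjI ballI)
    have "1 = emb X \<one>\<^bsub>S\<^esub>" by (simp only: one_S emb_one)
    then show "1 \<in> emb X ` carrier S"
      using monoid.one_closed[OF group.is_monoid[OF group_S]] by (rule image_eqI)
  next
    fix f g assume "f \<in> emb X ` carrier S" "g \<in> emb X ` carrier S"
    then obtain f' g' where f: "f' \<in> carrier S" "f = emb X f'" "g' \<in> carrier S" "g = emb X g'" by blast
    have "f * g = emb X (f' \<otimes>\<^bsub>S\<^esub> g')" unfolding f(2,4) by (rule emb_mult_S[OF f(1,3), symmetric])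
    then show "f * g \<in> emb X ` carrier S"
      using monoid.m_closed[OF group.is_monoid[OF group_S] f(1,3)] by (rule image_eqI)
  next
    fix f assume "f \<in> emb X ` carrier S"
    then obtain f' where f: "f' \<in> carrier S" "f = emb X f'" by blast
    have "inverse f = emb X (inv\<^bsub>S\<^esub> f')" unfolding f(2) by (rule emb_inv_S[OF f(1), symmetric])
    then show "inverse f \<in> emb X ` carrier S" using group.inv_closed[OF group_S f(1)] by (rule image_eqI)
  qed
  show "1 < qq" using prime_gt_1_nat[OF prime_p] k_pos by (simp add: qq_def)
next
  fix g h assume "g \<in> GG" "h \<in> GG"
  then obtain f f' where f: "f \<in> carrier S" "g = emb X f" "f' \<in> carrier S" "h = emb X f'"
    by (auto simp: GG_def)
  have m: "g * h = emb X (f \<otimes>\<^bsub>A\<^esub> f')" using f emb_mult_S by (simp add: mult_S)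
  show "qq dvd rh (g * h) - (rh g + rh h)"
    unfolding m unfolding f(2,4)
    by (rule trans_by_unique[OF rh_emb[OF S_mult[OF f(1,3)]]
          trans_by_mult[OF f(1,3) rh_emb[OF f(1)] rh_emb[OF f(3)]]])
  show "sc (g * h) i = sc g (i + rh h) * sc h i" for i
  proof -
    have e: "f' [ltr i] = [ltr (i + rh h)]"
      using rh_emb[OF f(3)] f(4) ltr_add[of "rh h" i] by (simp add: trans_by_def add.commute)
    have "sc (g * h) i = emb X (tree_section X f [ltr (i + rh h)] \<otimes>\<^bsub>A\<^esub> tree_section X f' [ltr i])"
      unfolding m sc_emb[OF S_mult[OF f(1,3)]]
      using tree_section_mult[OF S_sub[OF f(1)] S_sub[OF f(3)], of "[ltr i]"] e by simp
    also have "\<dots> = emb X (tree_section X f [ltr (i + rh h)]) * emb X (tree_section X f' [ltr i])"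
      by (rule emb_mult) (use f sect_S S_sub in auto)
    finally show ?thesis using f by (simp add: sc_emb)
  qed
next
  fix g i assume "g \<in> GG"
  then show "sc g i \<in> GG" by (auto simp: GG_def sc_emb sect_S)
next
  fix g i j assume "qq dvd i - j"
  then show "sc g i = sc g j" using ltr_eq_iff[of i j] by (simp add: sc_def)
qed

text \<open>Ties the abstract level stabilisers to the action on words; an element of all of them
  fixes every word and is trivial.\<close>

lemma fixes_if_in_lev:
  "f \<in> carrier S \<Longrightarrow> emb X f \<in> lev n \<Longrightarrow> w \<in> lists X \<Longrightarrow> length w \<le> n \<Longrightarrow> f w = w"
proof (induction n arbitrary: f w)
  case 0
  then show ?case using S_sub[OF 0(1)] by (simp add: tree_auts_def)
next
  case (Suc n)
  show ?case
  proof (cases w)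
    case Nil
    then show ?thesis using S_sub[OF Suc.prems(1)] by (simp add: tree_auts_def)
  next
    case (Cons y u)
    then have yu: "y \<in> X" "u \<in> lists X" "length u \<le> n" using Suc.prems by auto
    have l: "emb X f \<in> S1" "\<And>i. sc (emb X f) i \<in> lev n"
      using Suc.prems(2) by (auto simp: lev_Suc lift_def)
    have "ltr (rh (emb X f)) = ltr 0" using S1_rho[OF l(1)] by (simp add: ltr_eq_iff)
    then have fy: "f [y] = [y]" using rh_emb[OF Suc.prems(1)] yu(1) by (simp add: trans_by_def ltr_0)
    obtain i where i: "y = ltr i" using ltr_surj[OF yu(1)] by blast
    have "tree_section X f [y] u = u"
      using Suc.IH[OF sect_S[OF Suc.prems(1), of i] _ yu(2,3)] l(2)[of i] sc_emb[OF Suc.prems(1), of i] i by simp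
    then show ?thesis using tree_section_eq[OF S_sub[OF Suc.prems(1)], of "[y]" u] yu Cons fy by simp
  qed
qed

sublocale faithful_self_similar GG qq rh sc
proof
  fix g assume g: "g \<in> GG" and l: "\<And>n. g \<in> lev n"
  obtain f where f: "f \<in> carrier S" "g = emb X f" using g by (auto simp: GG_def)
  have "f = \<one>\<^bsub>A\<^esub>"
  proof (rule extensionalityI[of _ "lists X"])
    show "f \<in> extensional (lists X)" by (rule tree_auts_extensional[OF S_sub[OF f(1)]])
    show "\<one>\<^bsub>A\<^esub> \<in> extensional (lists X)" by (simp add: tree_one)
    fix w assume "w \<in> lists X"
    then show "f w = \<one>\<^bsub>A\<^esub> w" using fixes_if_in_lev[OF f(1), of "length w" w] l f(2) by (simp add: tree_one)
  qed
  then show "g = 1" using f emb_one by simp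
qed

definition DD :: "'a list_perm set" where "DD = emb X ` D"

definition EE :: "'a list_perm \<Rightarrow> int \<Rightarrow> int" where "EE d i = (SOME e. sc d i = ro e)"

lemma rooted_S: "s \<in> X \<Longrightarrow> rooted R s \<in> carrier S"
  using gens_S by (auto simp: rooted_auts_def)

lemma D_S: "d \<in> D \<Longrightarrow> d \<in> carrier S" using gens_S by auto

lemma sc_directed: assumes "d \<in> D" "\<not> qq dvd i" shows "sc (emb X d) i = ro (EE (emb X d) i)"
proof -
  have "ltr i \<noteq> \<one>" using ltr_eq_iff[of i 0] assms by (simp add: ltr_0)
  then have "tree_section X d [ltr i] \<in> rooted_auts R"
    using directed[OF assms(1)] by (simp add: directed_aut_def)
  then obtain s where "s \<in> X" "tree_section X d [ltr i] = rooted R s" by (auto simp: rooted_auts_def)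
  moreover obtain e where "s = ltr e" using ltr_surj \<open>s \<in> X\<close> by blast
  ultimately have "sc (emb X d) i = ro e" by (simp add: sc_emb D_S assms ro_def)
  then show ?thesis unfolding EE_def by (rule someI)
qed

lemma ro_add: "ro (s + t) = ro s * ro t"
  by (simp add: ro_def ltr_add rooted_mult emb_mult rooted_in_tree_auts[OF R.is_group])

lemma ro_eq_iff: "ro s = ro t \<longleftrightarrow> qq dvd s - t"
proof
  assume "ro s = ro t"
  then have "rooted R (ltr s) = rooted R (ltr t)"
    unfolding ro_def by (intro emb_inj[of _ X]) (auto intro: rooted_in_tree_auts[OF R.is_group])
  then have "rooted R (ltr s) [\<one>] = rooted R (ltr t) [\<one>]" by simp
  then show "qq dvd s - t" by (simp add: rooted_apply ltr_eq_iff)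
next
  assume "qq dvd s - t"
  then have "ltr s = ltr t" by (simp add: ltr_eq_iff)
  then show "ro s = ro t" by (simp add: ro_def)
qed

lemma GG_gen: "GG = gen (range ro \<union> DD)"
proof
  have sub: "emb X f \<in> gen (range ro \<union> DD)" if "f \<in> carrier S" for f
    using that
  proof (induction rule: S_induct)
    case one
    then show ?case by (simp add: emb_one)
  next
    case (gen f)
    then have "emb X f \<in> range ro \<union> DD"
      using ltr_surj by (auto simp: rooted_auts_def DD_def ro_def) blast
    then show ?case by (rule gen_incl)
  next
    case (mult f g)
    then show ?case using subgrp_mult[OF subgrp_gen] by (simp add: emb_mult S_sub)
  qed
  then show "GG \<subseteq> gen (range ro \<union> DD)" by (auto simp: GG_def)
  show "gen (range ro \<union> DD) \<subseteq> GG"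
    using rooted_S D_S by (intro gen_least[OF G]) (auto simp: GG_def DD_def ro_def)
qed

lemma subgrp_DD: "subgrp DD"
  unfolding subgrp_def DD_def
proof (intro conjI ballI)
  show "1 \<in> emb X ` D" by (rule image_eqI[where f = "emb X", OF emb_one[symmetric] subgroup.one_closed[OF D]])
next
  fix f g assume "f \<in> emb X ` D" "g \<in> emb X ` D"
  then obtain f' g' where f: "f' \<in> D" "f = emb X f'" "g' \<in> D" "g = emb X g'" by auto
  have "f' \<otimes>\<^bsub>A\<^esub> g' \<in> D" using subgroup.m_closed[OF D] f by blast
  moreover have "f * g = emb X (f' \<otimes>\<^bsub>A\<^esub> g')" using f by (simp add: emb_mult D_in)
  ultimately show "f * g \<in> emb X ` D" by blast
next
  fix f assume "f \<in> emb X ` D"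
  then obtain f' where f: "f' \<in> D" "f = emb X f'" by auto
  have i: "inv\<^bsub>A\<^esub> f' \<in> D" using subgroup.m_inv_closed[OF D] f by blast
  have "emb X (f' \<otimes>\<^bsub>A\<^esub> inv\<^bsub>A\<^esub> f') = 1"
    using group.r_inv[OF group_tree_aut_group, of f' X] f D_in by (simp add: carrier_A emb_one)
  then have "emb X f' * emb X (inv\<^bsub>A\<^esub> f') = 1" using f i by (simp add: emb_mult D_in)
  then have "inverse f = emb X (inv\<^bsub>A\<^esub> f')" using f by (simp only: mg_eq_1_iff)
  then show "inverse f \<in> emb X ` D" using i by blast
qed

text \<open>With \<open>r = ltr e\<close>, the generator \<open>x\<close> is a power of
  \<open>r\<close>, so \<open>e * m\<close> is 1 modulo \<open>qq\<close> for some \<open>m\<close>,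
  and \<open>p\<close> cannot divide \<open>e\<close>.\<close>

lemma d0_unit: "\<not> int p dvd EE (emb X d0) 1"
proof
  assume pd: "int p dvd EE (emb X d0) 1"
  define e where "e = EE (emb X d0) 1"
  have nq1: "\<not> qq dvd 1" using q_gt_1 by auto
  have "ltr 1 = x" using x by (simp add: ltr_def)
  then have "emb X (rooted R r) = ro e"
    using sc_directed[OF d0 nq1] r(2) by (simp add: sc_emb D_S d0 e_def)
  then have "rooted R r = rooted R (ltr e)"
    unfolding ro_def using r(1) by (intro emb_inj[of _ X]) (auto intro: rooted_in_tree_auts[OF R.is_group])
  then have "rooted R r [\<one>] = rooted R (ltr e) [\<one>]" by simp
  then have re: "r = ltr e" using r(1) by (simp add: rooted_apply)
  have "x \<in> generate R {r}" using r(3) x(1) by simp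
  then obtain m :: int where "x = r [^] m" using R.generate_pow[OF r(1)] by auto
  then have "ltr 1 = ltr (e * m)"
    using x(1) re by (simp add: ltr_def R.int_pow_pow)
  then have "qq dvd 1 - e * m" by (simp add: ltr_eq_iff)
  moreover have "int p dvd qq" using k_pos by (simp add: qq_def dvd_power)
  ultimately have "int p dvd 1 - e * m" by (rule dvd_trans[rotated])
  moreover have "int p dvd e * m" using pd by (simp add: e_def)
  ultimately have "int p dvd 1" by (simp add: dvd_diff_left_iff)
  then show False using prime_gt_1_nat[OF prime_p] by simp
qed

lemma torsion_GG: assumes "g \<in> GG" shows "\<exists>n::nat. n > 0 \<and> g ^ n = 1"
proof -
  obtain f where f: "f \<in> carrier S" "g = emb X f" using assms by (auto simp: GG_def)
  have pow: "emb X (f [^]\<^bsub>S\<^esub> n) = g ^ n" for n :: nat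
  proof (induction n)
    case 0
    then show ?case by (simp add: nat_pow_def one_S emb_one)
  next
    case (Suc n)
    have "f [^]\<^bsub>S\<^esub> n \<in> carrier S"
      using monoid.nat_pow_closed[OF group.is_monoid[OF group_S] f(1)] .
    then show ?case using Suc f emb_mult_S by (simp add: nat_pow_def power_commutes)
  qed
  obtain n :: nat where "n > 0" "f [^]\<^bsub>S\<^esub> n = \<one>\<^bsub>S\<^esub>"
    using periodic f(1) unfolding periodic_group_def by blast
  then show ?thesis using pow[of n] by (auto simp: one_S emb_one)
qed

sublocale ggs GG qq rh sc ro DD EE "int p" k "emb X d0"
proof
  show "prime (int p)" using prime_p by simp
  show "k > 0" by (rule k_pos)
  show "qq = int p ^ k" by (simp add: qq_def)
  show "ro s \<in> GG" for s by (simp add: ro_def GG_def rooted_S)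
  show "ro (s + t) = ro s * ro t" for s t by (rule ro_add)
  show "ro s = ro t" if "qq dvd s - t" for s t using that by (simp add: ro_eq_iff)
  show "qq dvd rh (ro s) - s" for s
  proof (rule trans_by_unique)
    show "trans_by (rooted R (ltr s)) (rh (ro s))" unfolding ro_def by (intro rh_emb rooted_S) simp
    show "trans_by (rooted R (ltr s)) s" by (simp add: trans_by_def rooted_apply)
  qed
  show "sc (ro s) i = 1" for s i
    by (simp add: ro_def sc_emb rooted_S section_rooted emb_one)
  show "DD \<subseteq> GG" using D_S by (auto simp: DD_def GG_def)
  show "subgrp DD" by (rule subgrp_DD)
  show "GG = gen (range ro \<union> DD)" by (rule GG_gen)
  show "emb X d0 \<in> DD" using d0 by (simp add: DD_def)
  show "\<not> int p dvd EE (emb X d0) 1" by (rule d0_unit)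
  show "\<exists>n>0. g ^ n = 1" if "g \<in> GG" for g using torsion_GG[OF that] .
next
  fix d assume "d \<in> DD"
  then obtain f where f: "f \<in> D" "d = emb X f" by (auto simp: DD_def)
  note df = directed[OF f(1), unfolded directed_aut_def]
  have "trans_by f 0" using df by (simp add: trans_by_def ltr_0)
  then show "qq dvd rh d" using trans_by_unique[OF rh_emb[OF D_S[OF f(1)]], of 0] f by simp
  show "sc d i = d" if "qq dvd i" for i
  proof -
    have "ltr i = \<one>" using that ltr_eq_iff[of i 0] by (simp add: ltr_0)
    then show ?thesis using df f by (simp add: sc_emb D_S)
  qed
  show "sc d i = ro (EE d i)" if "\<not> qq dvd i" for i using sc_directed[OF f(1) that] f by simp
qed

section \<open>Transfer of index and maximality to the original group\<close>

lemma finite_rcosets_if_fin_index: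
  assumes H: "subgroup H S" and fi: "fin_index (emb X ` H) GG"
  shows "finite (rcosets\<^bsub>S\<^esub> H)"
proof -
  interpret S: group S by (rule group_S)
  obtain c :: "'a list_perm \<Rightarrow> nat" where c: "finite (c ` GG)"
    "\<And>a b. a \<in> GG \<Longrightarrow> b \<in> GG \<Longrightarrow> c a = c b \<Longrightarrow> inverse a * b \<in> emb X ` H"
    using fi unfolding fin_index_def by blast
  \<comment> \<open>Colours compare \<open>inverse a * b\<close>, hence left cosets; colouring the
    inverse yields right cosets.\<close>
  define col where "col = (\<lambda>a. c (inverse (emb X a)))"
  have inG: "inverse (emb X a) \<in> GG" if "a \<in> carrier S" for a
    using that G_inv by (simp add: GG_def)
  have fin_col: "finite (col ` carrier S)"
    by (rule finite_subset[OF _ c(1)]) (use inG in \<open>auto simp: col_def\<close>)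
  have eq: "H #>\<^bsub>S\<^esub> a = H #>\<^bsub>S\<^esub> b" if ab: "a \<in> carrier S" "b \<in> carrier S" "col a = col b" for a b
  proof -
    have "inverse (inverse (emb X a)) * inverse (emb X b) \<in> emb X ` H"
      using c(2)[OF inG inG] ab unfolding col_def by blast
    then obtain h where h: "h \<in> H" "emb X a * inverse (emb X b) = emb X h" by auto
    have hS: "h \<in> carrier S" using subgroup.mem_carrier[OF H h(1)] .
    have "emb X (a \<otimes>\<^bsub>S\<^esub> inv\<^bsub>S\<^esub> b) = emb X h"
      using h ab by (simp add: emb_mult_S emb_inv_S)
    then have "a \<otimes>\<^bsub>S\<^esub> inv\<^bsub>S\<^esub> b = h"
      using ab hS by (intro emb_inj[of _ X]) (auto intro!: S_sub S.m_closed)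
    then have "a = h \<otimes>\<^bsub>S\<^esub> b" using ab hS by (auto simp: S.m_assoc)
    then have "a \<in> H #>\<^bsub>S\<^esub> b" using h(1) by (auto simp: r_coset_def)
    from S.repr_independence[OF this ab(2) H] show ?thesis by (rule sym)
  qed
  define rep where "rep = (\<lambda>n. SOME a. a \<in> carrier S \<and> col a = n)"
  have rep: "rep (col a) \<in> carrier S \<and> col (rep (col a)) = col a" if "a \<in> carrier S" for a
    unfolding rep_def by (rule someI[of _ a]) (use that in simp)
  have "rcosets\<^bsub>S\<^esub> H \<subseteq> (\<lambda>n. H #>\<^bsub>S\<^esub> rep n) ` col ` carrier S"
  proof
    fix C assume "C \<in> rcosets\<^bsub>S\<^esub> H"
    then obtain a where a: "a \<in> carrier S" "C = H #>\<^bsub>S\<^esub> a" by (auto simp: RCOSETS_def)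
    then have "C = H #>\<^bsub>S\<^esub> rep (col a)" using eq[of a "rep (col a)"] rep[OF a(1)] by simp
    then show "C \<in> (\<lambda>n. H #>\<^bsub>S\<^esub> rep n) ` col ` carrier S" using a(1) by blast
  qed
  moreover have "finite ((\<lambda>n. H #>\<^bsub>S\<^esub> rep n) ` col ` carrier S)" using fin_col by (rule finite_imageI)
  ultimately show ?thesis by (rule finite_subset)
qed

lemma subgrp_emb: assumes H: "subgroup H S" shows "subgrp (emb X ` H)"
  unfolding subgrp_def
proof (intro conjI ballI)
  note m = subgroup.mem_carrier[OF H]
  have "1 = emb X \<one>\<^bsub>S\<^esub>" by (simp only: one_S emb_one)
  then show "1 \<in> emb X ` H" using subgroup.one_closed[OF H] by (rule image_eqI)
  fix a assume "a \<in> emb X ` H"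
  then obtain f where f: "f \<in> H" "a = emb X f" by auto
  have "inverse a = emb X (inv\<^bsub>S\<^esub> f)" unfolding f(2) by (rule emb_inv_S[OF m[OF f(1)], symmetric])
  then show "inverse a \<in> emb X ` H" using subgroup.m_inv_closed[OF H f(1)] by (rule image_eqI)
  fix b assume "b \<in> emb X ` H"
  then obtain g where g: "g \<in> H" "b = emb X g" by auto
  have "a * b = emb X (f \<otimes>\<^bsub>S\<^esub> g)"
    unfolding f(2) g(2) by (rule emb_mult_S[OF m[OF f(1)] m[OF g(1)], symmetric])
  then show "a * b \<in> emb X ` H" using subgroup.m_closed[OF H f(1) g(1)] by (rule image_eqI)
qed

lemma subgroup_vimage:
  assumes L: "subgrp L" shows "subgroup {f \<in> carrier S. emb X f \<in> L} S"
proof -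
  interpret S: group S by (rule group_S)
  show ?thesis
  proof (rule S.subgroupI)
    have "emb X \<one>\<^bsub>S\<^esub> = 1" by (simp only: one_S emb_one)
    then have "\<one>\<^bsub>S\<^esub> \<in> {f \<in> carrier S. emb X f \<in> L}" using subgrp_one[OF L] by simp
    then show "{f \<in> carrier S. emb X f \<in> L} \<noteq> {}" by blast
  qed (use subgrp_mult[OF L] subgrp_inv[OF L] in \<open>auto simp: emb_mult_S emb_inv_S\<close>)
qed

text \<open>\<open>emb\<close> is an injective homomorphism on the spinal group, so the subgroups
  above \<open>H\<close> correspond to those between the image of \<open>H\<close> and
  \<open>GG\<close>, and maximality carries over.\<close>

theorem in_MF_S: "in_MF S"
  unfolding in_MF_def
proof (intro conjI allI impI)
  show "group S" by (rule group_S)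
  fix H assume max: "maximal_subgroup H S"
  then have H: "subgroup H S" "H \<noteq> carrier S"
    and Hmax: "\<And>K. subgroup K S \<Longrightarrow> H \<subseteq> K \<Longrightarrow> K = H \<or> K = carrier S"
    by (auto simp: maximal_subgroup_def)
  have HS: "H \<subseteq> carrier S" by (rule subgroup.subset[OF H(1)])
  have inj: "f = g" if "f \<in> carrier S" "g \<in> carrier S" "emb X f = emb X g" for f g
    using that by (intro emb_inj[of f X g] S_sub)
  have "fin_index (emb X ` H) GG"
  proof (rule maximal_fin_index)
    show "subgrp (emb X ` H)" by (rule subgrp_emb[OF H(1)])
    show "emb X ` H \<subseteq> GG" using HS by (auto simp: GG_def)
    show "emb X ` H \<noteq> GG"
    proof
      assume eq: "emb X ` H = GG"
      have "f \<in> H" if f: "f \<in> carrier S" for f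
      proof -
        have "emb X f \<in> emb X ` H" using f eq by (simp add: GG_def)
        then obtain h where "h \<in> H" "emb X f = emb X h" by auto
        then show ?thesis using inj[OF f, of h] HS by blast
      qed
      then show False using H(2) HS by blast
    qed
    fix K assume K: "subgrp K" "K \<subseteq> GG" "emb X ` H \<subseteq> K"
    define K' where "K' = {f \<in> carrier S. emb X f \<in> K}"
    have KK': "K = emb X ` K'" using K(2) by (auto simp: K'_def GG_def)
    have "H \<subseteq> K'" using HS K(3) by (auto simp: K'_def)
    then have "K' = H \<or> K' = carrier S"
      using Hmax[of K'] subgroup_vimage[OF K(1)] by (simp add: K'_def)
    then show "K = emb X ` H \<or> K = GG" using KK' by (auto simp: GG_def)
  qed
  then show "finite (rcosets\<^bsub>S\<^esub> H)" by (rule finite_rcosets_if_fin_index[OF H(1)])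
qed

end

theorem mainTheorem1:
  fixes R :: "('a, 'b) monoid_scheme"
    and D :: "('a list \<Rightarrow> 'a list) set"
  assumes "multi_GGS R D"
    and "primary R"
    and "periodic_group (spinal_group R D)"
    and "\<exists>d\<in>D. \<exists>x\<in>carrier R. generate R {x} = carrier R \<and>
           (\<exists>r\<in>carrier R. tree_section (carrier R) d [x] = rooted R r \<and>
              generate R {r} = carrier R)"
  shows "in_MF (spinal_group R D)"
proof -
  obtain d x r where d: "d \<in> D" and x: "x \<in> carrier R" "generate R {x} = carrier R"
    and r: "r \<in> carrier R" "tree_section (carrier R) d [x] = rooted R r" "generate R {r} = carrier R"
    using assms(4) by blast
  obtain p k where pk: "prime p" "k > 0" "order R = p ^ k"
    using assms(2) unfolding primary_def primepow_def by blast
  have c: "group R" "finite (carrier R)" "subgroup D (tree_aut_group (carrier R))"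
    "\<And>d. d \<in> D \<Longrightarrow> directed_aut R d"
    using assms(1) by (auto simp: multi_GGS_def constant_spinal_def)
  have "cyclic_spinal R D x r p k d"
    by (intro cyclic_spinal.intro cyclic_spinal_axioms.intro c d x r pk assms(3))
  then show ?thesis by (rule cyclic_spinal.in_MF_S)
qed

end
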